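(* Let $X_\sigma=\operatorname{Spec}(k[\Lambda])$ be a three-dimensional isolated affine toric Gorenstein singularity over a field $k$ of characteristic $0$. Then the cup product $T^1(-R^* )\times T^1(-R^* )\to T^2(-2R^* )$, which under the identifications $T^1(-R^* )\cong V/(k\cdot\underline 1)$ and $T^2(-2R^* )\cong\ker\eta/\operatorname{im}\delta$ is the bilinear map $$V/(k\cdot\underline 1)\times V/(k\cdot\underline 1)\to\ker\eta/\operatorname{im}\delta,\qquad(\underline t,\underline s)\mapsto(s_1t_1d_1,\dots,s_Nt_Nd_N),$$ gives Altmann's cup product $$V/(k\cdot\underline 1)\times V/(k\cdot\underline 1)\to (M_k/R^* )^*,\qquad (\underline t,\underline s)\mapsto\sum_{j=1}^Ns_jt_jd_j,$$ where $T^2(-2R^* )\cong\ker\eta/\operatorname{im}\delta$ is identified with $(M_k/R^* )^*$ by the isomorphism $\ker\eta/\operatorname{im}\delta\cong(M_k/R^* )^*$ given explicitly by summation of components, $(q_1,\dots,q_N)\mapsto\sum_jq_j$ for $(q_1,\dots,q_N)\in\ker\eta\subset N_k^N$.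
   Context: **Toric setting.** $k$ is a field of characteristic $0$; $M,N$ are mutually dual free abelian groups of rank $3$ (the letter $N$ also denotes the number of generators below), $N_k=N\otimes_{\mathbb Z}k$, $M_k=M\otimes_{\mathbb Z}k$, with pairing $\langle\cdot,\cdot\rangle$. Let $P$ be a lattice polygon in the affine hyperplane $\mathbb R^2\times\{1\}\subset \mathbb R^3=N_{\mathbb R}$, $\sigma=\operatorname{Cone}(P)=\langle a_1,\dots,a_N\rangle$, where $a_1,\dots,a_N\in N$ are the vertices of $P$ arranged in a cycle, $a_{N+1}:=a_1$. Put $\Lambda=\sigma^\vee\cap M$, $R^*=(0,0,1)\in M$ (so $\langle a_j,R^*\rangle=1$ for all $j$), $d_j:=a_{j+1}-a_j$, $\ell(d_j)$ the lattice length of $d_j$, and $$V=\{\underline t=(t_1,\dots,t_N)\in k^N\mid \textstyle\sum_{j=1}^N t_jd_j=0\},\qquad \underline 1=(1,\dots,1).$$ $X_\sigma$ is isolated exactly when $\ell(d_j)=1$ for all $j$. $(M_k/R^* )^*$ denotes the dual of $M_k/(k\cdot R^* )$, regarded as $\{b\in N_k\mid\langle b,R^*\rangle=0\}=(R^* )^\perp$. For $R\in M$ let $\Lambda(R)=\Lambda+R$ and $K_{a_j}^R=\{r\in\Lambda\mid \langle a_j,r\rangle<\langle a_j,R\rangle\}$; one has $\Lambda\setminus\Lambda(R)=\bigcup_jK^R_{a_j}$. **Harrison cochains.** For $Q\subset\Lambda$ let $S_n(Q)=\{(\lambda_1,\dots,\lambda_n)\in Q^n\mid \sum_v\lambda_v\in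 Q\}$. Let $s_{i,n-i}=\sum(\operatorname{sgn}\pi)\pi$ over permutations $\pi\in S_n$ with $\pi(1)<\dots<\pi(i)$ and $\pi(i+1)<\dots<\pi(n)$, and $s_n=\sum_{i=1}^{n-1}s_{i,n-i}$, acting on $n$-tuples by $\pi(\lambda_1,\dots,\lambda_n)=(\lambda_{\pi^{-1}(1)},\dots,\lambda_{\pi^{-1}(n)})$. For $L=\Lambda$, $L=\Lambda\setminus\Lambda(R)$, or $L$ an intersection of sets $K^R_{a_j}$, let $C^n_{(1)}(L;k)$ be the space of functions $\varphi:S_n(L)\to k$ with $\varphi\circ s_n=0$ ($\varphi$ extended linearly), and let $C^n_{(1)}(\Lambda,\Lambda\setminus\Lambda(R);k)\subset C^n_{(1)}(\Lambda;k)$ be the subspace of those vanishing on $S_n(\Lambda\setminus\Lambda(R))$. The differential is $$(d\varphi)(\lambda_1,\dots,\lambda_n)=\varphi(\lambda_2,\dots,\lambda_n)+\sum_{i=1}^{n-1}(-1)^i\varphi(\lambda_1,\dots,\lambda_i+\lambda_{i+1},\dots,\lambda_n)+(-1)^n\varphi(\lambda_1,\dots,\lambda_{n-1}),$$ and $H^n_{(1)}(\cdot)$ denotes the cohomology. $H^1_{(1)}(L;k)$ is the space of functions $f:L\to k$ with $f(a+b)=f(a)+f(b)$ whenever $a,b,a+b\in L$. Set $T^{n-1}(-R):=H^n_{(1)}(\Lambda,\Lambda\setminus\Lambda(R);k)$ (this is the degree $-R$ part of the André–Quillen cohomology $T^{n-1}(k[\Lambda])$). **Cup product.** For $R,S\in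 M$ the cup product $T^1(-R)\times T^1(-S)\to T^2(-R-S)$ is induced by $$[f,g](\lambda_1,\lambda_2,\lambda_3)=f(-S+\lambda_1+\lambda_2,\lambda_3)g(\lambda_1,\lambda_2)-f(\lambda_1,-S+\lambda_2+\lambda_3)g(\lambda_2,\lambda_3)+g(-R+\lambda_1+\lambda_2,\lambda_3)f(\lambda_1,\lambda_2)-g(\lambda_1,-R+\lambda_2+\lambda_3)f(\lambda_2,\lambda_3)$$ for $f\in C^2_{(1)}(\Lambda,\Lambda\setminus\Lambda(R);k)$, $g\in C^2_{(1)}(\Lambda,\Lambda\setminus\Lambda(S);k)$; a product is read as $0$ when one of its arguments is not in $\Lambda$ (then the other factor vanishes). **Identification of $T^1(-R^* )$.** For $\underline t\in V$ choose $b_1,\dots,b_N\in (R^* )^\perp\subset N_k$ with $b_{j+1}-b_j=t_jd_j$ for all $j$ (cyclically). The functions $\langle b_j,\cdot\rangle$ on $K^{R^*}_{a_j}$ glue to $\xi\in H^1_{(1)}(\Lambda\setminus\Lambda(R^* );k)$. Let $\xi^0:\Lambda\to k$ be the extension of $\xi$ by $0$. The class of $d\xi^0$ in $T^1(-R^* )$ depends only on $\underline t$ modulo $k\cdot\underline 1$, and $\underline t\mapsto\overline{d\xi^0}$ is the identification $V/(k\cdot\underline1)\cong T^1(-R^* )$. **Identification of $T^2(-2R^* )$ with $\ker\eta/\operatorname{im}\delta$ (isolated case).** When all $\ell(d_j)=1$, one has $\operatorname{span}_k(K^{2R^*}_{a_j})=\operatorname{span}_k(K^{2R^*}_{a_j}\cap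 K^{2R^*}_{a_{j+1}})=M_k$. Consider $$N_k^N\xrightarrow{\ \delta\ }N_k^N\xrightarrow{\ \eta\ }\Big(\operatorname{span}_k\big(\textstyle\bigcap_jK^{2R^*}_{a_j}\big)\Big)^*,\qquad \delta(b_1,\dots,b_N)=(b_1-b_2,\dots,b_N-b_1),\quad \eta(q_1,\dots,q_N)=\sum_jq_j.$$ Given a cocycle $c\in C^3_{(1)}(\Lambda,\Lambda\setminus\Lambda(2R^* );k)$ there are $C\in C^2_{(1)}(\Lambda;k)$ with $dC=c$ and $G_j\in C^1_{(1)}(K^{2R^*}_{a_j};k)$ with $dG_j=C|_{K^{2R^*}_{a_j}}$. Then $(G_j-G_{j+1})_j$ is an element of $\bigoplus_jH^1_{(1)}(K^{2R^*}_{a_j}\cap K^{2R^*}_{a_{j+1}};k)$ defining a class in the cohomology at the middle term of $\bigoplus_jH^1_{(1)}(K^{2R^*}_{a_j};k)\to\bigoplus_jH^1_{(1)}(K^{2R^*}_{a_j}\cap K^{2R^*}_{a_{j+1}};k)\to H^1_{(1)}(\bigcap_jK^{2R^*}_{a_j};k)$ (maps defined by the same formulas as $\delta$, $\eta$). This identifies $T^2(-2R^* )$ with that cohomology, and restricting linear functions to the sets in question identifies $\ker\eta/\operatorname{im}\delta$ with the same cohomology; together these give $T^2(-2R^* )\cong\ker\eta/\operatorname{im}\delta$.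
   Formalization: With the context's signs the product is -(s_j t_j d_j), so T^2(-2R^* ) ≅ ker η/im δ is taken via (G_{j+1}-G_j) instead; summation is claimed to be onto (M_k/R^* )^* only when X_σ is neither smooth nor the conifold xy=zw, since there ker η = im δ. *)

theory Defs
  imports "HOL-Analysis.Analysis" "HOL-Combinatorics.Permutations"
begin

text \<open>
  Both \<open>M\<close> and \<open>N\<close> are realised as \<open>int ^ 3\<close>, mutually dual via \<open>pairing\<close>; \<open>N\<^sub>k\<close> and \<open>M\<^sub>k\<close> are
  \<open>'k ^ 3\<close>.  The generators are \<open>a 0, ..., a (N - 1)\<close>, and the index after \<open>j\<close> is \<open>Suc j mod N\<close>.
  A tuple indexed by the generators is a function on \<open>nat\<close> vanishing from \<open>N\<close> on.
\<close>

type_synonym lat = "int ^ 3"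

definition pairing :: "'a::comm_ring_1 ^ 3 \<Rightarrow> 'a ^ 3 \<Rightarrow> 'a" where
  "pairing x y = (\<Sum>i\<in>UNIV. x $ i * y $ i)"

definition ext :: "lat \<Rightarrow> 'a::ring_1 ^ 3" where
  "ext x = (\<chi> i. of_int (x $ i))"

definition Rstar :: lat where
  "Rstar = vector [0, 0, 1]"

definition lattice_polygon :: "(real ^ 3) set \<Rightarrow> nat \<Rightarrow> (nat \<Rightarrow> lat) \<Rightarrow> bool" where
  "lattice_polygon P N a \<longleftrightarrow>
     polytope P \<and> aff_dim P = 2 \<and> P \<subseteq> {x. x $ 3 = 1} \<and>
     inj_on a {..<N} \<and> {x. x extreme_point_of P} = (\<lambda>j. ext (a j)) ` {..<N} \<and>
     (\<forall>j<N. closed_segment (ext (a j)) (ext (a (Suc j mod N))) edge_of P)"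

definition dvec :: "nat \<Rightarrow> (nat \<Rightarrow> lat) \<Rightarrow> nat \<Rightarrow> lat" where
  "dvec N a j = a (Suc j mod N) - a j"

definition lattice_length :: "lat \<Rightarrow> int" where
  "lattice_length d = Gcd (range (\<lambda>i. d $ i))"

definition isolated :: "nat \<Rightarrow> (nat \<Rightarrow> lat) \<Rightarrow> bool" where
  "isolated N a \<longleftrightarrow> (\<forall>j<N. lattice_length (dvec N a j) = 1)"

text \<open>
  The cone is smooth when its ray generators form a lattice basis; it is the cone of the
  conifold \<open>xy = zw\<close> when \<open>P\<close> is a unimodular parallelogram.  In these two cases the elements
  taking only the values 0 and 1 on the generators span \<open>M\<^sub>k\<close>, so that \<open>ker \<eta> = im \<delta>\<close>, whereas
  \<open>(M\<^sub>k / R\<^sup>*)\<^sup>*\<close> has dimension 2.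
\<close>

definition smooth_cone :: "nat \<Rightarrow> (nat \<Rightarrow> lat) \<Rightarrow> bool" where
  "smooth_cone N a \<longleftrightarrow> N = 3 \<and> \<bar>det (vector [a 0, a 1, a 2] :: int ^ 3 ^ 3)\<bar> = 1"

definition conifold_cone :: "nat \<Rightarrow> (nat \<Rightarrow> lat) \<Rightarrow> bool" where
  "conifold_cone N a \<longleftrightarrow> N = 4 \<and> a 0 + a 2 = a 1 + a 3 \<and>
     \<bar>det (vector [a 0, a 1, a 2] :: int ^ 3 ^ 3)\<bar> = 1"

definition toric_monoid :: "(real ^ 3) set \<Rightarrow> lat set" where
  "toric_monoid P = {r. \<forall>x\<in>cone hull P. 0 \<le> pairing x (ext r)}"

definition translate :: "lat set \<Rightarrow> lat \<Rightarrow> lat set" where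
  "translate L R = (\<lambda>r. r + R) ` L"

definition Kset :: "lat set \<Rightarrow> lat \<Rightarrow> lat \<Rightarrow> lat set" where
  "Kset L v R = {r \<in> L. pairing v r < pairing v R}"


subsection \<open>Harrison cochains\<close>

text \<open>
  A function on \<open>S\<^sub>n(Q)\<close> is represented by its extension by zero to all lists.  In particular
  cochains vanish on lists with an entry outside \<open>\<Lambda>\<close>.
\<close>

type_synonym 'k cochain = "lat list \<Rightarrow> 'k"

definition Stup :: "nat \<Rightarrow> lat set \<Rightarrow> lat list set" where
  "Stup n Q = {xs. length xs = n \<and> set xs \<subseteq> Q \<and> sum_list xs \<in> Q}"

definition shuffle_perms :: "nat \<Rightarrow> nat \<Rightarrow> (nat \<Rightarrow> nat) set" where
  "shuffle_perms i n =
     {p. p permutes {..<n} \<and> strict_mono_on {..<i} p \<and> strict_mono_on {i..<n} p}"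

definition shuffle_sum :: "nat \<Rightarrow> 'k::field_char_0 cochain \<Rightarrow> 'k cochain" where
  "shuffle_sum n \<phi> xs =
     (\<Sum>i = 1..<n. \<Sum>p\<in>shuffle_perms i n. of_int (sign p) * \<phi> (permute_list (inv p) xs))"

definition Harr :: "nat \<Rightarrow> lat set \<Rightarrow> 'k::field_char_0 cochain set" where
  "Harr n L = {\<phi>. (\<forall>xs. xs \<notin> Stup n L \<longrightarrow> \<phi> xs = 0) \<and> (\<forall>xs\<in>Stup n L. shuffle_sum n \<phi> xs = 0)}"

definition Harr_rel :: "nat \<Rightarrow> lat set \<Rightarrow> lat set \<Rightarrow> 'k::field_char_0 cochain set" where
  "Harr_rel n L D = {\<phi> \<in> Harr n L. \<forall>xs\<in>Stup n D. \<phi> xs = 0}"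

definition merge :: "nat \<Rightarrow> lat list \<Rightarrow> lat list" where
  "merge i xs = take (i - 1) xs @ [xs ! (i - 1) + xs ! i] @ drop (i + 1) xs"

text \<open>\<open>cobd n\<close> maps \<open>(n - 1)\<close>-cochains to \<open>n\<close>-cochains.\<close>

definition cobd :: "nat \<Rightarrow> lat set \<Rightarrow> 'k::field_char_0 cochain \<Rightarrow> 'k cochain" where
  "cobd n L \<phi> xs =
     (if xs \<in> Stup n L
      then \<phi> (tl xs) + (\<Sum>i = 1..<n. (- 1) ^ i * \<phi> (merge i xs)) + (- 1) ^ n * \<phi> (butlast xs)
      else 0)"

definition restr :: "nat \<Rightarrow> lat set \<Rightarrow> 'k::field_char_0 cochain \<Rightarrow> 'k cochain" where
  "restr n K \<phi> xs = (if xs \<in> Stup n K then \<phi> xs else 0)"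

definition H1 :: "lat set \<Rightarrow> (lat \<Rightarrow> 'k::field_char_0) set" where
  "H1 L = {h. \<forall>x\<in>L. \<forall>y\<in>L. x + y \<in> L \<longrightarrow> h (x + y) = h x + h y}"

definition T_cocycles :: "lat set \<Rightarrow> nat \<Rightarrow> lat \<Rightarrow> 'k::field_char_0 cochain set" where
  "T_cocycles L i R =
     {\<phi> \<in> Harr_rel (i + 1) L (L - translate L R). cobd (i + 2) L \<phi> = (\<lambda>_. 0)}"

definition T_rel :: "lat set \<Rightarrow> nat \<Rightarrow> lat \<Rightarrow> ('k::field_char_0 cochain \<times> 'k cochain) set" where
  "T_rel L i R = {(\<phi>, \<psi>). \<phi> \<in> T_cocycles L i R \<and> \<psi> \<in> T_cocycles L i R \<and>
     (\<exists>e\<in>Harr_rel i L (L - translate L R). (\<lambda>xs. \<phi> xs - \<psi> xs) = cobd (i + 1) L e)}"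

text \<open>\<open>T_space L i R\<close> is \<open>T\<^sup>i(-R)\<close>, the Harrison cohomology in degree \<open>i + 1\<close>.\<close>

definition T_space :: "lat set \<Rightarrow> nat \<Rightarrow> lat \<Rightarrow> 'k::field_char_0 cochain set set" where
  "T_space L i R = T_cocycles L i R // T_rel L i R"

definition bracket ::
  "lat \<Rightarrow> lat \<Rightarrow> 'k::field_char_0 cochain \<Rightarrow> 'k cochain \<Rightarrow> 'k cochain" where
  "bracket R S f g xs = (case xs of
     [x, y, z] \<Rightarrow>
         f [- S + x + y, z] * g [x, y] - f [x, - S + y + z] * g [y, z]
       + g [- R + x + y, z] * f [x, y] - g [x, - R + y + z] * f [y, z]
   | _ \<Rightarrow> 0)"

definition cup :: "lat set \<Rightarrow> lat \<Rightarrow> lat \<Rightarrow> 'k::field_char_0 cochain set \<Rightarrow> 'k cochain set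
    \<Rightarrow> 'k cochain set" where
  "cup L R S X Y = (\<Union>f\<in>X. \<Union>g\<in>Y. T_rel L 2 (R + S) `` {bracket R S f g})"


subsection \<open>The space \<open>V / (k \<cdot> 1)\<close> and its map to \<open>T\<^sup>1(-R\<^sup>*)\<close>\<close>

definition Vspace :: "nat \<Rightarrow> (nat \<Rightarrow> lat) \<Rightarrow> (nat \<Rightarrow> 'k::field_char_0) set" where
  "Vspace N a = {t. (\<forall>j\<ge>N. t j = 0) \<and> (\<Sum>j<N. t j *s ext (dvec N a j)) = 0}"

definition Vrel :: "nat \<Rightarrow> (nat \<Rightarrow> lat)
    \<Rightarrow> ((nat \<Rightarrow> 'k::field_char_0) \<times> (nat \<Rightarrow> 'k)) set" where
  "Vrel N a = {(t, t'). t \<in> Vspace N a \<and> t' \<in> Vspace N a \<and> (\<exists>c. \<forall>j<N. t j - t' j = c)}"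

text \<open>
  The functions \<open>\<xi>\<^sup>0\<close> arising from the possible choices of \<open>b\<close>.  As a cochain on
  \<open>\<Lambda> - \<Lambda>(R\<^sup>*)\<close>, the glued function is already extended by zero.
\<close>

definition glued :: "lat set \<Rightarrow> nat \<Rightarrow> (nat \<Rightarrow> lat) \<Rightarrow> (nat \<Rightarrow> 'k::field_char_0)
    \<Rightarrow> 'k cochain set" where
  "glued L N a t = {\<xi>. \<exists>b.
     (\<forall>j<N. pairing (b j) (ext Rstar) = 0 \<and> b (Suc j mod N) - b j = t j *s ext (dvec N a j)) \<and>
     (\<forall>j<N. \<forall>r\<in>Kset L (a j) Rstar. \<xi> [r] = pairing (b j) (ext r)) \<and>
     (\<forall>xs. xs \<notin> Stup 1 (L - translate L Rstar) \<longrightarrow> \<xi> xs = 0)}"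

definition T1_ident :: "lat set \<Rightarrow> nat \<Rightarrow> (nat \<Rightarrow> lat) \<Rightarrow> (nat \<Rightarrow> 'k::field_char_0) set
    \<Rightarrow> 'k cochain set" where
  "T1_ident L N a X = (\<Union>t\<in>X. \<Union>\<xi>\<in>glued L N a t. T_rel L 1 Rstar `` {cobd 2 L \<xi>})"


subsection \<open>The space \<open>ker \<eta> / im \<delta>\<close> and the map from \<open>T\<^sup>2(-2R\<^sup>*)\<close>\<close>

definition K2 :: "lat set \<Rightarrow> nat \<Rightarrow> (nat \<Rightarrow> lat) \<Rightarrow> nat \<Rightarrow> lat set" where
  "K2 L N a j = Kset L (a (j mod N)) (Rstar + Rstar)"

definition ktuples :: "nat \<Rightarrow> (nat \<Rightarrow> 'k::field_char_0 ^ 3) set" where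
  "ktuples N = {q. \<forall>j\<ge>N. q j = 0}"

definition delta :: "nat \<Rightarrow> (nat \<Rightarrow> 'k::field_char_0 ^ 3) \<Rightarrow> (nat \<Rightarrow> 'k ^ 3)" where
  "delta N b j = (if j < N then b j - b (Suc j mod N) else 0)"

text \<open>The linear form \<open>\<eta>(q)\<close> is zero iff \<open>\<Sum>\<^sub>j q\<^sub>j\<close> pairs to zero with the span.\<close>

definition ker_eta :: "lat set \<Rightarrow> nat \<Rightarrow> (nat \<Rightarrow> lat) \<Rightarrow> (nat \<Rightarrow> 'k::field_char_0 ^ 3) set" where
  "ker_eta L N a = {q \<in> ktuples N.
     \<forall>v\<in>vec.span (ext ` (\<Inter>j<N. K2 L N a j)). pairing (\<Sum>j<N. q j) v = 0}"

definition quot_rel :: "lat set \<Rightarrow> nat \<Rightarrow> (nat \<Rightarrow> lat)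
    \<Rightarrow> ((nat \<Rightarrow> 'k::field_char_0 ^ 3) \<times> (nat \<Rightarrow> 'k ^ 3)) set" where
  "quot_rel L N a = {(p, q). p \<in> ker_eta L N a \<and> q \<in> ker_eta L N a \<and>
     (\<lambda>j. p j - q j) \<in> delta N ` ktuples N}"

definition ker_mod_im :: "lat set \<Rightarrow> nat \<Rightarrow> (nat \<Rightarrow> lat)
    \<Rightarrow> (nat \<Rightarrow> 'k::field_char_0 ^ 3) set set" where
  "ker_mod_im L N a = ker_eta L N a // quot_rel L N a"

text \<open>
  For a class \<open>X\<close> in \<open>T\<^sup>2(-2R\<^sup>*)\<close>, all \<open>q\<close> in \<open>ker \<eta>\<close> whose restrictions represent the same class
  as \<open>(G\<^sub>j - G\<^sub>j\<^sub>+\<^sub>1)\<^sub>j\<close> modulo differences \<open>(h\<^sub>j - h\<^sub>j\<^sub>+\<^sub>1)\<^sub>j\<close>, for any cocycle \<open>c\<close> in \<open>X\<close> and any choice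
  of \<open>C\<close> and \<open>G\<close>.
\<close>

definition T2_connect :: "lat set \<Rightarrow> nat \<Rightarrow> (nat \<Rightarrow> lat) \<Rightarrow> 'k::field_char_0 cochain set
    \<Rightarrow> (nat \<Rightarrow> 'k ^ 3) set" where
  "T2_connect L N a X = {q \<in> ker_eta L N a.
     \<exists>c\<in>X. \<exists>C\<in>Harr 2 L. \<exists>G h.
       cobd 3 L C = c \<and>
       (\<forall>j<N. G j \<in> Harr 1 (K2 L N a j) \<and>
              cobd 2 (K2 L N a j) (G j) = restr 2 (K2 L N a j) C) \<and>
       (\<forall>j<N. h j \<in> H1 (K2 L N a j)) \<and>
       (\<forall>j<N. \<forall>r\<in>K2 L N a j \<inter> K2 L N a (Suc j).
          (G j [r] - G (Suc j mod N) [r]) - pairing (q j) (ext r) = h j r - h (Suc j mod N) r)}"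

text \<open>
  Sign normalisation.  With \<open>(df)(x, y) = f(y) - f(x + y) + f(x)\<close>, \<open>dC = c\<close>, \<open>dG\<^sub>j = C\<close> and the class
  of \<open>(G\<^sub>j - G\<^sub>j\<^sub>+\<^sub>1)\<^sub>j\<close>, the cup product of the classes of \<open>t\<close> and \<open>s\<close> is represented by
  \<open>- (s\<^sub>j t\<^sub>j d\<^sub>j)\<^sub>j\<close>.  The isomorphism onto \<open>ker \<eta> / im \<delta>\<close> is therefore normalised by \<open>- 1\<close>, that is,
  by the class of the Cech coboundary \<open>(G\<^sub>j\<^sub>+\<^sub>1 - G\<^sub>j)\<^sub>j\<close>.
\<close>

definition T2_ident :: "lat set \<Rightarrow> nat \<Rightarrow> (nat \<Rightarrow> lat) \<Rightarrow> 'k::field_char_0 cochain set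
    \<Rightarrow> (nat \<Rightarrow> 'k ^ 3) set" where
  "T2_ident L N a X = (\<lambda>q j. - q j) ` T2_connect L N a X"


subsection \<open>Altmann's cup product\<close>

text \<open>\<open>(M\<^sub>k / R\<^sup>*)\<^sup>*\<close>, regarded as the annihilator of \<open>R\<^sup>*\<close> in \<open>N\<^sub>k\<close>.\<close>

definition Rperp :: "('k::field_char_0 ^ 3) set" where
  "Rperp = {b. pairing b (ext Rstar) = 0}"

definition sum_class :: "nat \<Rightarrow> (nat \<Rightarrow> 'k::field_char_0 ^ 3) set \<Rightarrow> 'k ^ 3" where
  "sum_class N Q = the_elem ((\<lambda>q. \<Sum>j<N. q j) ` Q)"

definition prod_tuple :: "nat \<Rightarrow> (nat \<Rightarrow> lat) \<Rightarrow> (nat \<Rightarrow> 'k::field_char_0) \<Rightarrow> (nat \<Rightarrow> 'k)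
    \<Rightarrow> (nat \<Rightarrow> 'k ^ 3)" where
  "prod_tuple N a t s j = (if j < N then (s j * t j) *s ext (dvec N a j) else 0)"

definition altmann_cup :: "nat \<Rightarrow> (nat \<Rightarrow> lat) \<Rightarrow> (nat \<Rightarrow> 'k::field_char_0) \<Rightarrow> (nat \<Rightarrow> 'k)
    \<Rightarrow> 'k ^ 3" where
  "altmann_cup N a t s = (\<Sum>j<N. (s j * t j) *s ext (dvec N a j))"

end

theory Submission
  imports Defs "HOL-Algebra.Group"
begin

text \<open>
  Put \<open>R = R\<^sup>*\<close>.  A class in \<open>T\<^sup>1(-R)\<close> is represented by \<open>d\<xi>\<close>, where \<open>\<xi>\<close> is the function on the
  monoid that equals the linear form \<open>b\<^sub>j\<close> on the facet orthogonal to \<open>a\<^sub>j\<close> and vanishes on \<open>R + \<Lambda>\<close>.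
  Multiplication by \<open>\<xi>\<close> followed by a shift by \<open>-R\<close> is a linear operator on the group algebra \<open>k[M]\<close>,
  and \<open>d\<xi>\<close> is its commutator with the multiplication \<open>\<mu>\<close>.  So the bracket of \<open>d\<xi>\<close> and \<open>d\<zeta>\<close> is
  \<open>[[\<mu>, \<xi>], [\<mu>, \<zeta>]]\<close>, which by the Jacobi identity is up to sign the coboundary of \<open>[\<xi>, [\<mu>, \<zeta>]]\<close>.
  Only products of values inside \<open>\<Lambda>\<close> survive, hence this identity of cochains on \<open>M\<close> descends to
  \<open>\<Lambda>\<close> with all functions extended by zero (\<open>bracket_eq_lie_cobd\<close>).  The same
  formula shows that changing a representative changes the bracket by a relative coboundary, so the
  cup product of classes is the class of this single bracket (\<open>cup_eq\<close>).

  The connecting map to \<open>ker \<eta> / im \<delta>\<close> asks for primitives of that cochain on the slabs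
  \<open>\<langle>a\<^sub>j, r\<rangle> \<le> 1\<close>.  There \<open>\<xi> - b\<^sub>j\<close> and \<open>\<zeta> - b'\<^sub>j\<close> vanish at level \<open>0\<close>, and
  \<open>g\<^sub>j = b\<^sub>j \<zeta> + \<xi> b'\<^sub>j - b\<^sub>j b'\<^sub>j\<close> is a primitive (\<open>lie_cochain_local_primitive\<close>).  On the
  intersection of two neighbouring slabs the values of \<open>d\<^sub>j\<close> are \<open>0\<close>, \<open>1\<close> or \<open>-1\<close>, and
  \<open>g\<^sub>j - g\<^sub>j\<^sub>+\<^sub>1 = s\<^sub>j t\<^sub>j d\<^sub>j\<close> exactly (\<open>local_primitive_difference\<close>).

  For this tuple to determine the class, the choices in the connecting map must not matter
  (\<open>T2_connect_eq\<close>).  This rests on three facts: a symmetric 2-cocycle on \<open>\<Lambda>\<close> is a coboundary,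
  because the commutative extension of \<open>\<Lambda>\<close> by \<open>k\<close> which it defines splits over a lattice basis
  (\<open>symmetric_cocycle_splits\<close>); additive functions on a slab are linear (\<open>H1_K2_linear\<close>); and the
  intersection of neighbouring slabs spans \<open>M\<^sub>k\<close> (\<open>K2_Int_spans\<close>).  The geometric input for all
  three is that a primitive edge has an adapted basis of \<open>M\<close> inside \<open>\<Lambda>\<close> (\<open>primitive_edge_frame\<close>).

  Summation of components kills exactly the image of \<open>\<delta>\<close> because a tuple with sum zero is a cyclic
  difference.  It is onto \<open>R\<^sup>\<bottom>\<close> as soon as \<open>0\<close> and \<open>R\<close> are the only elements of \<open>M\<close> with all values
  \<open>0\<close> or \<open>1\<close> on the vertices.  Any other such element presents the polygon as having
  lattice width one, and a primitive polygon of width one is a unimodular triangle or parallelogram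
  (\<open>width_1_smooth_or_conifold\<close>).
\<close>

section \<open>Pairings and primitive lattice polygons\<close>

lemma pairing_expand: "pairing x y = x $ 1 * y $ 1 + x $ 2 * y $ 2 + x $ 3 * y $ 3"
  by (simp add: pairing_def sum_3)

lemma pairing_simps [simp]:
  "pairing 0 y = 0" "pairing x 0 = 0"
  "pairing (x + x') y = pairing x y + pairing x' y"
  "pairing x (y + y') = pairing x y + pairing x y'"
  "pairing (x - x') y = pairing x y - pairing x' y"
  "pairing x (y - y') = pairing x y - pairing x y'"
  "pairing (- x) y = - pairing x y"
  "pairing x (- y) = - pairing x y"
  "pairing (c *s x) y = c * pairing x y"
  "pairing x (c *s y) = c * pairing x y"
  by (simp_all add: pairing_expand algebra_simps)

lemma pairing_sum_left: "pairing (\<Sum>i\<in>A. f i) y = (\<Sum>i\<in>A. pairing (f i) y)"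
  by (induction A rule: infinite_finite_induct) auto

lemma ext_simps [simp]:
  "ext 0 = 0" "ext (x + y) = ext x + ext y" "ext (x - y) = ext x - ext y" "ext (- x) = - ext x"
  "ext (c *s x) = of_int c *s ext x" "ext x $ i = of_int (x $ i)"
  by (simp_all add: ext_def vec_eq_iff)

lemma pairing_ext [simp]: "pairing (ext x) (ext y) = of_int (pairing x y)"
  by (simp add: pairing_expand)

lemma pairing_Rstar [simp]: "pairing x Rstar = x $ 3"
  by (simp add: pairing_expand Rstar_def)

lemma pairing_ext_Rstar [simp]: "pairing x (ext Rstar) = x $ 3"
  by (simp add: pairing_expand Rstar_def)

lemma pairing_2_Rstar [simp]: "pairing x (2 * Rstar) = 2 * x $ 3"
  by (simp add: pairing_expand Rstar_def)

lemma pairing_eq_inner: "pairing x y = x \<bullet> (y :: real ^ 3)"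
  by (simp add: pairing_def inner_vec_def)

lemma vec3_eq_iff: "x = (y :: 'a ^ 3) \<longleftrightarrow> x $ 1 = y $ 1 \<and> x $ 2 = y $ 2 \<and> x $ 3 = y $ 3"
  by (simp add: vec_eq_iff forall_3)

lemma pairing_nondegenerate:
  assumes "\<And>x :: lat. pairing q (ext x) = 0"
  shows "q = (0 :: 'k::field_char_0 ^ 3)"
proof -
  have "q $ i = 0" for i
  proof -
    have "pairing q (ext (axis i 1)) = q $ i"
      by (simp add: pairing_def axis_def if_distrib cong: if_cong)
    then show ?thesis using assms by simp
  qed
  then show ?thesis by (simp add: vec_eq_iff)
qed

lemma lat_pairing_nondegenerate:
  assumes "\<And>x :: lat. pairing d x = 0"
  shows "d = (0 :: lat)"
proof -
  have "d $ i = 0" for i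
  proof -
    have "pairing d (axis i 1) = d $ i"
      by (simp add: pairing_def axis_def if_distrib cong: if_cong)
    then show ?thesis using assms by simp
  qed
  then show ?thesis by (simp add: vec_eq_iff)
qed

text \<open>
  By the Krein-Milman theorem a half space contains the polygon, hence the cone over it,
  as soon as it contains the vertices.
\<close>

lemma mem_toric_monoid_iff:
  assumes P: "lattice_polygon P N a"
  shows "r \<in> toric_monoid P \<longleftrightarrow> (\<forall>l<N. 0 \<le> pairing (a l) r)"
proof -
  have ep: "{x. x extreme_point_of P} = (\<lambda>j. ext (a j)) ` {..<N}" and poly: "polytope P"
    using P by (auto simp: lattice_polygon_def)
  have hull: "P = convex hull ((\<lambda>j. ext (a j)) ` {..<N})"
    using Krein_Milman_Minkowski[of P] poly ep
    by (metis polytope_imp_compact polytope_imp_convex)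
  have half: "convex {x :: real ^ 3. 0 \<le> pairing x (ext r)}"
    using convex_halfspace_ge[of 0 "ext r :: real ^ 3"] by (simp add: pairing_eq_inner inner_commute)
  have "r \<in> toric_monoid P \<longleftrightarrow> (\<forall>x\<in>P. 0 \<le> pairing x (ext r))"
    unfolding toric_monoid_def
  proof (intro iffI; clarsimp)
    fix x assume "\<forall>x\<in>cone hull P. 0 \<le> pairing x (ext r)" "x \<in> P"
    then show "0 \<le> pairing x (ext r)" by (meson hull_inc)
  next
    fix x assume *: "\<forall>x\<in>P. 0 \<le> pairing x (ext r)" and "x \<in> cone hull P"
    then obtain c y where "x = c *\<^sub>R y" "0 \<le> c" "y \<in> P"
      by (auto simp: cone_hull_expl)
    then show "0 \<le> pairing x (ext r)" using * by (simp add: pairing_eq_inner)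
  qed
  also have "\<dots> \<longleftrightarrow> P \<subseteq> {x. 0 \<le> pairing x (ext r)}" by auto
  also have "\<dots> \<longleftrightarrow> (\<lambda>j. ext (a j)) ` {..<N} \<subseteq> {x. 0 \<le> pairing x (ext r :: real ^ 3)}"
    by (subst hull) (simp add: subset_hull[of convex, OF half])
  also have "\<dots> \<longleftrightarrow> (\<forall>l<N. 0 \<le> pairing (a l) r)"
    by (auto simp: image_subset_iff)
  finally show ?thesis .
qed

lemma lattice_polygon_height:
  assumes P: "lattice_polygon P N a" and j: "j < N"
  shows "a j $ 3 = 1"
proof -
  have "ext (a j) extreme_point_of P" "P \<subseteq> {x. x $ 3 = 1}"
    using P j by (auto simp: lattice_polygon_def)
  then have "(ext (a j) :: real ^ 3) $ 3 = 1" by (auto simp: extreme_point_of_def)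
  then show ?thesis by simp
qed

lemma lattice_polygon_ge_3:
  assumes P: "lattice_polygon P N a"
  shows "3 \<le> N"
proof -
  have ep: "{x. x extreme_point_of P} = (\<lambda>j. ext (a j)) ` {..<N}" and poly: "polytope P"
    and dim: "aff_dim P = 2"
    using P by (auto simp: lattice_polygon_def)
  have hull: "P = convex hull ((\<lambda>j. ext (a j)) ` {..<N})"
    using Krein_Milman_Minkowski[of P] poly ep
    by (metis polytope_imp_compact polytope_imp_convex)
  have "2 = aff_dim ((\<lambda>j. ext (a j) :: real ^ 3) ` {..<N})"
    using dim hull aff_dim_convex_hull by metis
  also have "\<dots> \<le> int (card ((\<lambda>j. ext (a j) :: real ^ 3) ` {..<N})) - 1"
    by (rule aff_dim_le_card) simp
  also have "\<dots> \<le> int N - 1" using card_image_le[of "{..<N}" "\<lambda>j. ext (a j) :: real ^ 3"] by simp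
  finally show ?thesis by linarith
qed

text \<open>
  An edge is an exposed face, so some real functional vanishes on it and is of one sign elsewhere.
  In the plane of height one this functional is determined up to a factor by the two end points,
  namely by their cross product, which is integral.
\<close>

lemma lattice_polygon_edge_normal:
  assumes P: "lattice_polygon P N a" and j: "j < N"
  defines "d \<equiv> dvec N a j"
  defines "m \<equiv> vector [- d $ 2, d $ 1, a j $ 1 * d $ 2 - a j $ 2 * d $ 1] :: lat"
  shows "\<exists>s::int. (s = 1 \<or> s = - 1) \<and> (\<forall>l<N. 0 \<le> s * pairing (a l) m) \<and>
    (\<forall>l<N. pairing (a l) m = 0 \<longleftrightarrow> l = j \<or> l = Suc j mod N)"
proof -
  let ?e = "\<lambda>l. ext (a l) :: real ^ 3"
  let ?j' = "Suc j mod N"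
  have j': "?j' < N" using j by simp
  have ep: "{x. x extreme_point_of P} = ?e ` {..<N}" and poly: "polytope P"
    and edge: "closed_segment (?e j) (?e ?j') edge_of P" and inj: "inj_on a {..<N}"
    and P1: "P \<subseteq> {x. x $ 3 = 1}"
    using P j by (auto simp: lattice_polygon_def)
  have face: "closed_segment (?e j) (?e ?j') face_of P" using edge by (simp add: edge_of_def)
  then have "closed_segment (?e j) (?e ?j') exposed_face_of P"
    using poly by (simp add: exposed_face_of_polyhedron polytope_imp_polyhedron)
  then obtain g b where sub: "P \<subseteq> {x. g \<bullet> x \<le> b}"
    and seg: "closed_segment (?e j) (?e ?j') = P \<inter> {x. g \<bullet> x = b}"
    unfolding exposed_face_of_def by blast
  have inP: "?e l \<in> P" if "l < N" for l
    using ep that by (auto simp: extreme_point_of_def)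
  have a3: "a l $ 3 = 1" if "l < N" for l by (rule lattice_polygon_height[OF P that])
  have on_edge: "g \<bullet> ?e l = b \<longleftrightarrow> l = j \<or> l = ?j'" if l: "l < N" for l
  proof
    assume "g \<bullet> ?e l = b"
    then have "?e l \<in> closed_segment (?e j) (?e ?j')" using seg inP[OF l] by auto
    moreover have "?e l extreme_point_of P" using ep l by auto
    ultimately have "?e l extreme_point_of closed_segment (?e j) (?e ?j')"
      using extreme_point_of_face[OF face] by auto
    then have "?e l = ?e j \<or> ?e l = ?e ?j'" by (simp add: extreme_point_of_segment)
    then have "a l = a j \<or> a l = a ?j'" by (simp add: vec_eq_iff)
    then show "l = j \<or> l = ?j'" using inj l j j' by (auto simp: inj_on_def)
  next
    assume "l = j \<or> l = ?j'"
    then have "?e l \<in> closed_segment (?e j) (?e ?j')" by auto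
    then show "g \<bullet> ?e l = b" using seg by auto
  qed
  define D1 D2 where "D1 = real_of_int (d $ 1)" and "D2 = real_of_int (d $ 2)"
  have d3: "d $ 3 = 0" using a3 j j' by (simp add: d_def dvec_def)
  have inner3: "x \<bullet> y = x $ 1 * y $ 1 + x $ 2 * y $ 2 + x $ 3 * y $ 3" for x y :: "real ^ 3"
    by (simp add: inner_vec_def sum_3)
  have "g \<bullet> ext d = 0"
    using on_edge[OF j] on_edge[OF j'] by (simp add: d_def dvec_def inner_diff_right)
  then have gd: "g $ 1 * D1 + g $ 2 * D2 = 0" using d3 by (simp add: inner3 D1_def D2_def)
  have "d \<noteq> 0"
  proof
    assume "d = 0"
    then have "j = ?j'" using inj j j' by (auto simp: d_def dvec_def inj_on_def)
    then show False using lattice_polygon_ge_3[OF P] j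
      by (cases "Suc j = N") auto
  qed
  then have dn: "D1 * D1 + D2 * D2 > 0"
    using d3 by (auto simp: vec3_eq_iff D1_def D2_def sum_squares_gt_zero_iff)
  \<comment> \<open>The component of \<open>g\<close> along the rotated edge direction; its sign tells on which side
    the polygon lies.\<close>
  define lam where "lam = (g $ 2 * D1 - g $ 1 * D2) / (D1 * D1 + D2 * D2)"
  have "g $ 1 * (D1 * D1 + D2 * D2) = - (g $ 2 * D1 - g $ 1 * D2) * D2"
    using arg_cong[OF gd, of "\<lambda>z. z * D1"] by (simp add: algebra_simps)
  then have g1: "g $ 1 = - lam * D2" using dn unfolding lam_def
    by (metis divide_minus_left less_irrefl nonzero_eq_divide_eq times_divide_eq_left)
  have "g $ 2 * (D1 * D1 + D2 * D2) = (g $ 2 * D1 - g $ 1 * D2) * D1"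
    using arg_cong[OF gd, of "\<lambda>z. z * D2"] by (simp add: algebra_simps)
  then have g2: "g $ 2 = lam * D1" using dn unfolding lam_def
    by (metis less_irrefl nonzero_eq_divide_eq times_divide_eq_left)
  have b: "b = g $ 1 * a j $ 1 + g $ 2 * a j $ 2 + g $ 3"
    using on_edge[OF j] a3[OF j] by (simp add: inner3)
  have val: "g \<bullet> ?e l - b = lam * pairing (a l) m" if "l < N" for l
    using a3[OF that] unfolding b inner3
    by (simp add: g1 g2 m_def pairing_expand D1_def D2_def algebra_simps)
  have "lam \<noteq> 0"
  proof
    assume "lam = 0"
    then have "g \<bullet> ?e l = b" if "l < N" for l using val[OF that] by simp
    then have "{..<N} \<subseteq> {j, ?j'}" using on_edge by auto
    then have "card {..<N} \<le> card {j, ?j'}" by (intro card_mono) auto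
    then show False using lattice_polygon_ge_3[OF P] card_insert_le_m1[of 2 "{?j'}" j] by simp
  qed
  have le: "lam * pairing (a l) m \<le> 0" if "l < N" for l
    using val[OF that] sub inP[OF that] by force
  have zero: "pairing (a l) m = 0 \<longleftrightarrow> l = j \<or> l = ?j'" if "l < N" for l
    using val[OF that] on_edge[OF that] \<open>lam \<noteq> 0\<close> by auto
  show ?thesis
  proof (cases "lam < 0")
    case True
    then show ?thesis using le zero by (intro exI[of _ 1]) (simp add: mult_le_0_iff)
  next
    case False
    then have "0 < lam" using \<open>lam \<noteq> 0\<close> by simp
    then show ?thesis using le zero by (intro exI[of _ "- 1"]) (simp add: mult_le_0_iff)
  qed
qed

text \<open>
  The basis \<open>n, v, u\<close> of \<open>M\<close> is dual to the basis \<open>w, a\<^sub>j\<^sub>+\<^sub>1, a\<^sub>j\<close> of \<open>N\<close>; moreover it lies in the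
  monoid and \<open>n\<close> is the inner normal of the edge, primitive because its pairing with \<open>w\<close> is 1.
  The last clause identifies it up to sign with the cross product of the two vertices.
\<close>

definition edge_frame :: "nat \<Rightarrow> (nat \<Rightarrow> lat) \<Rightarrow> nat \<Rightarrow> lat \<Rightarrow> lat \<Rightarrow> lat \<Rightarrow> lat \<Rightarrow> bool" where
  "edge_frame N a j n v u w \<longleftrightarrow>
     (\<forall>l<N. 0 \<le> pairing (a l) n \<and> 0 \<le> pairing (a l) v \<and> 0 \<le> pairing (a l) u) \<and>
     (\<forall>l<N. pairing (a l) n = 0 \<longleftrightarrow> l = j \<or> l = Suc j mod N) \<and>
     pairing (a j) v = 0 \<and> pairing (a (Suc j mod N)) v = 1 \<and>
     pairing (a j) u = 1 \<and> pairing (a (Suc j mod N)) u = 0 \<and>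
     (\<forall>x. x = pairing w x *s n + pairing (a (Suc j mod N)) x *s v + pairing (a j) x *s u) \<and>
     (\<forall>c. \<bar>det (vector [a j, a (Suc j mod N), c] :: int ^ 3 ^ 3)\<bar> = \<bar>pairing c n\<bar>)"

text \<open>
  Lattice length one means that the direction \<open>d\<close> is primitive, so Bezout coefficients complete
  \<open>a\<^sub>j\<close> and \<open>d\<close> to a basis of \<open>N\<close>.  The two dual vectors that are not the edge normal are
  moved into the monoid by adding a large multiple of the normal, which is positive at all
  other vertices.
\<close>

lemma primitive_edge_frame:
  assumes P: "lattice_polygon P N a" and iso: "isolated N a" and j: "j < N"
  shows "\<exists>n v u w. edge_frame N a j n v u w"
proof -
  let ?j' = "Suc j mod N"
  have j': "?j' < N" using j by simp
  define d where "d = dvec N a j"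
  have a': "a ?j' = a j + d" by (simp add: d_def dvec_def)
  have a3: "a l $ 3 = 1" if "l < N" for l by (rule lattice_polygon_height[OF P that])
  have d3: "d $ 3 = 0" using a3[OF j] a3[OF j'] by (simp add: d_def dvec_def)
  define m where "m = (vector [- d $ 2, d $ 1, a j $ 1 * d $ 2 - a j $ 2 * d $ 1] :: lat)"
  obtain s where s: "s = 1 \<or> s = - 1" and sm: "\<And>l. l < N \<Longrightarrow> 0 \<le> s * pairing (a l) m"
    and zm: "\<And>l. l < N \<Longrightarrow> pairing (a l) m = 0 \<longleftrightarrow> l = j \<or> l = ?j'"
    using lattice_polygon_edge_normal[OF P j, folded d_def, folded m_def] by blast
  have "range (\<lambda>i. d $ i) = {d $ 1, d $ 2, 0}" using d3 by (simp add: UNIV_3)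
  moreover have "Gcd (range (\<lambda>i. d $ i)) = 1"
    using iso j unfolding isolated_def lattice_length_def d_def by simp
  ultimately have "gcd (d $ 1) (d $ 2) = 1" by simp
  then obtain y1 y2 where y: "y1 * d $ 1 + y2 * d $ 2 = 1" by (metis bezout_int)
  define n where "n = s *s m"
  define v0 where "v0 = (vector [y1, y2, - (a j $ 1 * y1 + a j $ 2 * y2)] :: lat)"
  define w0 where "w0 = (s *s vector [- y2, y1, 0] :: lat)"
  have ss: "s * s = 1" using s by auto
  have dual: "x = pairing w0 x *s n + pairing d x *s v0 + pairing (a j) x *s Rstar" for x
  proof -
    have "pairing w0 x *s n = (s * s) *s (pairing (vector [- y2, y1, 0]) x *s m)"
      by (simp add: w0_def n_def vec_eq_iff algebra_simps)
    then have e: "pairing w0 x *s n = pairing (vector [- y2, y1, 0]) x *s m" by (simp add: ss)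
    have y': "y2 * d $ 2 = 1 - y1 * d $ 1" using y by simp
    have f: "x $ 1 = x $ 1 * (y1 * d $ 1 + y2 * d $ 2)" "x $ 2 = x $ 2 * (y1 * d $ 1 + y2 * d $ 2)"
      using y by simp_all
    have g: "x $ 1 * a j $ 1 = x $ 1 * a j $ 1 * (y1 * d $ 1 + y2 * d $ 2)"
      "x $ 2 * a j $ 2 = x $ 2 * a j $ 2 * (y1 * d $ 1 + y2 * d $ 2)"
      using y by simp_all
    show ?thesis unfolding e vec3_eq_iff using f g
      by (simp add: m_def v0_def Rstar_def pairing_expand a3[OF j] d3 algebra_simps)
  qed
  \<comment> \<open>Large enough to outweigh the values of \<open>v0\<close> at every vertex.\<close>
  define B where "B = (\<Sum>l<N. \<bar>pairing (a l) v0\<bar>)"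
  have B: "\<bar>pairing (a l) v0\<bar> \<le> B" if "l < N" for l
    unfolding B_def using that by (intro member_le_sum) auto
  define v where "v = v0 + B *s n"
  define u where "u = Rstar - v0 + B *s n"
  define w where "w = w0 - B *s a ?j' - B *s a j"
  have dv0: "pairing d v0 = 1" "pairing (a j) v0 = 0"
    using y d3 a3[OF j] by (simp_all add: v0_def pairing_expand algebra_simps)
  have n0: "pairing (a j) n = 0" "pairing (a ?j') n = 0"
    using zm[OF j] zm[OF j'] by (simp_all add: n_def)
  have dR: "pairing d Rstar = 0" "pairing (a j) Rstar = 1" using d3 a3[OF j] by simp_all
  have zn: "pairing (a l) n = 0 \<longleftrightarrow> l = j \<or> l = ?j'" "0 \<le> pairing (a l) n" if "l < N" for l
    using zm[OF that] sm[OF that] s by (auto simp: n_def)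
  have pos: "0 \<le> pairing (a l) v" "0 \<le> pairing (a l) u" if l: "l < N" for l
  proof -
    have "0 \<le> pairing (a l) v \<and> 0 \<le> pairing (a l) u"
    proof (cases "l = j \<or> l = ?j'")
      case True
      then show ?thesis using dv0 n0 dR by (auto simp: v_def u_def a' a3[OF j] d3)
    next
      case False
      then have "1 \<le> pairing (a l) n" using zn[OF l] by linarith
      moreover have "0 \<le> B" using B[OF l] by linarith
      ultimately have "B \<le> B * pairing (a l) n" by (simp add: mult_le_cancel_left1)
      then show ?thesis using B[OF l] a3[OF l] by (simp add: v_def u_def) linarith
    qed
    then show "0 \<le> pairing (a l) v" "0 \<le> pairing (a l) u" by simp_all
  qed
  have basis: "x = pairing w x *s n + pairing (a ?j') x *s v + pairing (a j) x *s u" for x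
  proof -
    have e: "pairing w x = pairing w0 x - B * (pairing (a j) x + pairing d x) - B * pairing (a j) x"
      "pairing (a ?j') x = pairing (a j) x + pairing d x"
      by (simp_all only: w_def a' pairing_simps)
    have "pairing w x *s n + pairing (a ?j') x *s v + pairing (a j) x *s u =
        pairing w0 x *s n + pairing d x *s v0 + pairing (a j) x *s Rstar"
      unfolding e by (simp add: v_def u_def vec_eq_iff algebra_simps)
    then show ?thesis using dual[of x] by simp
  qed
  have det: "\<bar>det (vector [a j, a ?j', c] :: int ^ 3 ^ 3)\<bar> = \<bar>pairing c n\<bar>" for c
  proof -
    have "det (vector [a j, a ?j', c] :: int ^ 3 ^ 3) = pairing c m"
      by (simp add: det_3 a' m_def pairing_expand d3 a3[OF j] algebra_simps)
    then show ?thesis using s by (auto simp: n_def)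
  qed
  have "edge_frame N a j n v u w"
    unfolding edge_frame_def using zn pos dv0 n0 dR basis det
    by (simp add: v_def u_def a' a3[OF j] d3)
  then show ?thesis by blast
qed

section \<open>Harrison cochains of low degree\<close>

lemma Stup_1_iff: "xs \<in> Stup 1 Q \<longleftrightarrow> (\<exists>x. xs = [x] \<and> x \<in> Q)"
  by (auto simp: Stup_def length_Suc_conv)

lemma Stup_2_iff: "xs \<in> Stup 2 Q \<longleftrightarrow> (\<exists>x y. xs = [x, y] \<and> x \<in> Q \<and> y \<in> Q \<and> x + y \<in> Q)"
  by (auto simp: Stup_def length_Suc_conv numeral_2_eq_2)

lemma Stup_3_iff: "xs \<in> Stup 3 Q \<longleftrightarrow>
    (\<exists>x y z. xs = [x, y, z] \<and> x \<in> Q \<and> y \<in> Q \<and> z \<in> Q \<and> x + y + z \<in> Q)"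
  by (auto simp: Stup_def length_Suc_conv numeral_3_eq_3 add.assoc)

lemma Stup_4_iff: "xs \<in> Stup 4 Q \<longleftrightarrow> (\<exists>x y z w. xs = [x, y, z, w] \<and>
    x \<in> Q \<and> y \<in> Q \<and> z \<in> Q \<and> w \<in> Q \<and> x + y + z + w \<in> Q)"
  by (auto simp: Stup_def length_Suc_conv eval_nat_numeral add.assoc)

lemmas Stup_iffs = Stup_1_iff Stup_2_iff Stup_3_iff Stup_4_iff

lemma cobd_2: "cobd 2 L \<phi> [x, y] =
    (if [x, y] \<in> Stup 2 L then \<phi> [y] - \<phi> [x + y] + \<phi> [x] else 0)"
proof -
  have "{1..<2::nat} = {1}" by auto
  then show ?thesis by (simp add: cobd_def merge_def)
qed

lemma cobd_3: "cobd 3 L \<phi> [x, y, z] =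
    (if [x, y, z] \<in> Stup 3 L then \<phi> [y, z] - \<phi> [x + y, z] + \<phi> [x, y + z] - \<phi> [x, y] else 0)"
proof -
  have "{1..<3::nat} = {1, 2}" by auto
  then show ?thesis by (simp add: cobd_def merge_def)
qed

lemma cobd_4: "cobd 4 L \<phi> [x, y, z, w] =
    (if [x, y, z, w] \<in> Stup 4 L
     then \<phi> [y, z, w] - \<phi> [x + y, z, w] + \<phi> [x, y + z, w] - \<phi> [x, y, z + w] + \<phi> [x, y, z] else 0)"
proof -
  have "{1..<4::nat} = {1, 2, 3}" by auto
  then show ?thesis by (simp add: cobd_def merge_def)
qed

lemma cobd_outside: "xs \<notin> Stup n L \<Longrightarrow> cobd n L \<phi> xs = 0"
  by (simp add: cobd_def)

lemma cobd_add: "cobd n L (\<lambda>xs. \<phi> xs + \<psi> xs) = (\<lambda>xs. cobd n L \<phi> xs + cobd n L \<psi> xs)"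
  by (rule ext) (simp add: cobd_def sum.distrib algebra_simps)

lemma cobd_uminus: "cobd n L (\<lambda>xs. - \<phi> xs) = (\<lambda>xs. - cobd n L \<phi> xs)"
  by (rule ext) (simp add: cobd_def sum_negf algebra_simps)

lemma cobd_diff: "cobd n L (\<lambda>xs. \<phi> xs - \<psi> xs) = (\<lambda>xs. cobd n L \<phi> xs - cobd n L \<psi> xs)"
  using cobd_add[of n L \<phi> "\<lambda>xs. - \<psi> xs"] by (simp add: cobd_uminus)

lemma cobd_3_cobd_2:
  assumes add: "\<And>x y. x \<in> L \<Longrightarrow> y \<in> L \<Longrightarrow> x + y \<in> L"
  shows "cobd 3 L (cobd 2 L \<phi>) = (\<lambda>_. 0)"
proof
  fix xs show "cobd 3 L (cobd 2 L \<phi>) xs = 0"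
  proof (cases "xs \<in> Stup 3 L")
    case True
    then obtain x y z where "xs = [x, y, z]" "x \<in> L" "y \<in> L" "z \<in> L" by (auto simp: Stup_3_iff)
    then show ?thesis by (simp add: cobd_3 cobd_2 Stup_iffs add add.assoc)
  qed (simp add: cobd_outside)
qed

lemma cobd_4_cobd_3:
  assumes add: "\<And>x y. x \<in> L \<Longrightarrow> y \<in> L \<Longrightarrow> x + y \<in> L"
  shows "cobd 4 L (cobd 3 L \<phi>) = (\<lambda>_. 0)"
proof
  fix xs show "cobd 4 L (cobd 3 L \<phi>) xs = 0"
  proof (cases "xs \<in> Stup 4 L")
    case True
    then obtain x y z w where "xs = [x, y, z, w]" "x \<in> L" "y \<in> L" "z \<in> L" "w \<in> L"
      by (auto simp: Stup_4_iff)
    then show ?thesis by (simp add: cobd_4 cobd_3 Stup_iffs add add.assoc)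
  qed (simp add: cobd_outside)
qed

lemma permutes_lessThan_2:
  assumes p: "p permutes {..<2::nat}"
  shows "p = id \<or> p = Transposition.transpose 0 1"
proof -
  have "p 0 < 2" "p 1 < 2" using permutes_in_image[OF p, of 0] permutes_in_image[OF p, of 1] by auto
  moreover have "p 0 \<noteq> p 1" by (simp add: inj_eq[OF permutes_inj[OF p]])
  ultimately have c: "(p 0 = 0 \<and> p 1 = 1) \<or> (p 0 = 1 \<and> p 1 = 0)" by linarith
  have ext: "p = q" if "q permutes {..<2}" "p 0 = q 0" "p 1 = q 1" for q
  proof
    fix i show "p i = q i"
      using that permutes_not_in[OF p, of i] permutes_not_in[OF that(1), of i]
      by (cases "i < 2") (auto simp: less_2_cases_iff)
  qed
  show ?thesis
    using c ext[OF permutes_id] ext[OF permutes_swap_id[of 0 "{..<2::nat}" 1]] by auto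
qed

lemma shuffle_sum_1: "shuffle_sum 1 \<phi> xs = 0"
  by (simp add: shuffle_sum_def)

lemma shuffle_sum_2: "shuffle_sum 2 \<phi> [x, y] = \<phi> [x, y] - \<phi> [y, x]"
proof -
  have "p permutes {..<2} \<longleftrightarrow> p \<in> {id, Transposition.transpose 0 (1::nat)}" for p
    using permutes_lessThan_2[of p] permutes_swap_id[of 0 "{..<2::nat}" 1] permutes_id by auto
  then have *: "shuffle_perms 1 2 = {id, Transposition.transpose 0 1}"
    unfolding shuffle_perms_def by (auto simp: strict_mono_on_def)
  have "{1..<2::nat} = {1}" by auto
  moreover have "id \<noteq> Transposition.transpose 0 (1::nat)" by (metis id_apply Transposition.transpose_apply_first zero_neq_one)
  moreover have "[0..<2] = [0, 1::nat]" by (simp add: upt_rec)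
  ultimately show ?thesis
    unfolding shuffle_sum_def
    by (simp add: *[simplified] sign_swap_id permute_list_def upt_rec)
qed

lemma Harr_1_iff: "\<phi> \<in> Harr 1 L \<longleftrightarrow> (\<forall>xs. xs \<notin> Stup 1 L \<longrightarrow> \<phi> xs = 0)"
  unfolding Harr_def using shuffle_sum_1 by blast

lemma Harr_2_iff: "\<phi> \<in> Harr 2 L \<longleftrightarrow>
    (\<forall>xs. xs \<notin> Stup 2 L \<longrightarrow> \<phi> xs = 0) \<and> (\<forall>x y. \<phi> [x, y] = \<phi> [y, x])"
proof -
  have sym: "[x, y] \<in> Stup 2 L \<longleftrightarrow> [y, x] \<in> Stup 2 L" for x y
    by (auto simp: Stup_2_iff add.commute)
  show ?thesis
  proof (intro iffI conjI allI impI)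
    fix x y assume "\<phi> \<in> Harr 2 L"
    then show "\<phi> [x, y] = \<phi> [y, x]"
      using sym[of x y] by (cases "[x, y] \<in> Stup 2 L") (auto simp: Harr_def shuffle_sum_2)
  next
    assume "(\<forall>xs. xs \<notin> Stup 2 L \<longrightarrow> \<phi> xs = 0) \<and> (\<forall>x y. \<phi> [x, y] = \<phi> [y, x])"
    then show "\<phi> \<in> Harr 2 L"
      unfolding Harr_def by (auto simp: shuffle_sum_2 Stup_2_iff)
  qed (auto simp: Harr_def)
qed

definition rot3 :: "nat \<Rightarrow> nat" where
  "rot3 = Transposition.transpose 0 1 \<circ> Transposition.transpose 1 2"

lemma rot3_apply [simp]: "rot3 0 = 1" "rot3 (Suc 0) = 2" "rot3 2 = 0"
  by (simp_all add: rot3_def Transposition.transpose_def)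

lemma permutes_lessThan_3_eqI:
  assumes "p permutes {..<3::nat}" "q permutes {..<3}" "p 0 = q 0" "p 1 = q 1" "p 2 = q 2"
  shows "p = q"
proof
  fix i show "p i = q i"
  proof (cases "i < 3")
    case True
    then have "i = 0 \<or> i = 1 \<or> i = 2" by auto
    then show ?thesis using assms by auto
  next
    case False
    then show ?thesis using assms permutes_not_in[of p] permutes_not_in[of q] by auto
  qed
qed

lemma rot3_permutes: "rot3 permutes {..<3}" "inv_into UNIV rot3 permutes {..<3}"
proof -
  show "rot3 permutes {..<3}" unfolding rot3_def
    by (intro permutes_compose permutes_swap_id) auto
  then show "inv_into UNIV rot3 permutes {..<3}" by (rule permutes_inv)
qed

lemma inv_rot3_apply [simp]: "inv_into UNIV rot3 0 = 2" "inv_into UNIV rot3 (Suc 0) = 0" "inv_into UNIV rot3 2 = 1"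
  using rot3_permutes(1) by (simp_all add: permutes_inv_eq)

lemma sign_rot3: "sign rot3 = 1" "sign (inv_into UNIV rot3) = 1"
proof -
  have "permutation (Transposition.transpose 0 (1::nat))" "permutation (Transposition.transpose 1 (2::nat))"
    by (auto intro: permutation_swap_id)
  then show "sign rot3 = 1" unfolding rot3_def by (simp add: sign_compose sign_swap_id)
  then show "sign (inv_into UNIV rot3) = 1"
    using rot3_permutes(1) by (simp add: sign_inverse permutation_permutes exI[of _ "{..<3::nat}"])
qed

lemma strict_mono_on_3: "strict_mono_on {1..<3} p \<longleftrightarrow> p 1 < p (2::nat)" for p :: "nat \<Rightarrow> nat"
proof -
  have "{1..<3::nat} = {1, 2}" by auto
  then show ?thesis by (auto simp: strict_mono_on_def)
qed

lemma strict_mono_on_2: "strict_mono_on {..<2} p \<longleftrightarrow> p 0 < p (1::nat)" for p :: "nat \<Rightarrow> nat"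
proof -
  have "{..<2::nat} = {0, 1}" by auto
  then show ?thesis by (auto simp: strict_mono_on_def)
qed

lemma mem_shuffle_perms_1_3: "p \<in> shuffle_perms 1 3 \<longleftrightarrow> p permutes {..<3} \<and> p 1 < p 2"
proof -
  have "strict_mono_on {..<1} p" by (auto simp: strict_mono_on_def)
  then show ?thesis unfolding shuffle_perms_def strict_mono_on_3 by simp
qed

lemma mem_shuffle_perms_2_3: "p \<in> shuffle_perms 2 3 \<longleftrightarrow> p permutes {..<3} \<and> p 0 < p 1"
proof -
  have "strict_mono_on {2..<3} p" by (auto simp: strict_mono_on_def)
  then show ?thesis unfolding shuffle_perms_def strict_mono_on_2 by simp
qed

lemma shuffle_perms_1_3: "shuffle_perms 1 3 = {id, Transposition.transpose 0 1, inv_into UNIV rot3}"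
proof (intro equalityI subsetI)
  fix p assume "p \<in> shuffle_perms 1 3"
  then have p: "p permutes {..<3}" and m': "p 1 < p 2"
    by (simp_all only: mem_shuffle_perms_1_3)
  have "p 2 < 3" "p 0 < 3" using permutes_in_image[OF p, of 2] permutes_in_image[OF p, of 0] by auto
  moreover have "p 0 \<noteq> p 1" "p 0 \<noteq> p 2" by (simp_all add: inj_eq[OF permutes_inj[OF p]])
  ultimately have "(p 0 = 0 \<and> p 1 = 1 \<and> p 2 = 2) \<or> (p 0 = 1 \<and> p 1 = 0 \<and> p 2 = 2)
      \<or> (p 0 = 2 \<and> p 1 = 0 \<and> p 2 = 1)" using m' by linarith
  then show "p \<in> {id, Transposition.transpose 0 1, inv_into UNIV rot3}"
  proof (elim disjE)
    assume "p 0 = 0 \<and> p 1 = 1 \<and> p 2 = 2"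
    then have "p = id" by (intro permutes_lessThan_3_eqI[OF p]) (auto simp: permutes_id)
    then show ?thesis by simp
  next
    assume "p 0 = 1 \<and> p 1 = 0 \<and> p 2 = 2"
    then have "p = Transposition.transpose 0 1"
      by (intro permutes_lessThan_3_eqI[OF p]) (auto simp: permutes_swap_id Transposition.transpose_def)
    then show ?thesis by simp
  next
    assume "p 0 = 2 \<and> p 1 = 0 \<and> p 2 = 1"
    then have "p = inv_into UNIV rot3" by (intro permutes_lessThan_3_eqI[OF p] rot3_permutes) auto
    then show ?thesis by simp
  qed
next
  fix p assume "p \<in> {id, Transposition.transpose 0 1, inv_into UNIV rot3}"
  then show "p \<in> shuffle_perms 1 3"
    using rot3_permutes(2) permutes_id permutes_swap_id[of 0 "{..<3::nat}" 1]
    unfolding mem_shuffle_perms_1_3 by (auto simp: Transposition.transpose_def)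
qed

lemma shuffle_perms_2_3: "shuffle_perms 2 3 = {id, Transposition.transpose 1 2, rot3}"
proof (intro equalityI subsetI)
  fix p assume "p \<in> shuffle_perms 2 3"
  then have p: "p permutes {..<3}" and m': "p 0 < p 1"
    by (simp_all only: mem_shuffle_perms_2_3)
  have "p 2 < 3" "p 1 < 3" using permutes_in_image[OF p, of 2] permutes_in_image[OF p, of 1] by auto
  moreover have "p 2 \<noteq> p 1" "p 0 \<noteq> p 2" by (simp_all add: inj_eq[OF permutes_inj[OF p]])
  ultimately have "(p 0 = 0 \<and> p 1 = 1 \<and> p 2 = 2) \<or> (p 0 = 0 \<and> p 1 = 2 \<and> p 2 = 1)
      \<or> (p 0 = 1 \<and> p 1 = 2 \<and> p 2 = 0)" using m' by linarith
  then show "p \<in> {id, Transposition.transpose 1 2, rot3}"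
  proof (elim disjE)
    assume "p 0 = 0 \<and> p 1 = 1 \<and> p 2 = 2"
    then have "p = id" by (intro permutes_lessThan_3_eqI[OF p]) (auto simp: permutes_id)
    then show ?thesis by simp
  next
    assume "p 0 = 0 \<and> p 1 = 2 \<and> p 2 = 1"
    then have "p = Transposition.transpose 1 2"
      by (intro permutes_lessThan_3_eqI[OF p]) (auto simp: permutes_swap_id Transposition.transpose_def)
    then show ?thesis by simp
  next
    assume "p 0 = 1 \<and> p 1 = 2 \<and> p 2 = 0"
    then have "p = rot3" by (intro permutes_lessThan_3_eqI[OF p] rot3_permutes) auto
    then show ?thesis by simp
  qed
next
  fix p assume "p \<in> {id, Transposition.transpose 1 2, rot3}"
  then show "p \<in> shuffle_perms 2 3"
    using rot3_permutes(1) permutes_id permutes_swap_id[of 1 "{..<3::nat}" 2]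
    unfolding mem_shuffle_perms_2_3 by (auto simp: Transposition.transpose_def)
qed

text \<open>
  The identity occurs both as a \<open>(1, 2)\<close>-shuffle and as a \<open>(2, 1)\<close>-shuffle, whence the factor 2.
\<close>

lemma shuffle_sum_3: "shuffle_sum 3 \<phi> [x, y, z] =
    2 * \<phi> [x, y, z] - \<phi> [y, x, z] - \<phi> [x, z, y] + \<phi> [y, z, x] + \<phi> [z, x, y]"
proof -
  have i3: "{1..<3::nat} = {1, 2}" by auto
  have "inv_into UNIV rot3 \<noteq> id" "inv_into UNIV rot3 \<noteq> Transposition.transpose 0 1"
      "id \<noteq> Transposition.transpose 0 (1::nat)"
    by (auto dest!: fun_cong[of _ _ "0::nat"])
  then have 1: "sum f (shuffle_perms 1 3) = f id + (f (Transposition.transpose 0 1) + f (inv_into UNIV rot3))"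
    for f :: "_ \<Rightarrow> 'a"
    unfolding shuffle_perms_1_3 by (simp add: eq_commute)
  have "rot3 \<noteq> id" "rot3 \<noteq> Transposition.transpose 1 2"
    by (auto dest!: fun_cong[of _ _ "0::nat"] simp: Transposition.transpose_def)
  moreover have "id \<noteq> Transposition.transpose 1 (2::nat)"
    by (auto dest!: fun_cong[of _ _ "1::nat"])
  ultimately have 2: "sum f (shuffle_perms 2 3) = f id + (f (Transposition.transpose 1 2) + f rot3)"
    for f :: "_ \<Rightarrow> 'a"
    unfolding shuffle_perms_2_3 by (simp add: eq_commute)
  have pl: "permute_list p [x, y, z] = [[x, y, z] ! p 0, [x, y, z] ! p 1, [x, y, z] ! p 2]" for p
    by (simp add: permute_list_def upt_rec numeral_2_eq_2)
  have "inv_into UNIV (inv_into UNIV rot3) = rot3"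
    by (simp add: inv_inv_eq permutes_bij[OF rot3_permutes(1)])
  then show ?thesis
    unfolding shuffle_sum_def i3
    by (simp add: 1[unfolded One_nat_def] 2 pl sign_rot3 sign_swap_id Transposition.transpose_def)
qed

lemma shuffle_sum_add: "shuffle_sum n (\<lambda>xs. \<phi> xs + \<psi> xs) xs = shuffle_sum n \<phi> xs + shuffle_sum n \<psi> xs"
  by (simp add: shuffle_sum_def sum.distrib algebra_simps)

lemma shuffle_sum_uminus: "shuffle_sum n (\<lambda>xs. - \<phi> xs) xs = - shuffle_sum n \<phi> xs"
  by (simp add: shuffle_sum_def sum_negf)

lemma Harr_rel_add: "\<phi> \<in> Harr_rel n L D \<Longrightarrow> \<psi> \<in> Harr_rel n L D \<Longrightarrow> (\<lambda>xs. \<phi> xs + \<psi> xs) \<in> Harr_rel n L D"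
  by (auto simp: Harr_rel_def Harr_def shuffle_sum_add)

lemma Harr_rel_uminus: "\<phi> \<in> Harr_rel n L D \<Longrightarrow> (\<lambda>xs. - \<phi> xs) \<in> Harr_rel n L D"
  by (auto simp: Harr_rel_def Harr_def shuffle_sum_uminus)

lemma Harr_rel_zero: "(\<lambda>xs. 0) \<in> Harr_rel n L D"
  by (auto simp: Harr_rel_def Harr_def shuffle_sum_def)

lemma T_relI:
  assumes "\<phi> \<in> T_cocycles L i R" "\<psi> \<in> T_cocycles L i R"
    and "e \<in> Harr_rel i L (L - translate L R)" "(\<lambda>xs. \<phi> xs - \<psi> xs) = cobd (i + 1) L e"
  shows "(\<phi>, \<psi>) \<in> T_rel L i R"
  using assms unfolding T_rel_def by blast

lemma T_rel_1_iff: "(\<phi>, \<psi>) \<in> T_rel L 1 R \<longleftrightarrow> \<phi> \<in> T_cocycles L 1 R \<and> \<psi> \<in> T_cocycles L 1 R \<and>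
    (\<exists>e\<in>Harr_rel 1 L (L - translate L R). (\<lambda>xs. \<phi> xs - \<psi> xs) = cobd 2 L e)"
  unfolding T_rel_def one_add_one by blast

lemma equiv_T_rel: "equiv (T_cocycles L i R) (T_rel L i R)"
proof (intro equivI refl_onI symI transI)
  show "T_rel L i R \<subseteq> T_cocycles L i R \<times> T_cocycles L i R"
    by (auto simp: T_rel_def)
next
  fix \<phi> :: "'a cochain" assume "\<phi> \<in> T_cocycles L i R"
  then show "(\<phi>, \<phi>) \<in> T_rel L i R"
    by (intro T_relI[where e = "\<lambda>_. 0"]) (auto simp: Harr_rel_zero cobd_def)
next
  fix \<phi> \<psi> :: "'a cochain" assume "(\<phi>, \<psi>) \<in> T_rel L i R"
  then obtain e where *: "\<phi> \<in> T_cocycles L i R" "\<psi> \<in> T_cocycles L i R"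
    "e \<in> Harr_rel i L (L - translate L R)" "(\<lambda>xs. \<phi> xs - \<psi> xs) = cobd (i + 1) L e"
    unfolding T_rel_def by auto
  have "(\<lambda>xs. \<psi> xs - \<phi> xs) = cobd (i + 1) L (\<lambda>xs. - e xs)"
    unfolding cobd_uminus *(4)[symmetric] by simp
  then show "(\<psi>, \<phi>) \<in> T_rel L i R" using * by (intro T_relI[where e = "\<lambda>xs. - e xs"] Harr_rel_uminus)
next
  fix \<phi> \<psi> \<rho> :: "'a cochain" assume "(\<phi>, \<psi>) \<in> T_rel L i R" "(\<psi>, \<rho>) \<in> T_rel L i R"
  then obtain e e' where *: "\<phi> \<in> T_cocycles L i R" "\<rho> \<in> T_cocycles L i R"
    "e \<in> Harr_rel i L (L - translate L R)" "(\<lambda>xs. \<phi> xs - \<psi> xs) = cobd (i + 1) L e"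
    "e' \<in> Harr_rel i L (L - translate L R)" "(\<lambda>xs. \<psi> xs - \<rho> xs) = cobd (i + 1) L e'"
    unfolding T_rel_def by auto
  have "(\<lambda>xs. \<phi> xs - \<rho> xs) = cobd (i + 1) L (\<lambda>xs. e xs + e' xs)"
    unfolding cobd_add *(4)[symmetric] *(6)[symmetric] by simp
  then show "(\<phi>, \<rho>) \<in> T_rel L i R" using * by (intro T_relI[where e = "\<lambda>xs. e xs + e' xs"] Harr_rel_add)
qed

section \<open>The bracket of two coboundaries\<close>

lemma mem_translate: "r \<in> translate L R \<longleftrightarrow> r - R \<in> L"
  by (auto simp: translate_def image_iff algebra_simps) (metis diff_add_cancel)

lemma cobd_2_Harr: "cobd 2 L \<phi> \<in> Harr 2 L"
proof -
  have "cobd 2 L \<phi> [x, y] = cobd 2 L \<phi> [y, x]" for x y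
    by (auto simp: cobd_2 Stup_2_iff add.commute)
  then show ?thesis by (auto simp: Harr_2_iff cobd_outside)
qed

text \<open>
  With a cochain \<open>\<phi>\<close> viewed as the operator \<open>\<chi>\<^sup>x \<mapsto> \<phi>(x) \<chi>\<^bsup>x - R\<^esup>\<close> on \<open>k[M]\<close> and \<open>\<mu>\<close> the multiplication,
  this is the double commutator \<open>[\<phi>, [\<mu>, \<psi>]]\<close> restricted to the monoid \<open>L\<close>.
\<close>

definition lie_cochain :: "lat set \<Rightarrow> lat \<Rightarrow> 'k::field_char_0 cochain \<Rightarrow> 'k cochain \<Rightarrow> 'k cochain" where
  "lie_cochain L R \<phi> \<psi> xs = (case xs of
     [x, y] \<Rightarrow> if x \<in> L \<and> y \<in> L then
         \<phi> [x + y - R] * (\<psi> [x] + \<psi> [y] - \<psi> [x + y])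
       - \<phi> [x] * (\<psi> [x - R] + \<psi> [y] - \<psi> [x + y - R])
       - \<phi> [y] * (\<psi> [x] + \<psi> [y - R] - \<psi> [x + y - R]) else 0
   | _ \<Rightarrow> 0)"

lemma lie_cochain_2: "lie_cochain L R \<phi> \<psi> [x, y] = (if x \<in> L \<and> y \<in> L then
         \<phi> [x + y - R] * (\<psi> [x] + \<psi> [y] - \<psi> [x + y])
       - \<phi> [x] * (\<psi> [x - R] + \<psi> [y] - \<psi> [x + y - R])
       - \<phi> [y] * (\<psi> [x] + \<psi> [y - R] - \<psi> [x + y - R]) else 0)"
  by (simp add: lie_cochain_def)

lemma lie_cochain_Harr:
  assumes "\<And>x y. x \<in> L \<Longrightarrow> y \<in> L \<Longrightarrow> x + y \<in> L"
  shows "lie_cochain L R \<phi> \<psi> \<in> Harr 2 L"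
proof -
  have "lie_cochain L R \<phi> \<psi> xs = 0" if "xs \<notin> Stup 2 L" for xs
    using that assms by (auto simp: lie_cochain_def Stup_2_iff split: list.splits)
  moreover have "lie_cochain L R \<phi> \<psi> [x, y] = lie_cochain L R \<phi> \<psi> [y, x]" for x y
    by (simp add: lie_cochain_2 add.commute)
  ultimately show ?thesis by (simp add: Harr_2_iff)
qed

lemma bracket_outside:
  assumes "\<And>xs. xs \<notin> Stup 2 L \<Longrightarrow> f xs = 0" "\<And>xs. xs \<notin> Stup 2 L \<Longrightarrow> g xs = 0"
    and "\<And>x y. x \<in> L \<Longrightarrow> y \<in> L \<Longrightarrow> x + y \<in> L" "xs \<notin> Stup 3 L"
  shows "bracket R S f g xs = 0"
proof (cases "\<exists>x y z. xs = [x, y, z]")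
  case True
  then obtain x y z where xs: "xs = [x, y, z]" by blast
  have f: "f [x, y] = 0" if "x \<notin> L \<or> y \<notin> L" for x y using assms(1) that by (auto simp: Stup_2_iff)
  have g: "g [x, y] = 0" if "x \<notin> L \<or> y \<notin> L" for x y using assms(2) that by (auto simp: Stup_2_iff)
  have "x \<notin> L \<or> y \<notin> L \<or> z \<notin> L" using assms(3,4) by (auto simp: xs Stup_3_iff)
  then show ?thesis by (auto simp: xs bracket_def f g)
next
  case False
  then show ?thesis by (auto simp: bracket_def split: list.splits)
qed

lemma bracket_commute: "bracket R R f g = bracket R R g f"
  by (rule ext) (simp add: bracket_def algebra_simps split: list.splits)

text \<open>
  On all of \<open>M\<close> this is the Jacobi identity together with \<open>[\<mu>, [\<mu>, \<psi>]] = 0\<close>.  On \<open>L\<close> the only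
  discrepancy is in the coboundaries evaluated at a point such as \<open>x + y - R\<close> outside \<open>L\<close>; there
  the other factor is zero by hypothesis, so every product may be computed in \<open>M\<close>.
\<close>

lemma bracket_eq_lie_cobd:
  assumes add: "\<And>x y. x \<in> L \<Longrightarrow> y \<in> L \<Longrightarrow> x + y \<in> L"
    and f: "\<forall>xs\<in>Stup 2 (L - translate L R). cobd 2 L \<phi> xs = 0"
    and g: "\<forall>xs\<in>Stup 2 (L - translate L R). cobd 2 L \<psi> xs = 0"
  shows "bracket R R (cobd 2 L \<phi>) (cobd 2 L \<psi>) = (\<lambda>xs. - cobd 3 L (lie_cochain L R \<phi> \<psi>) xs)"
proof
  fix xs
  show "bracket R R (cobd 2 L \<phi>) (cobd 2 L \<psi>) xs = - cobd 3 L (lie_cochain L R \<phi> \<psi>) xs"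
  proof (cases "xs \<in> Stup 3 L")
    case False
    then show ?thesis
      using bracket_outside[OF cobd_outside cobd_outside add False] by (simp add: cobd_outside)
  next
    case True
    then obtain x y z where xs: "xs = [x, y, z]" and L: "x \<in> L" "y \<in> L" "z \<in> L"
      by (auto simp: Stup_3_iff)
    have D: "cobd 2 L \<rho> [x, y] = \<rho> [x] + \<rho> [y] - \<rho> [x + y]" if "x \<in> L" "y \<in> L"
      for \<rho> :: "'a cochain" and x y using that add by (simp add: cobd_2 Stup_2_iff)
    have sing: "\<rho> [x] + \<rho> [y] - \<rho> [x + y] = 0" if "x \<in> L" "y \<in> L" "x + y - R \<notin> L"
      "\<forall>xs\<in>Stup 2 (L - translate L R). cobd 2 L \<rho> xs = 0" for \<rho> :: "'a cochain" and x y
    proof -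
      have "x - R \<notin> L" "y - R \<notin> L"
        using add[of "x - R" y] add[of x "y - R"] that by (auto simp: algebra_simps)
      then have "[x, y] \<in> Stup 2 (L - translate L R)"
        using that add by (simp add: Stup_2_iff mem_translate)
      then show ?thesis using that D by force
    qed
    have 1: "cobd 2 L \<rho> [- R + x + y, z] * cobd 2 L \<rho>' [x, y] =
      (\<rho> [x + y - R] + \<rho> [z] - \<rho> [x + y + z - R]) * (\<rho>' [x] + \<rho>' [y] - \<rho>' [x + y])"
      if "x \<in> L" "y \<in> L" "z \<in> L" "\<forall>xs\<in>Stup 2 (L - translate L R). cobd 2 L \<rho>' xs = 0"
      for \<rho> \<rho>' :: "'a cochain" and x y z
    proof (cases "x + y - R \<in> L")
      case True
      have "- R + x + y = x + y - R" "x + y + z - R = x + y - R + z" by simp_all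
      then show ?thesis by (simp only: D[OF True that(3)] D[OF that(1,2)])
    next
      case False
      then show ?thesis using sing[OF that(1,2) False that(4)] D[OF that(1,2), of \<rho>'] by simp
    qed
    have sym: "cobd 2 L \<rho> [x, y] = cobd 2 L \<rho> [y, x]" for \<rho> :: "'a cochain" and x y
      using cobd_2_Harr[of L \<rho>] by (simp add: Harr_2_iff)
    have 2: "cobd 2 L \<rho> [x, - R + y + z] * cobd 2 L \<rho>' [y, z] =
      (\<rho> [y + z - R] + \<rho> [x] - \<rho> [x + y + z - R]) * (\<rho>' [y] + \<rho>' [z] - \<rho>' [y + z])"
      if "x \<in> L" "y \<in> L" "z \<in> L" "\<forall>xs\<in>Stup 2 (L - translate L R). cobd 2 L \<rho>' xs = 0"
      for \<rho> \<rho>' :: "'a cochain" and x y z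
      using 1[OF that(2,3,1,4), of \<rho>] by (subst sym) (simp add: algebra_simps)
    show ?thesis
      unfolding xs bracket_def list.case 1[OF L g] 1[OF L f] 2[OF L g] 2[OF L f]
      by (simp add: cobd_3 lie_cochain_2 Stup_3_iff L add) (simp add: algebra_simps)
  qed
qed

section \<open>Splitting of symmetric cocycles\<close>

text \<open>
  The cocycle defines a commutative cancellative monoid \<open>E\<close> on \<open>L \<times> k\<close> lying over \<open>L\<close>.
  Lift the three basis vectors arbitrarily.  An element \<open>x\<close> of \<open>L\<close> may have a negative
  coordinate along \<open>n\<close>, but after adding a multiple of \<open>n\<close> it is a nonnegative combination of the
  basis; since \<open>E\<close> is cancellative, this singles out one lift of \<open>x\<close>.  These lifts are
  multiplicative, and their second components form the primitive.
\<close>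

lemma symmetric_cocycle_splits:
  fixes C :: "lat \<Rightarrow> lat \<Rightarrow> 'k::field_char_0" and \<alpha> \<beta> \<gamma> :: "lat \<Rightarrow> int"
  assumes add: "\<And>x y. x \<in> L \<Longrightarrow> y \<in> L \<Longrightarrow> x + y \<in> L" and zero: "0 \<in> L"
    and sym: "\<And>x y. x \<in> L \<Longrightarrow> y \<in> L \<Longrightarrow> C x y = C y x"
    and cocycle: "\<And>x y z. x \<in> L \<Longrightarrow> y \<in> L \<Longrightarrow> z \<in> L \<Longrightarrow> C y z - C (x + y) z + C x (y + z) - C x y = 0"
    and basis: "n \<in> L" "v \<in> L" "u \<in> L"
    and coord: "\<And>x. x = \<alpha> x *s n + \<beta> x *s v + \<gamma> x *s u"
    and lin: "\<And>x y. \<alpha> (x + y) = \<alpha> x + \<alpha> y" "\<And>x y. \<beta> (x + y) = \<beta> x + \<beta> y"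
      "\<And>x y. \<gamma> (x + y) = \<gamma> x + \<gamma> y"
    and pos: "\<And>x. x \<in> L \<Longrightarrow> 0 \<le> \<beta> x" "\<And>x. x \<in> L \<Longrightarrow> 0 \<le> \<gamma> x"
  shows "\<exists>G. \<forall>x\<in>L. \<forall>y\<in>L. C x y = G x + G y - G (x + y)"
proof -
  define E where "E = \<lparr>carrier = L \<times> (UNIV :: 'k set),
    monoid.mult = (\<lambda>p q. (fst p + fst q, snd p + snd q - C (fst p) (fst q))), one = (0, C 0 0)\<rparr>"
  have C0: "C 0 y = C 0 0" if "y \<in> L" for y using cocycle[OF zero zero that] by simp
  have mult: "(x, c) \<otimes>\<^bsub>E\<^esub> (y, d) = (x + y, c + d - C x y)" for x y c d by (simp add: E_def)
  have fst_mult: "fst (p \<otimes>\<^bsub>E\<^esub> q) = fst p + fst q" for p q by (simp add: E_def)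
  have car: "p \<in> carrier E \<longleftrightarrow> fst p \<in> L" for p by (auto simp: E_def mem_Times_iff)
  interpret E: comm_monoid E
  proof (rule comm_monoidI)
    fix p q r assume "p \<in> carrier E" "q \<in> carrier E" "r \<in> carrier E"
    then have L: "fst p \<in> L" "fst q \<in> L" "fst r \<in> L" by (auto simp: car)
    show "p \<otimes>\<^bsub>E\<^esub> q \<otimes>\<^bsub>E\<^esub> r = p \<otimes>\<^bsub>E\<^esub> (q \<otimes>\<^bsub>E\<^esub> r)"
      using cocycle[OF L] by (simp add: E_def algebra_simps)
  next
    fix p q assume "p \<in> carrier E" "q \<in> carrier E"
    then show "p \<otimes>\<^bsub>E\<^esub> q = q \<otimes>\<^bsub>E\<^esub> p" using sym[of "fst p" "fst q"] by (simp add: E_def add.commute mem_Times_iff)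
  next
    fix p assume "p \<in> carrier E"
    then show "\<one>\<^bsub>E\<^esub> \<otimes>\<^bsub>E\<^esub> p = p"
      using C0[of "fst p"] by (simp add: E_def mem_Times_iff prod_eq_iff)
  qed (simp_all add: E_def zero add mem_Times_iff)
  have cancel: "p = p'" if "p \<otimes>\<^bsub>E\<^esub> q = p' \<otimes>\<^bsub>E\<^esub> q" for p p' q
    using that by (auto simp: E_def prod_eq_iff)
  have pow_fst: "fst (p [^]\<^bsub>E\<^esub> k) = int k *s fst p" for p and k :: nat
  proof (induction k)
    case 0
    then show ?case by (simp add: E_def)
  next
    case (Suc k)
    then show ?case by (simp add: fst_mult vec_eq_iff algebra_simps)
  qed
  define \<nu> \<upsilon> \<omega> where "\<nu> = (n, 0 :: 'k)" and "\<upsilon> = (v, 0 :: 'k)" and "\<omega> = (u, 0 :: 'k)"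
  have gens: "\<nu> \<in> carrier E" "\<upsilon> \<in> carrier E" "\<omega> \<in> carrier E"
    using basis by (simp_all add: car \<nu>_def \<upsilon>_def \<omega>_def)
  define P where "P p b g = \<nu> [^]\<^bsub>E\<^esub> p \<otimes>\<^bsub>E\<^esub> (\<upsilon> [^]\<^bsub>E\<^esub> b \<otimes>\<^bsub>E\<^esub> \<omega> [^]\<^bsub>E\<^esub> g)" for p b g :: nat
  have P_closed: "P p b g \<in> carrier E" for p b g using gens by (simp add: P_def)
  have P_mult: "P p b g \<otimes>\<^bsub>E\<^esub> P p' b' g' = P (p + p') (b + b') (g + g')" for p b g p' b' g'
    using gens by (simp add: P_def E.nat_pow_mult[symmetric] E.m_ac)
  have P_pow: "P p b g \<otimes>\<^bsub>E\<^esub> \<nu> [^]\<^bsub>E\<^esub> q = P (p + q) b g" for p b g and q :: nat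
    using gens by (simp add: P_def E.nat_pow_mult[symmetric] E.m_ac)
  have P_fst: "fst (P p b g) = int p *s n + int b *s v + int g *s u" for p b g
    by (simp add: P_def fst_mult pow_fst \<nu>_def \<upsilon>_def \<omega>_def)
  define G where "G x = snd (P (nat (\<alpha> x)) (nat (\<beta> x)) (nat (\<gamma> x)))
    - snd (\<nu> [^]\<^bsub>E\<^esub> nat (- \<alpha> x)) + C x (int (nat (- \<alpha> x)) *s n)" for x
  have G: "(x, G x) \<otimes>\<^bsub>E\<^esub> \<nu> [^]\<^bsub>E\<^esub> nat (- \<alpha> x) = P (nat (\<alpha> x)) (nat (\<beta> x)) (nat (\<gamma> x))"
    if x: "x \<in> L" for x
  proof (rule prod_eqI)
    have "x + int (nat (- \<alpha> x)) *s n = (\<alpha> x + int (nat (- \<alpha> x))) *s n + \<beta> x *s v + \<gamma> x *s u"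
      by (subst (1) coord[of x]) (simp add: vec_eq_iff algebra_simps)
    also have "\<alpha> x + int (nat (- \<alpha> x)) = int (nat (\<alpha> x))" by simp
    finally show "fst ((x, G x) \<otimes>\<^bsub>E\<^esub> \<nu> [^]\<^bsub>E\<^esub> nat (- \<alpha> x)) = fst (P (nat (\<alpha> x)) (nat (\<beta> x)) (nat (\<gamma> x)))"
      using pos[OF x] by (simp add: fst_mult pow_fst P_fst \<nu>_def)
    have "fst (\<nu> [^]\<^bsub>E\<^esub> nat (- \<alpha> x)) = int (nat (- \<alpha> x)) *s n" by (simp add: pow_fst \<nu>_def)
    moreover have "snd ((x, G x) \<otimes>\<^bsub>E\<^esub> q) = G x + snd q - C x (fst q)" for q by (simp add: E_def)
    ultimately show "snd ((x, G x) \<otimes>\<^bsub>E\<^esub> \<nu> [^]\<^bsub>E\<^esub> nat (- \<alpha> x)) = snd (P (nat (\<alpha> x)) (nat (\<beta> x)) (nat (\<gamma> x)))"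
      by (simp add: G_def)
  qed
  have "C x y = G x + G y - G (x + y)" if L: "x \<in> L" "y \<in> L" for x y
  proof -
    let ?q = "\<lambda>x. nat (- \<alpha> x)" and ?p = "\<lambda>x. nat (\<alpha> x)"
    let ?X = "(x, G x)" and ?Y = "(y, G y)" and ?Z = "(x + y, G (x + y))"
    have cl: "?X \<in> carrier E" "?Y \<in> carrier E" "?Z \<in> carrier E" using L add by (simp_all add: car)
    have bg: "nat (\<beta> (x + y)) = nat (\<beta> x) + nat (\<beta> y)" "nat (\<gamma> (x + y)) = nat (\<gamma> x) + nat (\<gamma> y)"
      using pos L by (simp_all add: lin nat_add_distrib)
    have pq: "?p (x + y) + (?q x + ?q y) = ?p x + ?p y + ?q (x + y)"
      unfolding lin by arith
    have "(?X \<otimes>\<^bsub>E\<^esub> ?Y) \<otimes>\<^bsub>E\<^esub> \<nu> [^]\<^bsub>E\<^esub> (?q x + ?q y + ?q (x + y)) =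
        (?X \<otimes>\<^bsub>E\<^esub> \<nu> [^]\<^bsub>E\<^esub> ?q x) \<otimes>\<^bsub>E\<^esub> (?Y \<otimes>\<^bsub>E\<^esub> \<nu> [^]\<^bsub>E\<^esub> ?q y) \<otimes>\<^bsub>E\<^esub> \<nu> [^]\<^bsub>E\<^esub> ?q (x + y)"
      using cl gens by (simp add: E.nat_pow_mult[symmetric] E.m_ac)
    also have "\<dots> = P (?p x + ?p y + ?q (x + y)) (nat (\<beta> x) + nat (\<beta> y)) (nat (\<gamma> x) + nat (\<gamma> y))"
      unfolding G[OF L(1)] G[OF L(2)] P_mult P_pow ..
    also have "\<dots> = P (?p (x + y)) (nat (\<beta> (x + y))) (nat (\<gamma> (x + y))) \<otimes>\<^bsub>E\<^esub> \<nu> [^]\<^bsub>E\<^esub> (?q x + ?q y)"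
      unfolding P_pow bg pq ..
    also have "\<dots> = ?Z \<otimes>\<^bsub>E\<^esub> \<nu> [^]\<^bsub>E\<^esub> ?q (x + y) \<otimes>\<^bsub>E\<^esub> \<nu> [^]\<^bsub>E\<^esub> (?q x + ?q y)"
      unfolding G[OF add[OF L]] ..
    also have "\<dots> = ?Z \<otimes>\<^bsub>E\<^esub> \<nu> [^]\<^bsub>E\<^esub> (?q x + ?q y + ?q (x + y))"
      using cl gens by (simp add: E.nat_pow_mult[symmetric] E.m_ac)
    finally have "?X \<otimes>\<^bsub>E\<^esub> ?Y = ?Z" by (rule cancel)
    then show ?thesis by (simp add: mult algebra_simps)
  qed
  then show ?thesis by blast
qed

section \<open>Cones over primitive polygons\<close>

lemma det_cyclic:
  fixes x y z :: "int ^ 3"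
  shows "det (vector [y, z, x] :: int ^ 3 ^ 3) = det (vector [x, y, z])"
    and "det (vector [z, x, y] :: int ^ 3 ^ 3) = det (vector [x, y, z])"
  by (simp_all add: det_3 algebra_simps)

lemma det_parallelogram:
  fixes x y z :: "int ^ 3"
  shows "det (vector [y, z, z + x - y] :: int ^ 3 ^ 3) = det (vector [x, y, z])"
    and "det (vector [z, z + x - y, x] :: int ^ 3 ^ 3) = det (vector [x, y, z])"
    and "det (vector [z + x - y, x, y] :: int ^ 3 ^ 3) = det (vector [x, y, z])"
  by (simp_all add: det_3 algebra_simps)

text \<open>
  All later arguments use the polygon only through these facts; in particular the adapted basis at each
  edge replaces convex geometry.
\<close>

locale isolated_gorenstein_cone =
  fixes N :: nat and a :: "nat \<Rightarrow> lat" and L :: "lat set"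
  assumes N_ge_3: "3 \<le> N"
    and mem_L: "r \<in> L \<longleftrightarrow> (\<forall>l<N. 0 \<le> pairing (a l) r)"
    and height: "l < N \<Longrightarrow> a l $ 3 = 1"
    and frame: "j < N \<Longrightarrow> \<exists>n v u w. edge_frame N a j n v u w"
begin

lemma zero_L: "0 \<in> L" by (simp add: mem_L)

lemma add_L: "x \<in> L \<Longrightarrow> y \<in> L \<Longrightarrow> x + y \<in> L"
  by (auto simp: mem_L)

lemma mem_D1: "r \<in> L - translate L Rstar \<longleftrightarrow> r \<in> L \<and> (\<exists>j<N. pairing (a j) r = 0)"
  using height by (force simp: mem_translate mem_L)

lemma mem_D2: "r \<in> L - translate L (Rstar + Rstar) \<longleftrightarrow> r \<in> L \<and> (\<exists>j<N. pairing (a j) r \<le> 1)"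
proof -
  have "2 \<le> pairing (a j) r \<longleftrightarrow> \<not> pairing (a j) r \<le> 1" for j by auto
  then show ?thesis using height by (auto simp: mem_translate mem_L)
qed

lemma mem_K1: "j < N \<Longrightarrow> r \<in> Kset L (a j) Rstar \<longleftrightarrow> r \<in> L \<and> pairing (a j) r = 0"
  using height by (force simp: Kset_def mem_L)

lemma mem_K2: "j < N \<Longrightarrow> r \<in> K2 L N a j \<longleftrightarrow> r \<in> L \<and> pairing (a j) r \<le> 1"
  using height[of j] by (auto simp: Kset_def K2_def)

lemma nxt_lt: "j < N \<Longrightarrow> Suc j mod N < N" by simp

lemma nxt_neq: "j < N \<Longrightarrow> Suc j mod N \<noteq> j"
  using N_ge_3 by (cases "Suc j = N") auto

lemma nxt_nxt_neq: "j < N \<Longrightarrow> Suc (Suc j mod N) mod N \<noteq> j"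
  using N_ge_3 by (cases "Suc j = N"; cases "Suc (Suc j) = N") auto

lemma prev_ex: "i < N \<Longrightarrow> \<exists>p<N. Suc p mod N = i"
proof (cases i)
  case 0
  then show "i < N \<Longrightarrow> ?thesis" using N_ge_3 by (intro exI[of _ "N - 1"]) simp
next
  case (Suc p)
  then show "i < N \<Longrightarrow> ?thesis" by (intro exI[of _ p]) simp
qed

text \<open>
  At the vertex \<open>a\<^sub>i\<close> the elements of the monoid vanishing there form, rationally, the cone spanned by
  the normals of the two edges through \<open>a\<^sub>i\<close>.  Both normals are positive at every vertex \<open>a\<^sub>k\<close> that
  is not a neighbour, so a nonnegative combination of them vanishing at \<open>a\<^sub>k\<close> is zero.
\<close>

lemma common_zero_adjacent:
  assumes r: "r \<in> L" and i: "i < N" and k: "k < N" and "i \<noteq> k"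
    and ri: "pairing (a i) r = 0" and rk: "pairing (a k) r = 0"
  shows "r = 0 \<or> k = Suc i mod N \<or> i = Suc k mod N"
proof (rule ccontr)
  assume "\<not> ?thesis"
  then have r0: "r \<noteq> 0" and k1: "k \<noteq> Suc i mod N" and k2: "i \<noteq> Suc k mod N" by auto
  obtain p where p: "p < N" "Suc p mod N = i" using prev_ex[OF i] by blast
  obtain n v u w where fr: "edge_frame N a i n v u w" using frame[OF i] by blast
  obtain m v' u' w' where fp: "edge_frame N a p m v' u' w'" using frame[OF p(1)] by blast
  have ii: "Suc i mod N \<noteq> i" "Suc i mod N \<noteq> p" "p \<noteq> i" "k \<noteq> p"
    using nxt_neq[OF i] nxt_neq[OF p(1)] nxt_nxt_neq[OF p(1)] p k2 by auto
  have x: "x = pairing w x *s n + pairing (a (Suc i mod N)) x *s v + pairing (a i) x *s u" for x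
    using fr unfolding edge_frame_def by blast
  have "pairing (a i) m = 0" using fp i p unfolding edge_frame_def by auto
  define \<beta>' where "\<beta>' = pairing (a (Suc i mod N)) m"
  define \<beta> where "\<beta> = pairing (a (Suc i mod N)) r"
  define \<gamma> where "\<gamma> = \<beta>' * pairing w r - \<beta> * pairing w m"
  have "0 \<le> \<beta>'" "\<beta>' \<noteq> 0" using fp nxt_lt[OF i] ii p unfolding edge_frame_def \<beta>'_def by auto
  then have "0 < \<beta>'" by simp
  have "0 \<le> \<beta>" using r nxt_lt[OF i] by (simp add: mem_L \<beta>_def)
  have rr: "r = pairing w r *s n + \<beta> *s v" using x[of r] ri by (simp add: \<beta>_def)
  have mm: "m = pairing w m *s n + \<beta>' *s v" using x[of m] \<open>pairing (a i) m = 0\<close> by (simp add: \<beta>'_def)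
  have "\<beta>' *s r = \<beta>' *s (pairing w r *s n + \<beta> *s v)" using rr by simp
  also have "\<dots> = \<gamma> *s n + \<beta> *s (pairing w m *s n + \<beta>' *s v)"
    by (simp add: \<gamma>_def vec_eq_iff algebra_simps)
  also have "\<dots> = \<gamma> *s n + \<beta> *s m" using mm by simp
  finally have e: "\<beta>' *s r = \<gamma> *s n + \<beta> *s m" .
  have np: "0 < pairing (a p) n" "0 < pairing (a k) n" "0 < pairing (a k) m"
    "pairing (a p) m = 0"
    using fr fp p k k1 ii \<open>i \<noteq> k\<close> unfolding edge_frame_def by (metis order_le_less)+
  have ev: "\<beta>' * pairing (a l) r = \<gamma> * pairing (a l) n + \<beta> * pairing (a l) m" for l
    using arg_cong[OF e, of "pairing (a l)"] by simp
  have "0 \<le> \<beta>' * pairing (a p) r" using r p \<open>0 < \<beta>'\<close> by (simp add: mem_L)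
  then have "0 \<le> \<gamma> * pairing (a p) n" using ev[of p] np by simp
  then have "0 \<le> \<gamma>" using np(1) by (simp add: zero_le_mult_iff)
  moreover have "\<gamma> * pairing (a k) n + \<beta> * pairing (a k) m = 0" using ev[of k] rk by simp
  ultimately have "\<gamma> = 0 \<and> \<beta> = 0" using np \<open>0 \<le> \<beta>\<close>
    by (simp add: add_nonneg_eq_0_iff)
  then have "\<beta>' *s r = 0" using e by simp
  then show False using r0 \<open>\<beta>' \<noteq> 0\<close> by (simp add: vec_eq_iff)
qed

section \<open>First-order deformations in degree minus R*\<close>

lemma cyclic_constant:
  assumes "\<And>j. j < N \<Longrightarrow> e (Suc j mod N) = e j" "j < N"
  shows "e j = e 0"
  using assms(2)
proof (induction j)
  case (Suc j)
  then show ?case using assms(1)[of j] by simp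
qed simp

lemma height_dvec [simp]: "j < N \<Longrightarrow> dvec N a j $ 3 = 0"
  by (simp add: dvec_def height)

text \<open>
  The relation defining \<open>V\<close> closes the partial sums \<open>b\<^sub>j\<close> of \<open>t\<^sub>i d\<^sub>i\<close> cyclically.  The forms \<open>b\<^sub>j\<close> agree
  where the facets meet: away from 0 only neighbouring facets meet, and there \<open>d\<^sub>j\<close> vanishes.
\<close>

lemma glued_nonempty:
  fixes t :: "nat \<Rightarrow> 'k::field_char_0"
  assumes t: "t \<in> Vspace N a"
  shows "\<exists>\<xi>. \<xi> \<in> glued L N a t"
proof -
  define b where "b j = (\<Sum>i<j. t i *s ext (dvec N a i))" for j
  have step: "b (Suc j mod N) - b j = t j *s ext (dvec N a j)" if "j < N" for j
  proof (cases "Suc j = N")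
    case True
    have "b (Suc j) = b j + t j *s ext (dvec N a j)" by (simp add: b_def)
    moreover have "b N = 0" using t by (simp add: b_def Vspace_def)
    ultimately have "- b j = t j *s ext (dvec N a j)" using True by (intro minus_unique) simp
    moreover have "b (Suc j mod N) = 0" using True by (simp add: b_def)
    ultimately show ?thesis by simp
  next
    case False
    then have "Suc j mod N = Suc j" using that by simp
    then show ?thesis by (simp add: b_def)
  qed
  have perp: "pairing (b j) (ext Rstar) = 0" if "j < N" for j
    using that by (auto simp: b_def intro!: sum.neutral)
  have consistent: "pairing (b i) (ext r) = pairing (b k) (ext r)"
    if r: "r \<in> L" and ik: "i < N" "k < N" "pairing (a i) r = 0" "pairing (a k) r = 0" for i k r
  proof -
    have nb: "pairing (b (Suc l mod N)) (ext r) = pairing (b l) (ext r)"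
      if "l < N" "pairing (a l) r = 0" "pairing (a (Suc l mod N)) r = 0" for l
    proof -
      have "pairing (b (Suc l mod N) - b l) (ext r) = 0"
        unfolding step[OF that(1)] using that by (simp add: dvec_def)
      then show ?thesis by simp
    qed
    show ?thesis
    proof (cases "i = k")
      case False
      then consider "r = 0" | "k = Suc i mod N" | "i = Suc k mod N"
        using common_zero_adjacent[OF r ik(1,2)] ik by blast
      then show ?thesis using nb[of i] nb[of k] ik by cases auto
    qed simp
  qed
  define \<xi> where "\<xi> xs = (if xs \<in> Stup 1 (L - translate L Rstar)
     then pairing (b (SOME j. j < N \<and> pairing (a j) (hd xs) = 0)) (ext (hd xs)) else 0)" for xs
  have "\<xi> [r] = pairing (b j) (ext r)" if j: "j < N" and r: "r \<in> Kset L (a j) Rstar" for j r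
  proof -
    have r': "r \<in> L" "pairing (a j) r = 0" using r j by (simp_all add: mem_K1)
    then have "r \<in> L - translate L Rstar" using j by (subst mem_D1) blast
    then have "\<xi> [r] = pairing (b (SOME j. j < N \<and> pairing (a j) r = 0)) (ext r)"
      unfolding \<xi>_def Stup_1_iff by simp
    moreover have "(SOME j. j < N \<and> pairing (a j) r = 0) < N \<and>
       pairing (a (SOME j. j < N \<and> pairing (a j) r = 0)) r = 0"
      by (rule someI[of _ j]) (use j r' in simp)
    ultimately show ?thesis using consistent[OF r'(1) _ j _ r'(2)] by simp
  qed
  moreover have "\<forall>xs. xs \<notin> Stup 1 (L - translate L Rstar) \<longrightarrow> \<xi> xs = 0" by (simp add: \<xi>_def)
  ultimately have "\<xi> \<in> glued L N a t"
    unfolding glued_def using step perp by (intro CollectI exI[of _ b]) blast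
  then show ?thesis by blast
qed

lemma gluedE:
  fixes \<xi> :: "'k::field_char_0 cochain"
  assumes "\<xi> \<in> glued L N a t"
  obtains b where "\<And>j. j < N \<Longrightarrow> b (Suc j mod N) - b j = t j *s ext (dvec N a j)"
    and "\<And>j r. j < N \<Longrightarrow> r \<in> L \<Longrightarrow> pairing (a j) r = 0 \<Longrightarrow> \<xi> [r] = pairing (b j) (ext r)"
    and "\<And>r. r \<notin> L \<Longrightarrow> \<xi> [r] = 0" and "\<And>r. r - Rstar \<in> L \<Longrightarrow> \<xi> [r] = 0"
    and "\<And>j. j < N \<Longrightarrow> b j $ 3 = 0"
proof -
  obtain b where b: "\<forall>j<N. pairing (b j) (ext Rstar) = 0 \<and> b (Suc j mod N) - b j = t j *s ext (dvec N a j)"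
    "\<forall>j<N. \<forall>r\<in>Kset L (a j) Rstar. \<xi> [r] = pairing (b j) (ext r)"
    "\<forall>xs. xs \<notin> Stup 1 (L - translate L Rstar) \<longrightarrow> \<xi> xs = 0"
    using assms unfolding glued_def by blast
  show ?thesis
  proof (rule that[of b])
      show "\<xi> [r] = 0" if "r \<notin> L" for r using b(3) that unfolding Stup_1_iff by auto
    show "\<xi> [r] = 0" if "r - Rstar \<in> L" for r
      using b(3) that unfolding Stup_1_iff by (auto simp: mem_translate)
  qed (use b mem_K1 in auto)
qed

lemma cobd_glued_cocycle:
  fixes \<xi> :: "'k::field_char_0 cochain"
  assumes "\<xi> \<in> glued L N a t"
  shows "cobd 2 L \<xi> \<in> T_cocycles L 1 Rstar"
proof -
  obtain b where b: "\<And>j r. j < N \<Longrightarrow> r \<in> L \<Longrightarrow> pairing (a j) r = 0 \<Longrightarrow> \<xi> [r] = pairing (b j) (ext r)"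
    using gluedE[OF assms] by metis
  have "cobd 2 L \<xi> [x, y] = 0" if xy: "x \<in> L" "y \<in> L" "x + y \<in> L - translate L Rstar" for x y
  proof -
    obtain j where j: "j < N" "pairing (a j) (x + y) = 0" using xy(3) unfolding mem_D1 by blast
    moreover have "0 \<le> pairing (a j) x" "0 \<le> pairing (a j) y" using xy j by (simp_all add: mem_L)
    ultimately have "pairing (a j) x = 0" "pairing (a j) y = 0" by simp_all
    then show ?thesis using b[OF j(1)] xy j add_L by (simp add: cobd_2)
  qed
  then have "\<forall>xs\<in>Stup 2 (L - translate L Rstar). cobd 2 L \<xi> xs = 0"
    by (auto simp: Stup_2_iff)
  then show ?thesis
    using cobd_2_Harr[of L \<xi>] cobd_3_cobd_2[OF add_L] by (simp add: T_cocycles_def Harr_rel_def numeral_2_eq_2 numeral_3_eq_3)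
qed

lemma relative_zero_on_zeros:
  assumes "e \<in> Harr_rel 1 L (L - translate L Rstar)" "x \<in> L" "j < N" "pairing (a j) x = 0"
  shows "e [x] = 0"
proof -
  have "x \<in> L - translate L Rstar" using assms mem_D1 by blast
  then have "[x] \<in> Stup 1 (L - translate L Rstar)" unfolding Stup_1_iff by blast
  then show ?thesis using assms(1) unfolding Harr_rel_def by blast
qed

lemma relative_zero_outside:
  assumes "e \<in> Harr_rel 1 L D" "x \<notin> L"
  shows "e [x] = 0"
  using assms unfolding Harr_rel_def Harr_1_iff Stup_1_iff by blast

text \<open>
  Two choices differ, on the facet of \<open>a\<^sub>j\<close>, by \<open>c a\<^sub>j\<close> plus one and the same linear form \<open>e\<close>.
  The first summand vanishes on that facet, and the second has zero coboundary.
\<close>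

lemma glued_unique:
  fixes \<xi> \<xi>' :: "'k::field_char_0 cochain"
  assumes \<xi>: "\<xi> \<in> glued L N a t" and \<xi>': "\<xi>' \<in> glued L N a t'" and tt: "(t, t') \<in> Vrel N a"
  shows "(cobd 2 L \<xi>, cobd 2 L \<xi>') \<in> T_rel L 1 Rstar"
proof -
  obtain b where b: "\<And>j. j < N \<Longrightarrow> b (Suc j mod N) - b j = t j *s ext (dvec N a j)"
    "\<And>j r. j < N \<Longrightarrow> r \<in> L \<Longrightarrow> pairing (a j) r = 0 \<Longrightarrow> \<xi> [r] = pairing (b j) (ext r)"
    using gluedE[OF \<xi>] by metis
  obtain b' where b': "\<And>j. j < N \<Longrightarrow> b' (Suc j mod N) - b' j = t' j *s ext (dvec N a j)"
    "\<And>j r. j < N \<Longrightarrow> r \<in> L \<Longrightarrow> pairing (a j) r = 0 \<Longrightarrow> \<xi>' [r] = pairing (b' j) (ext r)"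
    using gluedE[OF \<xi>'] by metis
  obtain c where c: "\<And>j. j < N \<Longrightarrow> t j - t' j = c" using tt unfolding Vrel_def by blast
  define e where "e j = b j - b' j - c *s ext (a j)" for j
  have "e (Suc j mod N) = e j" if j: "j < N" for j
  proof -
    have "e (Suc j mod N) - e j =
        (b (Suc j mod N) - b j) - (b' (Suc j mod N) - b' j) - c *s ext (dvec N a j)"
      by (simp add: e_def dvec_def vec_eq_iff algebra_simps)
    also have "\<dots> = 0"
      unfolding b(1)[OF j] b'(1)[OF j] c[OF j, symmetric] by (simp add: vec_eq_iff algebra_simps)
    finally show ?thesis by simp
  qed
  then have e0: "e j = e 0" if "j < N" for j using cyclic_constant[of e] that by blast
  define \<epsilon> where "\<epsilon> xs = (if xs \<in> Stup 1 L then \<xi> xs - \<xi>' xs - pairing (e 0) (ext (hd xs)) else 0)" for xs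
  have "\<epsilon> [x] = 0" if x: "x \<in> L - translate L Rstar" for x
  proof -
    obtain j where j: "j < N" "x \<in> L" "pairing (a j) x = 0" using x unfolding mem_D1 by blast
    have "\<xi> [x] - \<xi>' [x] = pairing (b j - b' j) (ext x)"
      using b(2)[OF j] b'(2)[OF j] by simp
    also have "b j - b' j = e 0 + c *s ext (a j)" using e0[OF j(1)] by (simp add: e_def algebra_simps)
    finally show ?thesis using j unfolding \<epsilon>_def Stup_1_iff by simp
  qed
  then have "\<epsilon> \<in> Harr_rel 1 L (L - translate L Rstar)"
    unfolding Harr_rel_def Harr_1_iff by (auto simp: \<epsilon>_def Stup_1_iff[unfolded One_nat_def])
  moreover have "(\<lambda>xs. cobd 2 L \<xi> xs - cobd 2 L \<xi>' xs) = cobd 2 L \<epsilon>"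
  proof
    fix xs show "cobd 2 L \<xi> xs - cobd 2 L \<xi>' xs = cobd 2 L \<epsilon> xs"
    proof (cases "xs \<in> Stup 2 L")
      case True
      have "\<epsilon> [x] = \<xi> [x] - \<xi>' [x] - pairing (e 0) (ext x)" if "x \<in> L" for x
        using that unfolding \<epsilon>_def Stup_1_iff by simp
      then show ?thesis using True by (auto simp: Stup_2_iff cobd_2)
    qed (simp add: cobd_outside)
  qed
  ultimately show ?thesis
    using cobd_glued_cocycle[OF \<xi>] cobd_glued_cocycle[OF \<xi>'] unfolding T_rel_1_iff by blast
qed

lemma Vrel_refl: "t \<in> Vspace N a \<Longrightarrow> (t, t) \<in> Vrel N a"
  by (auto simp: Vrel_def)

lemma T1_ident_eq:
  fixes \<xi> :: "'k::field_char_0 cochain"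
  assumes t: "t \<in> Vspace N a" and \<xi>: "\<xi> \<in> glued L N a t"
  shows "T1_ident L N a (Vrel N a `` {t}) = T_rel L 1 Rstar `` {cobd 2 L \<xi>}"
proof -
  have "T_rel L 1 Rstar `` {cobd 2 L \<zeta>} = T_rel L 1 Rstar `` {cobd 2 L \<xi>}"
    if "(t, t') \<in> Vrel N a" "\<zeta> \<in> glued L N a t'" for t' \<zeta>
    using equiv_class_eq[OF equiv_T_rel glued_unique[OF \<xi> that(2,1)]] by simp
  then have "T_rel L 1 Rstar `` {cobd 2 L \<zeta>} = T_rel L 1 Rstar `` {cobd 2 L \<xi>}"
    if "t' \<in> Vrel N a `` {t}" "\<zeta> \<in> glued L N a t'" for t' \<zeta> using that by blast
  moreover have "t \<in> Vrel N a `` {t}" using Vrel_refl[OF t] by blast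
  ultimately show ?thesis unfolding T1_ident_def using \<xi> by blast
qed

section \<open>The cup product on classes\<close>

lemma mem_T1_class:
  fixes \<xi> :: "'k::field_char_0 cochain"
  assumes f: "f \<in> T_rel L 1 Rstar `` {cobd 2 L \<xi>}"
  obtains e where "e \<in> Harr_rel 1 L (L - translate L Rstar)" "f = cobd 2 L (\<lambda>xs. \<xi> xs - e xs)"
    "f \<in> T_cocycles L 1 Rstar"
proof -
  obtain e where e: "e \<in> Harr_rel 1 L (L - translate L Rstar)" "f \<in> T_cocycles L 1 Rstar"
    "(\<lambda>xs. cobd 2 L \<xi> xs - f xs) = cobd 2 L e"
    using f unfolding Image_singleton_iff T_rel_1_iff by blast
  have "f = cobd 2 L (\<lambda>xs. \<xi> xs - e xs)"
  proof
    fix xs show "f xs = cobd 2 L (\<lambda>xs. \<xi> xs - e xs) xs"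
      using fun_cong[OF e(3), of xs] by (simp add: cobd_diff algebra_simps)
  qed
  then show ?thesis using that e by blast
qed

text \<open>
  If a sum lies in a facet, then both summands do.
\<close>

lemma T1_cocycle_vanishes:
  assumes f: "f \<in> T_cocycles L 1 Rstar" and x: "x \<in> L" "y \<in> L" and j: "j < N" "pairing (a j) (x + y) = 0"
  shows "f [x, y] = 0"
proof -
  have "0 \<le> pairing (a j) x" "0 \<le> pairing (a j) y" using x j by (simp_all add: mem_L)
  then have "pairing (a j) x = 0" "pairing (a j) y = 0" using j(2) by simp_all
  then have "[x, y] \<in> Stup 2 (L - translate L Rstar)"
    unfolding Stup_2_iff using mem_D1 x j add_L by blast
  then show ?thesis using f by (simp add: T_cocycles_def Harr_rel_def numeral_2_eq_2)
qed

lemma T1_cocycle_outside: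
  assumes f: "f \<in> T_cocycles L 1 Rstar" and "xs \<notin> Stup 2 L"
  shows "f xs = 0"
  using assms by (simp add: T_cocycles_def Harr_rel_def Harr_def numeral_2_eq_2)

lemma T1_cocycle_Harr:
  assumes f: "f \<in> T_cocycles L 1 Rstar"
  shows "f \<in> Harr 2 L"
  using assms by (simp add: T_cocycles_def Harr_rel_def numeral_2_eq_2)

text \<open>
  At level at most 1 with respect to \<open>a\<^sub>j\<close>, the arguments of the outer factor have level at most 0
  after the shift by \<open>R\<close>: they lie either outside the monoid or in the facet of \<open>a\<^sub>j\<close>.
\<close>

lemma bracket_vanishes:
  assumes f: "f \<in> T_cocycles L 1 Rstar" and g: "g \<in> T_cocycles L 1 Rstar"
    and L: "x \<in> L" "y \<in> L" "z \<in> L" and j: "j < N" "pairing (a j) (x + y + z) \<le> 1"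
  shows "bracket Rstar Rstar f g [x, y, z] = 0"
proof -
  have 1: "f [- Rstar + x + y, z] = 0" if f: "f \<in> T_cocycles L 1 Rstar"
    and L: "x \<in> L" "y \<in> L" "z \<in> L" and j: "j < N" "pairing (a j) (x + y + z) \<le> 1" for f :: "'a cochain" and x y z
  proof (cases "x + y - Rstar \<in> L")
    case True
    then have "0 \<le> pairing (a j) (x + y - Rstar)" "0 \<le> pairing (a j) z" using L j by (simp_all add: mem_L)
    then have "pairing (a j) (x + y - Rstar + z) = 0" using j height[OF j(1)] by simp
    moreover have "- Rstar + x + y = x + y - Rstar" by simp
    ultimately show ?thesis using T1_cocycle_vanishes[OF f True L(3) j(1)] by (simp only:)
  next
    case False
    then have "- Rstar + x + y \<notin> L" by (simp add: algebra_simps)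
    then show ?thesis by (intro T1_cocycle_outside[OF f]) (simp add: Stup_2_iff)
  qed
  have 2: "f [x, - Rstar + y + z] = 0" if f: "f \<in> T_cocycles L 1 Rstar"
    and L: "x \<in> L" "y \<in> L" "z \<in> L" and j: "j < N" "pairing (a j) (x + y + z) \<le> 1" for f :: "'a cochain" and x y z
    using 1[OF f L(2,3,1) j(1)] j(2) T1_cocycle_Harr[OF f] by (simp add: Harr_2_iff algebra_simps)
  show ?thesis using 1[OF f L j] 1[OF g L j] 2[OF f L j] 2[OF g L j] by (simp add: bracket_def)
qed

text \<open>
  The Harrison condition reduces to the symmetry of \<open>lie_cochain\<close>: the shuffle sum of the
  coboundary of a symmetric cochain vanishes.
\<close>

lemma bracket_cocycle:
  assumes f: "cobd 2 L \<phi> \<in> T_cocycles L 1 Rstar" and g: "cobd 2 L \<psi> \<in> T_cocycles L 1 Rstar"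
  shows "bracket Rstar Rstar (cobd 2 L \<phi>) (cobd 2 L \<psi>) \<in> T_cocycles L 2 (Rstar + Rstar)"
    and "bracket Rstar Rstar (cobd 2 L \<phi>) (cobd 2 L \<psi>) =
      (\<lambda>xs. - cobd 3 L (lie_cochain L Rstar \<phi> \<psi>) xs)"
proof -
  let ?B = "bracket Rstar Rstar (cobd 2 L \<phi>) (cobd 2 L \<psi>)"
  let ?C = "lie_cochain L Rstar \<phi> \<psi>"
  show eq: "?B = (\<lambda>xs. - cobd 3 L ?C xs)"
    using f g by (intro bracket_eq_lie_cobd add_L) (simp_all add: T_cocycles_def Harr_rel_def numeral_2_eq_2)
  have C: "?C [x, y] = ?C [y, x]" for x y
    using lie_cochain_Harr[OF add_L, of Rstar \<phi> \<psi>] by (simp add: Harr_2_iff)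
  have "shuffle_sum 3 ?B [x, y, z] = 0" if "x \<in> L" "y \<in> L" "z \<in> L" for x y z
    unfolding eq shuffle_sum_3 using that
    by (simp add: cobd_3 Stup_3_iff add_L C[of x y] C[of z y] C[of z x] C[of "x + y" z]
        C[of "y + z" x] C[of "x + z" y] add.commute[of y x] add.commute[of z x] add.commute[of z y])
  moreover have "?B xs = 0" if "xs \<notin> Stup 3 L" for xs
    using that unfolding eq by (simp add: cobd_outside)
  moreover have "?B xs = 0" if xs: "xs \<in> Stup 3 (L - translate L (Rstar + Rstar))" for xs
  proof -
    obtain x y z where xyz: "xs = [x, y, z]" "x \<in> L" "y \<in> L" "z \<in> L"
      "x + y + z \<in> L - translate L (Rstar + Rstar)" using xs unfolding Stup_3_iff by blast
    then show ?thesis using bracket_vanishes[OF f g] unfolding mem_D2 by blast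
  qed
  ultimately have "?B \<in> Harr_rel 3 L (L - translate L (Rstar + Rstar))"
    unfolding Harr_rel_def Harr_def by (auto simp: Stup_3_iff)
  moreover have "cobd 4 L ?B = (\<lambda>_. 0)"
    unfolding eq cobd_uminus using cobd_4_cobd_3[OF add_L] by (simp add: fun_eq_iff)
  ultimately show "?B \<in> T_cocycles L 2 (Rstar + Rstar)"
    by (simp add: T_cocycles_def)
qed

text \<open>
  By bilinearity the difference is the coboundary of \<open>lie_cochain\<close> of \<open>e\<close> and \<open>\<psi>\<close>.  Since \<open>e\<close> is
  relative, this cochain is relative for the doubled degree: each of its terms contains a value of
  \<open>e\<close> or of the coboundary of \<open>\<psi>\<close> at level 0.
\<close>

lemma bracket_relative:
  assumes f: "cobd 2 L \<phi> \<in> T_cocycles L 1 Rstar" and f': "cobd 2 L (\<lambda>xs. \<phi> xs - e xs) \<in> T_cocycles L 1 Rstar"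
    and g: "cobd 2 L \<psi> \<in> T_cocycles L 1 Rstar"
    and e: "e \<in> Harr_rel 1 L (L - translate L Rstar)"
  shows "(bracket Rstar Rstar (cobd 2 L \<phi>) (cobd 2 L \<psi>),
     bracket Rstar Rstar (cobd 2 L (\<lambda>xs. \<phi> xs - e xs)) (cobd 2 L \<psi>)) \<in> T_rel L 2 (Rstar + Rstar)"
proof -
  let ?C = "lie_cochain L Rstar e \<psi>"
  have lin: "lie_cochain L Rstar \<phi> \<psi> xs - lie_cochain L Rstar (\<lambda>xs. \<phi> xs - e xs) \<psi> xs = ?C xs" for xs
  proof (cases "\<exists>x y. xs = [x, y]")
    case True
    then show ?thesis by (auto simp: lie_cochain_2) (simp add: algebra_simps)
  next
    case False
    then show ?thesis by (auto simp: lie_cochain_def split: list.split)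
  qed
  have "?C [x, y] = 0" if xy: "x \<in> L" "y \<in> L" and j: "j < N" "pairing (a j) (x + y) \<le> 1" for x y j
  proof -
    have D: "cobd 2 L \<psi> [x, y] = \<psi> [x] + \<psi> [y] - \<psi> [x + y]" if "x \<in> L" "y \<in> L"
      for x y using that add_L by (simp add: cobd_2 Stup_2_iff)
    have 1: "e [x + y - Rstar] = 0"
    proof (cases "x + y - Rstar \<in> L")
      case True
      then have "0 \<le> pairing (a j) (x + y - Rstar)" using j unfolding mem_L by blast
      then have "pairing (a j) (x + y - Rstar) = 0" using j height[OF j(1)] by simp
      then show ?thesis using relative_zero_on_zeros[OF e True j(1)] by simp
    qed (rule relative_zero_outside[OF e])
    have 2: "e [x] * (\<psi> [x - Rstar] + \<psi> [y] - \<psi> [x + y - Rstar]) = 0"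
      if xy: "x \<in> L" "y \<in> L" and j: "pairing (a j) (x + y) \<le> 1" for x y
    proof (cases "x - Rstar \<in> L")
      case True
      then have "0 \<le> pairing (a j) (x - Rstar)" "0 \<le> pairing (a j) y"
        using \<open>j < N\<close> xy(2) unfolding mem_L by blast+
      then have "pairing (a j) (x - Rstar + y) = 0" using j height[OF \<open>j < N\<close>] by simp
      then have "\<psi> [x - Rstar] + \<psi> [y] - \<psi> [x - Rstar + y] = 0"
        using T1_cocycle_vanishes[OF g True xy(2) \<open>j < N\<close>] D[OF True xy(2)] by simp
      then show ?thesis by (simp add: algebra_simps)
    next
      case False
      then have "x \<in> L - translate L Rstar" using xy by (simp add: mem_translate)
      then have "[x] \<in> Stup 1 (L - translate L Rstar)" unfolding Stup_1_iff by blast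
      then have "e [x] = 0" using e unfolding Harr_rel_def by blast
      then show ?thesis by simp
    qed
    show ?thesis
      using xy 1 2[OF xy j(2)] 2[OF xy(2,1)] j(2) by (simp add: lie_cochain_2 algebra_simps)
  qed
  then have "?C xs = 0" if "xs \<in> Stup 2 (L - translate L (Rstar + Rstar))" for xs
    using that unfolding Stup_2_iff mem_D2 by blast
  then have rel: "?C \<in> Harr_rel 2 L (L - translate L (Rstar + Rstar))"
    using lie_cochain_Harr[OF add_L, of Rstar e \<psi>] unfolding Harr_rel_def by blast
  show ?thesis
  proof (rule T_relI[OF bracket_cocycle(1)[OF f g] bracket_cocycle(1)[OF f' g] Harr_rel_uminus[OF rel]])
    show "(\<lambda>xs. bracket Rstar Rstar (cobd 2 L \<phi>) (cobd 2 L \<psi>) xs -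
        bracket Rstar Rstar (cobd 2 L (\<lambda>xs. \<phi> xs - e xs)) (cobd 2 L \<psi>) xs) =
      cobd (2 + 1) L (\<lambda>xs. - ?C xs)"
      unfolding bracket_cocycle(2)[OF f g] bracket_cocycle(2)[OF f' g]
      unfolding lin[symmetric] cobd_uminus cobd_diff by simp
  qed
qed

text \<open>
  The bracket is symmetric, so it suffices to change one argument at a time.
\<close>

lemma cup_eq:
  fixes \<xi> \<zeta> :: "'k::field_char_0 cochain"
  assumes f: "cobd 2 L \<xi> \<in> T_cocycles L 1 Rstar" and g: "cobd 2 L \<zeta> \<in> T_cocycles L 1 Rstar"
  shows "cup L Rstar Rstar (T_rel L 1 Rstar `` {cobd 2 L \<xi>}) (T_rel L 1 Rstar `` {cobd 2 L \<zeta>})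
    = T_rel L 2 (Rstar + Rstar) `` {bracket Rstar Rstar (cobd 2 L \<xi>) (cobd 2 L \<zeta>)}"
proof -
  let ?T = "T_rel L 2 (Rstar + Rstar)"
  have "?T `` {bracket Rstar Rstar f' g'} = ?T `` {bracket Rstar Rstar (cobd 2 L \<xi>) (cobd 2 L \<zeta>)}"
    if f': "f' \<in> T_rel L 1 Rstar `` {cobd 2 L \<xi>}" and g': "g' \<in> T_rel L 1 Rstar `` {cobd 2 L \<zeta>}" for f' g'
  proof -
    obtain e where e: "e \<in> Harr_rel 1 L (L - translate L Rstar)" "f' = cobd 2 L (\<lambda>xs. \<xi> xs - e xs)"
      "f' \<in> T_cocycles L 1 Rstar" using mem_T1_class[OF f'] by blast
    obtain h where h: "h \<in> Harr_rel 1 L (L - translate L Rstar)" "g' = cobd 2 L (\<lambda>xs. \<zeta> xs - h xs)"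
      "g' \<in> T_cocycles L 1 Rstar" using mem_T1_class[OF g'] by blast
    have 1: "(bracket Rstar Rstar (cobd 2 L \<xi>) (cobd 2 L \<zeta>), bracket Rstar Rstar f' (cobd 2 L \<zeta>)) \<in> ?T"
      using bracket_relative[OF f e(3)[unfolded e(2)] g e(1)] by (simp only: e(2))
    have 2: "(bracket Rstar Rstar (cobd 2 L \<zeta>) f', bracket Rstar Rstar g' f') \<in> ?T"
      using bracket_relative[OF g h(3)[unfolded h(2)] e(3)[unfolded e(2)] h(1)] by (simp only: e(2) h(2))
    show ?thesis
      using equiv_class_eq[OF equiv_T_rel 1] equiv_class_eq[OF equiv_T_rel 2]
      by (simp only: bracket_commute)
  qed
  moreover have "cobd 2 L \<xi> \<in> T_rel L 1 Rstar `` {cobd 2 L \<xi>}"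
    "cobd 2 L \<zeta> \<in> T_rel L 1 Rstar `` {cobd 2 L \<zeta>}"
    using equiv_class_self[OF equiv_T_rel] f g by blast+
  ultimately show ?thesis unfolding cup_def by blast
qed

end

section \<open>The Cech description of second cohomology\<close>

lemma restr_cobd_eq_iff:
  "cobd 2 K \<phi> = restr 2 K C \<longleftrightarrow> (\<forall>x y. x \<in> K \<longrightarrow> y \<in> K \<longrightarrow> x + y \<in> K \<longrightarrow> \<phi> [y] - \<phi> [x + y] + \<phi> [x] = C [x, y])"
proof
  assume *: "cobd 2 K \<phi> = restr 2 K C"
  show "\<forall>x y. x \<in> K \<longrightarrow> y \<in> K \<longrightarrow> x + y \<in> K \<longrightarrow> \<phi> [y] - \<phi> [x + y] + \<phi> [x] = C [x, y]"
  proof (intro allI impI)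
    fix x y assume "x \<in> K" "y \<in> K" "x + y \<in> K"
    then show "\<phi> [y] - \<phi> [x + y] + \<phi> [x] = C [x, y]"
      using fun_cong[OF *, of "[x, y]"] by (simp add: cobd_2 restr_def Stup_2_iff)
  qed
next
  assume *: "\<forall>x y. x \<in> K \<longrightarrow> y \<in> K \<longrightarrow> x + y \<in> K \<longrightarrow> \<phi> [y] - \<phi> [x + y] + \<phi> [x] = C [x, y]"
  show "cobd 2 K \<phi> = restr 2 K C"
  proof
    fix xs show "cobd 2 K \<phi> xs = restr 2 K C xs"
      using * by (cases "xs \<in> Stup 2 K") (auto simp: cobd_outside restr_def Stup_2_iff cobd_2)
  qed
qed

lemma sum_cyclic_shift:
  assumes "0 < N"
  shows "(\<Sum>j<N. f (Suc j mod N)) = (\<Sum>j<N. f j)"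
proof -
  obtain m where N: "N = Suc m" using assms by (cases N) auto
  have "(\<Sum>j<m. f (Suc j mod N)) = (\<Sum>j<m. f (Suc j))" by (rule sum.cong) (auto simp: N)
  then have "(\<Sum>j<N. f (Suc j mod N)) = (\<Sum>j<m. f (Suc j)) + f 0" by (simp add: N)
  also have "\<dots> = (\<Sum>j<N. f j)" unfolding N sum.lessThan_Suc_shift by (simp add: add.commute)
  finally show ?thesis .
qed

context isolated_gorenstein_cone
begin

lemma Harrison_H2_zero:
  fixes C :: "'k::field_char_0 cochain"
  assumes C: "C \<in> Harr 2 L" and dC: "cobd 3 L C = (\<lambda>_. 0)"
  shows "\<exists>\<Gamma>. C = cobd 2 L \<Gamma>"
proof -
  have 0: "0 < N" using N_ge_3 by simp
  obtain n v u w where fr: "edge_frame N a 0 n v u w" using frame[OF 0] by blast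
  have "\<exists>G. \<forall>x\<in>L. \<forall>y\<in>L. C [x, y] = G x + G y - G (x + y)"
  proof (rule symmetric_cocycle_splits[where n = n and v = v and u = u and \<alpha> = "pairing w"
        and \<beta> = "pairing (a (Suc 0 mod N))" and \<gamma> = "pairing (a 0)"])
    show "x = pairing w x *s n + pairing (a (Suc 0 mod N)) x *s v + pairing (a 0) x *s u" for x
      using fr unfolding edge_frame_def by blast
    show "n \<in> L" "v \<in> L" "u \<in> L" using fr unfolding edge_frame_def mem_L by blast+
    show "C [x, y] = C [y, x]" for x y using C by (simp add: Harr_2_iff)
    show "C [y, z] - C [x + y, z] + C [x, y + z] - C [x, y] = 0" if "x \<in> L" "y \<in> L" "z \<in> L" for x y z
      using fun_cong[OF dC, of "[x, y, z]"] that add_L by (simp add: cobd_3 Stup_3_iff)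
  qed (use zero_L add_L mem_L 0 in auto)
  then obtain G where G: "\<And>x y. x \<in> L \<Longrightarrow> y \<in> L \<Longrightarrow> C [x, y] = G x + G y - G (x + y)" by blast
  have "C xs = cobd 2 L (\<lambda>xs. G (hd xs)) xs" for xs
  proof (cases "xs \<in> Stup 2 L")
    case True
    then show ?thesis by (auto simp: Stup_2_iff cobd_2 G)
  next
    case False
    then show ?thesis using C by (simp add: Harr_2_iff cobd_outside)
  qed
  then show ?thesis by blast
qed

lemma K2_Suc: "K2 L N a (Suc j) = K2 L N a (Suc j mod N)"
  by (simp add: K2_def)

text \<open>
  The frame of the edge \<open>j\<close> lies in the slab, and adding multiples of \<open>n\<close> does not change the level.
  So every element of the slab can be compared inside the slab with a combination of the frame in
  which \<open>u\<close> occurs at most once.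
\<close>

lemma H1_K2_linear:
  fixes h :: "lat \<Rightarrow> 'k::field_char_0"
  assumes j: "j < N" and h: "h \<in> H1 (K2 L N a j)"
  shows "\<exists>b. \<forall>r\<in>K2 L N a j. h r = pairing b (ext r)"
proof -
  obtain n v u w where fr: "edge_frame N a j n v u w" using frame[OF j] by blast
  let ?K = "K2 L N a j" and ?j' = "Suc j mod N"
  have coord: "x = pairing w x *s n + pairing (a ?j') x *s v + pairing (a j) x *s u" for x
    using fr unfolding edge_frame_def by blast
  have nvu: "n \<in> L" "v \<in> L" "u \<in> L" and lev: "pairing (a j) n = 0" "pairing (a j) v = 0" "pairing (a j) u = 1"
    using fr j unfolding edge_frame_def mem_L by blast+
  have hadd: "h (x + y) = h x + h y" if "x \<in> ?K" "y \<in> ?K" "x + y \<in> ?K" for x y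
    using h that unfolding H1_def by blast
  have mult: "int k *s x \<in> ?K \<and> pairing (a j) (int k *s x) = 0 \<and> h (int k *s x) = of_nat k * h x"
    if x: "x \<in> L" "pairing (a j) x = 0" for x k
  proof (induction k)
    case 0
    have "0 \<in> ?K" using zero_L by (simp add: mem_K2[OF j])
    then show ?case using hadd[of 0 0] by simp
  next
    case (Suc k)
    have e: "int (Suc k) *s x = int k *s x + x" by (simp add: vec_eq_iff algebra_simps)
    have "int k *s x + x \<in> ?K" "x \<in> ?K" using Suc x add_L by (simp_all add: mem_K2[OF j])
    then show ?case unfolding e using Suc x hadd[of "int k *s x" x] by (simp add: algebra_simps)
  qed
  define b where "b = h n *s ext w + h v *s ext (a ?j') + h u *s ext (a j)"
  have "h r = pairing b (ext r)" if r: "r \<in> ?K" for r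
  proof -
    have rL: "r \<in> L" and le: "pairing (a j) r \<le> 1" using r by (simp_all add: mem_K2[OF j])
    have "0 \<le> pairing (a ?j') r" "0 \<le> pairing (a j) r" using rL j nxt_lt[OF j] unfolding mem_L by blast+
    then have nn: "0 \<le> pairing (a ?j') r" and g: "pairing (a j) r = 0 \<or> pairing (a j) r = 1" using le by auto
    define p q m where "p = nat (pairing w r)" and "q = nat (- pairing w r)"
      and "m = nat (pairing (a ?j') r)"
    have w: "pairing w r + int q = int p" by (simp add: p_def q_def)
    have m: "int m = pairing (a ?j') r" using nn by (simp add: m_def)
    have "r + int q *s n = (pairing w r + int q) *s n + pairing (a ?j') r *s v + pairing (a j) r *s u"
      by (subst (1) coord[of r]) (simp add: vec_eq_iff algebra_simps)
    then have e: "r + int q *s n = int p *s n + int m *s v + pairing (a j) r *s u"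
      unfolding w m by simp
    note mn = mult[OF nvu(1) lev(1)] and mv = mult[OF nvu(2) lev(2)]
    have inL: "int k *s n \<in> L" "int k *s v \<in> L" for k using mn mv by (simp_all add: mem_K2[OF j])
    have "r + int q *s n \<in> ?K" using rL le inL add_L mn lev by (simp add: mem_K2[OF j])
    then have 1: "h (r + int q *s n) = h r + of_nat q * h n" using hadd[OF r] mn by simp
    have pb: "int p *s n + int m *s v \<in> ?K" using inL add_L mn mv lev by (simp add: mem_K2[OF j])
    then have 2: "h (int p *s n + int m *s v) = of_nat p * h n + of_nat m * h v"
      using hadd mn mv by simp
    have 3: "h (int p *s n + int m *s v + pairing (a j) r *s u) =
        of_nat p * h n + of_nat m * h v + of_int (pairing (a j) r) * h u"
      using g
    proof
      assume "pairing (a j) r = 0"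
      then show ?thesis using 2 by simp
    next
      assume 1: "pairing (a j) r = 1"
      have "u \<in> ?K" using nvu lev by (simp add: mem_K2[OF j])
      moreover have "int p *s n + int m *s v + u \<in> ?K"
        using inL add_L mn mv nvu lev by (simp add: mem_K2[OF j])
      ultimately show ?thesis using hadd[OF pb] 2 unfolding 1 by simp
    qed
    have "h r = (of_nat p - of_nat q) * h n + of_nat m * h v + of_int (pairing (a j) r) * h u"
      using 1 3 unfolding e by (simp add: algebra_simps)
    also have "(of_nat p - of_nat q :: 'k) = of_int (pairing w r)"
      by (metis add_diff_cancel_right' of_int_diff of_int_of_nat_eq w)
    also have "(of_nat m :: 'k) = of_int (pairing (a ?j') r)" by (simp add: m[symmetric])
    finally show ?thesis by (simp add: b_def algebra_simps)
  qed
  then show ?thesis by blast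
qed

text \<open>
  The frame of the edge \<open>j\<close> lies in the intersection.
\<close>

lemma K2_Int_spans:
  fixes q :: "'k::field_char_0 ^ 3"
  assumes j: "j < N" and q: "\<And>r. r \<in> K2 L N a j \<inter> K2 L N a (Suc j) \<Longrightarrow> pairing q (ext r) = 0"
  shows "q = 0"
proof (rule pairing_nondegenerate)
  fix x
  obtain n v u w where fr: "edge_frame N a j n v u w" using frame[OF j] by blast
  have coord: "x = pairing w x *s n + pairing (a (Suc j mod N)) x *s v + pairing (a j) x *s u" for x
    using fr unfolding edge_frame_def by blast
  have "n \<in> L" "v \<in> L" "u \<in> L" using fr unfolding edge_frame_def mem_L by blast+
  moreover have "pairing (a j) n = 0" "pairing (a (Suc j mod N)) n = 0"
    using fr j nxt_lt[OF j] unfolding edge_frame_def by blast+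
  moreover have "pairing (a j) v = 0" "pairing (a (Suc j mod N)) v = 1"
    "pairing (a j) u = 1" "pairing (a (Suc j mod N)) u = 0"
    using fr unfolding edge_frame_def by blast+
  ultimately have "r \<in> K2 L N a j \<inter> K2 L N a (Suc j)" if "r = n \<or> r = v \<or> r = u" for r
    unfolding K2_Suc using j nxt_lt[OF j] that by (auto simp: mem_K2)
  then have "pairing q (ext n) = 0" "pairing q (ext v) = 0" "pairing q (ext u) = 0" using q by blast+
  then show "pairing q (ext x) = 0" by (subst coord) simp
qed

lemma mem_ker_etaI:
  fixes q :: "nat \<Rightarrow> 'k::field_char_0 ^ 3"
  assumes "q \<in> ktuples N" and "\<And>r. (\<And>j. j < N \<Longrightarrow> r \<in> K2 L N a j) \<Longrightarrow> pairing (\<Sum>j<N. q j) (ext r) = 0"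
  shows "q \<in> ker_eta L N a"
proof -
  have "vec.subspace {v. pairing (\<Sum>j<N. q j) v = 0}" by (rule vec.subspaceI) auto
  then have "vec.span (ext ` (\<Inter>j<N. K2 L N a j)) \<subseteq> {v. pairing (\<Sum>j<N. q j) v = 0}"
    using assms(2) by (intro vec.span_minimal) auto
  then show ?thesis using assms(1) unfolding ker_eta_def by blast
qed

lemma ker_eta_quot:
  fixes p q :: "nat \<Rightarrow> 'k::field_char_0 ^ 3"
  assumes "p \<in> ker_eta L N a" "q \<in> ker_eta L N a" "\<And>j. j < N \<Longrightarrow> p j - q j = \<beta> j - \<beta> (Suc j mod N)"
  shows "(p, q) \<in> quot_rel L N a"
proof -
  have "(\<lambda>j. p j - q j) = delta N (\<lambda>j. if j < N then \<beta> j else 0)"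
  proof
    fix j show "p j - q j = delta N (\<lambda>j. if j < N then \<beta> j else 0) j"
      using assms nxt_lt[of j] by (auto simp: delta_def ker_eta_def ktuples_def)
  qed
  moreover have "(\<lambda>j. if j < N then \<beta> j else 0) \<in> ktuples N" by (simp add: ktuples_def)
  ultimately show ?thesis using assms(1,2) unfolding quot_rel_def by blast
qed

text \<open>
  Let \<open>C\<close> and \<open>G\<close> be any other choices.  Then \<open>C\<close> and \<open>C\<^sub>0\<close> differ by a relative cochain, which is zero
  on the slabs, and by a cocycle, which is the coboundary of some \<open>\<Gamma>\<close>.  Hence \<open>G\<^sub>j - G\<^sub>0\<^sub>j - \<Gamma>\<close> is
  additive on the slab, thus linear, and \<open>\<Gamma>\<close> cancels in the differences between neighbours.  That
  \<open>q\<^sub>0\<close> lies in the kernel of \<open>\<eta>\<close> is the telescoping of these differences around the cycle.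
\<close>

lemma T2_connect_eq:
  fixes C\<^sub>0 :: "'k::field_char_0 cochain"
  assumes c: "cobd 3 L C\<^sub>0 \<in> T_cocycles L 2 (Rstar + Rstar)" and C\<^sub>0: "C\<^sub>0 \<in> Harr 2 L"
    and G\<^sub>0: "\<And>j. j < N \<Longrightarrow> G\<^sub>0 j \<in> Harr 1 (K2 L N a j)"
      "\<And>j. j < N \<Longrightarrow> cobd 2 (K2 L N a j) (G\<^sub>0 j) = restr 2 (K2 L N a j) C\<^sub>0"
    and q\<^sub>0: "q\<^sub>0 \<in> ktuples N"
      "\<And>j r. j < N \<Longrightarrow> r \<in> K2 L N a j \<inter> K2 L N a (Suc j) \<Longrightarrow>
        G\<^sub>0 j [r] - G\<^sub>0 (Suc j mod N) [r] = pairing (q\<^sub>0 j) (ext r)"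
  shows "q\<^sub>0 \<in> ker_eta L N a"
    and "T2_connect L N a (T_rel L 2 (Rstar + Rstar) `` {cobd 3 L C\<^sub>0}) = quot_rel L N a `` {q\<^sub>0}"
proof -
  let ?K = "K2 L N a"
  show q0: "q\<^sub>0 \<in> ker_eta L N a"
  proof (rule mem_ker_etaI[OF q\<^sub>0(1)])
    fix r assume r: "\<And>j. j < N \<Longrightarrow> r \<in> ?K j"
    have "pairing (\<Sum>j<N. q\<^sub>0 j) (ext r) = (\<Sum>j<N. G\<^sub>0 j [r] - G\<^sub>0 (Suc j mod N) [r])"
      unfolding pairing_sum_left using q\<^sub>0(2) r nxt_lt by (intro sum.cong) (auto simp: K2_Suc)
    also have "\<dots> = 0"
      using sum_cyclic_shift[of N "\<lambda>j. G\<^sub>0 j [r]"] N_ge_3 by (simp add: sum_subtractf)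
    finally show "pairing (\<Sum>j<N. q\<^sub>0 j) (ext r) = 0" .
  qed
  have two: "2 + 1 = (3::nat)" by simp
  show "T2_connect L N a (T_rel L 2 (Rstar + Rstar) `` {cobd 3 L C\<^sub>0}) = quot_rel L N a `` {q\<^sub>0}"
  proof (intro equalityI subsetI)
    fix q assume "q \<in> T2_connect L N a (T_rel L 2 (Rstar + Rstar) `` {cobd 3 L C\<^sub>0})"
    then obtain c C G h where q: "q \<in> ker_eta L N a"
      and cX: "(cobd 3 L C\<^sub>0, c) \<in> T_rel L 2 (Rstar + Rstar)" and C: "C \<in> Harr 2 L" "cobd 3 L C = c"
      and G: "\<And>j. j < N \<Longrightarrow> cobd 2 (?K j) (G j) = restr 2 (?K j) C"
      and h: "\<And>j. j < N \<Longrightarrow> h j \<in> H1 (?K j)"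
      and diff: "\<And>j r. j < N \<Longrightarrow> r \<in> ?K j \<inter> ?K (Suc j) \<Longrightarrow>
        (G j [r] - G (Suc j mod N) [r]) - pairing (q j) (ext r) = h j r - h (Suc j mod N) r"
      unfolding T2_connect_def by blast
    obtain e where e: "e \<in> Harr_rel 2 L (L - translate L (Rstar + Rstar))"
      "(\<lambda>xs. cobd 3 L C\<^sub>0 xs - c xs) = cobd 3 L e"
      using cX unfolding T_rel_def two by blast
    have eH: "e \<in> Harr 2 L" using e(1) by (simp add: Harr_rel_def)
    have "(\<lambda>xs. C xs + e xs - C\<^sub>0 xs) \<in> Harr 2 L"
      using C(1) eH C\<^sub>0 by (simp add: Harr_2_iff)
    moreover have "cobd 3 L (\<lambda>xs. C xs + e xs - C\<^sub>0 xs) = (\<lambda>_. 0)"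
      unfolding cobd_diff cobd_add e(2)[symmetric] C(2) by simp
    ultimately obtain \<Gamma> where \<Gamma>: "(\<lambda>xs. C xs + e xs - C\<^sub>0 xs) = cobd 2 L \<Gamma>"
      using Harrison_H2_zero by blast
    define \<kappa> where "\<kappa> j r = G j [r] - G\<^sub>0 j [r] - \<Gamma> [r] - h j r" for j r
    have "\<kappa> j \<in> H1 (?K j)" if j: "j < N" for j
      unfolding H1_def
    proof (intro CollectI ballI impI)
      fix x y assume xy: "x \<in> ?K j" "y \<in> ?K j" "x + y \<in> ?K j"
      then have L: "x \<in> L" "y \<in> L" "x + y \<in> L" by (simp_all add: mem_K2[OF j])
      have "x \<in> L - translate L (Rstar + Rstar) \<and> y \<in> L - translate L (Rstar + Rstar) \<and>
          x + y \<in> L - translate L (Rstar + Rstar)"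
        using xy j unfolding mem_D2 mem_K2[OF j] by blast
      then have "[x, y] \<in> Stup 2 (L - translate L (Rstar + Rstar))" unfolding Stup_2_iff by blast
      then have "e [x, y] = 0" using e(1) unfolding Harr_rel_def by blast
      then have "C [x, y] - C\<^sub>0 [x, y] = \<Gamma> [y] - \<Gamma> [x + y] + \<Gamma> [x]"
        using fun_cong[OF \<Gamma>, of "[x, y]"] L by (simp add: cobd_2 Stup_2_iff)
      moreover have "G j [y] - G j [x + y] + G j [x] = C [x, y]"
        using G[OF j] xy unfolding restr_cobd_eq_iff by blast
      moreover have "G\<^sub>0 j [y] - G\<^sub>0 j [x + y] + G\<^sub>0 j [x] = C\<^sub>0 [x, y]"
        using G\<^sub>0(2)[OF j] xy unfolding restr_cobd_eq_iff by blast
      moreover have "h j (x + y) = h j x + h j y" using h[OF j] xy unfolding H1_def by blast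
      ultimately show "\<kappa> j (x + y) = \<kappa> j x + \<kappa> j y"
        unfolding \<kappa>_def by (simp add: algebra_simps)
    qed
    then have "\<forall>j. \<exists>b. j < N \<longrightarrow> (\<forall>r\<in>?K j. \<kappa> j r = pairing b (ext r))"
      using H1_K2_linear by blast
    then obtain \<beta> where \<beta>: "\<And>j r. j < N \<Longrightarrow> r \<in> ?K j \<Longrightarrow> \<kappa> j r = pairing (\<beta> j) (ext r)"
      by metis
    have "q\<^sub>0 j - q j = - \<beta> j - - \<beta> (Suc j mod N)" if j: "j < N" for j
    proof -
      have "q j - q\<^sub>0 j - (\<beta> j - \<beta> (Suc j mod N)) = 0"
      proof (rule K2_Int_spans[OF j])
        fix r assume r: "r \<in> ?K j \<inter> ?K (Suc j)"
        then have r': "r \<in> ?K j" "r \<in> ?K (Suc j mod N)" by (simp_all add: K2_Suc)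
        show "pairing (q j - q\<^sub>0 j - (\<beta> j - \<beta> (Suc j mod N))) (ext r) = 0"
          using \<beta>[OF j r'(1)] \<beta>[OF nxt_lt[OF j] r'(2)] diff[OF j r] q\<^sub>0(2)[OF j r]
          by (simp add: \<kappa>_def algebra_simps)
      qed
      then show ?thesis by (simp add: algebra_simps)
    qed
    then have "(q\<^sub>0, q) \<in> quot_rel L N a" by (rule ker_eta_quot[OF q0 q])
    then show "q \<in> quot_rel L N a `` {q\<^sub>0}" by blast
  next
    fix q assume "q \<in> quot_rel L N a `` {q\<^sub>0}"
    then obtain \<beta> where q: "q \<in> ker_eta L N a" and \<beta>: "(\<lambda>j. q\<^sub>0 j - q j) = delta N \<beta>"
      unfolding quot_rel_def by blast
    define h where "h j r = pairing (\<beta> j) (ext r)" for j and r :: lat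
    have "h j \<in> H1 (?K j)" for j by (simp add: H1_def h_def)
    moreover have "(G\<^sub>0 j [r] - G\<^sub>0 (Suc j mod N) [r]) - pairing (q j) (ext r) = h j r - h (Suc j mod N) r"
      if "j < N" "r \<in> ?K j \<inter> ?K (Suc j)" for j r
    proof -
      have "pairing (q\<^sub>0 j - q j) (ext r) = pairing (\<beta> j - \<beta> (Suc j mod N)) (ext r)"
        using fun_cong[OF \<beta>, of j] that(1) by (simp add: delta_def)
      then show ?thesis using q\<^sub>0(2)[OF that] by (simp add: h_def)
    qed
    moreover have "cobd 3 L C\<^sub>0 \<in> T_rel L 2 (Rstar + Rstar) `` {cobd 3 L C\<^sub>0}"
      using equiv_class_self[OF equiv_T_rel c] .
    ultimately show "q \<in> T2_connect L N a (T_rel L 2 (Rstar + Rstar) `` {cobd 3 L C\<^sub>0})"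
      unfolding T2_connect_def using q C\<^sub>0 G\<^sub>0 by blast
  qed
qed

end

section \<open>Local primitives and the cup product\<close>

text \<open>
  Here \<open>d\<close> is the value of \<open>d\<^sub>j\<close> at a point of two neighbouring slabs.  If it is 1, the point has level 0
  at \<open>a\<^sub>j\<close>, and if it is \<open>-1\<close>, it has level 0 at \<open>a\<^sub>j\<^sub>+\<^sub>1\<close>; at level 0 the glued functions
  are the linear forms.
\<close>

lemma local_primitive_difference:
  fixes B B' f g t s d :: "'k::field_char_0"
  assumes "d = 0 \<or> (d = 1 \<and> f = B \<and> g = B') \<or> (d = - 1 \<and> f = B + t * d \<and> g = B' + s * d)"
  shows "(B * g + f * B' - B * B') - ((B + t * d) * g + f * (B' + s * d) - (B + t * d) * (B' + s * d)) = s * t * d"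
  using assms by (auto simp: algebra_simps)

context isolated_gorenstein_cone
begin

text \<open>
  One of \<open>x\<close>, \<open>y\<close> has level 0, say \<open>y\<close>.  If \<open>x\<close> has level 0 too, only the products \<open>b(x) b'(y)\<close> and
  \<open>b(y) b'(x)\<close> survive,
  up to sign the polarisation of the quadratic form \<open>b b'\<close>.  If \<open>x\<close> has level 1, a shift
  by \<open>R\<close> lands at level 0, and what remains depends on which of \<open>x - R\<close> and \<open>x + y - R\<close> lie in
  the monoid.
\<close>

lemma lie_cochain_local_primitive:
  fixes \<phi> \<psi> :: "'k::field_char_0 cochain"
  assumes j: "j < N"
    and lev0: "\<And>r. r \<in> L \<Longrightarrow> pairing (a j) r = 0 \<Longrightarrow> \<phi> [r] = pairing b (ext r)"
      "\<And>r. r \<in> L \<Longrightarrow> pairing (a j) r = 0 \<Longrightarrow> \<psi> [r] = pairing b' (ext r)"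
    and perp: "b $ 3 = 0" "b' $ 3 = 0"
    and out: "\<And>r. r \<notin> L \<Longrightarrow> \<phi> [r] = 0" "\<And>r. r \<notin> L \<Longrightarrow> \<psi> [r] = 0"
    and shift: "\<And>r. r - Rstar \<in> L \<Longrightarrow> \<phi> [r] = 0" "\<And>r. r - Rstar \<in> L \<Longrightarrow> \<psi> [r] = 0"
    and coc: "cobd 2 L \<phi> \<in> T_cocycles L 1 Rstar" "cobd 2 L \<psi> \<in> T_cocycles L 1 Rstar"
    and xy: "x \<in> L" "y \<in> L" "pairing (a j) (x + y) \<le> 1"
  defines "g \<equiv> \<lambda>r. pairing b (ext r) * \<psi> [r] + \<phi> [r] * pairing b' (ext r) - pairing b (ext r) * pairing b' (ext r)"
  shows "lie_cochain L Rstar \<phi> \<psi> [x, y] = g x + g y - g (x + y)"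
proof -
  have *: "lie_cochain L Rstar \<phi> \<psi> [x, y] = g x + g y - g (x + y)"
    if xy: "x \<in> L" "y \<in> L" and lx: "pairing (a j) x \<le> 1" and ly: "pairing (a j) y = 0" for x y
  proof -
    have neg: "r \<notin> L" if "pairing (a j) r < 0" for r using that j unfolding mem_L by force
    have aR: "pairing (a j) Rstar = 1" using height[OF j] by simp
    have yR: "y - Rstar \<notin> L" using neg ly aR by (metis pairing_simps(6) diff_0 neg_less_0_iff_less zero_less_one)
    have y0: "\<phi> [y] = pairing b (ext y)" "\<psi> [y] = pairing b' (ext y)" using lev0 xy ly by simp_all
    have "0 \<le> pairing (a j) x" using xy j unfolding mem_L by blast
    then consider "pairing (a j) x = 0" | "pairing (a j) x = 1" using lx by fastforce
    then show ?thesis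
    proof cases
      case 1
      have "x - Rstar \<notin> L" "x + y - Rstar \<notin> L" using neg 1 ly aR by (simp_all del: pairing_Rstar)
      moreover have "\<phi> [x] = pairing b (ext x)" "\<psi> [x] = pairing b' (ext x)"
        "\<phi> [x + y] = pairing b (ext (x + y))" "\<psi> [x + y] = pairing b' (ext (x + y))"
        using lev0 xy 1 ly add_L by simp_all
      ultimately show ?thesis using xy yR y0
        by (simp add: lie_cochain_2 out g_def algebra_simps)
    next
      case 2
      have low: "\<phi> [r - Rstar] = pairing b (ext r)" "\<psi> [r - Rstar] = pairing b' (ext r)"
        if "r - Rstar \<in> L" "pairing (a j) r = 1" for r
        using lev0[OF that(1)] that(2) aR perp by (simp_all del: pairing_Rstar)
      have l1: "pairing (a j) (x + y) = 1" using 2 ly by simp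
      consider "x - Rstar \<in> L" "x + y - Rstar \<in> L" | "x - Rstar \<notin> L" "x + y - Rstar \<in> L"
        | "x - Rstar \<notin> L" "x + y - Rstar \<notin> L"
        using add_L[of "x - Rstar" y] xy by (auto simp: algebra_simps)
      then show ?thesis
      proof cases
        case 1
        then show ?thesis using xy yR y0 low[OF 1(1) 2] low[OF 1(2) l1] shift[OF 1(1)] shift[OF 1(2)]
          by (simp add: lie_cochain_2 out g_def algebra_simps)
      next
        case 2
        then show ?thesis using xy yR y0 low[OF 2(2) l1] shift[OF 2(2)]
          by (simp add: lie_cochain_2 out g_def algebra_simps)
      next
        case 3
        have "x + y \<in> L - translate L Rstar" using 3 xy add_L by (simp add: mem_translate)
        then obtain k where k: "k < N" "pairing (a k) (x + y) = 0" unfolding mem_D1 by blast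
        have "\<phi> [x + y] = \<phi> [x] + \<phi> [y]" "\<psi> [x + y] = \<psi> [x] + \<psi> [y]"
          using T1_cocycle_vanishes[OF coc(1) xy k] T1_cocycle_vanishes[OF coc(2) xy k] xy add_L
          by (simp_all add: cobd_2 Stup_2_iff algebra_simps)
        then show ?thesis using 3 xy yR y0
          by (simp add: lie_cochain_2 out g_def algebra_simps)
      qed
    qed
  qed
  have nn: "0 \<le> pairing (a j) x" "0 \<le> pairing (a j) y" using xy j unfolding mem_L by blast+
  show ?thesis
  proof (cases "pairing (a j) y = 0")
    case True
    then show ?thesis using * xy by simp
  next
    case False
    then have "pairing (a j) x = 0" "pairing (a j) y \<le> 1" using nn xy(3) by simp_all
    then have "lie_cochain L Rstar \<phi> \<psi> [y, x] = g y + g x - g (y + x)" using * xy by blast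
    then show ?thesis
      using lie_cochain_Harr[OF add_L, of Rstar \<phi> \<psi>] by (simp add: Harr_2_iff add.commute)
  qed
qed

lemma cup_product_formula:
  fixes t s :: "nat \<Rightarrow> 'k::field_char_0"
  assumes t: "t \<in> Vspace N a" and s: "s \<in> Vspace N a"
  defines "X \<equiv> T1_ident L N a (Vrel N a `` {t})" and "Y \<equiv> T1_ident L N a (Vrel N a `` {s})"
  shows "X \<in> T_space L 1 Rstar" and "cup L Rstar Rstar X Y \<in> T_space L 2 (Rstar + Rstar)"
    and "prod_tuple N a t s \<in> ker_eta L N a"
    and "T2_ident L N a (cup L Rstar Rstar X Y) = quot_rel L N a `` {prod_tuple N a t s}"
proof -
  obtain \<xi> where \<xi>: "\<xi> \<in> glued L N a t" using glued_nonempty[OF t] by blast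
  obtain \<zeta> where \<zeta>: "\<zeta> \<in> glued L N a s" using glued_nonempty[OF s] by blast
  note d\<xi> = cobd_glued_cocycle[OF \<xi>] and d\<zeta> = cobd_glued_cocycle[OF \<zeta>]
  have X: "X = T_rel L 1 Rstar `` {cobd 2 L \<xi>}" unfolding X_def by (rule T1_ident_eq[OF t \<xi>])
  have Y: "Y = T_rel L 1 Rstar `` {cobd 2 L \<zeta>}" unfolding Y_def by (rule T1_ident_eq[OF s \<zeta>])
  show "X \<in> T_space L 1 Rstar" unfolding X T_space_def using d\<xi> by (rule quotientI)
  have XY: "cup L Rstar Rstar X Y =
      T_rel L 2 (Rstar + Rstar) `` {bracket Rstar Rstar (cobd 2 L \<xi>) (cobd 2 L \<zeta>)}"
    unfolding X Y by (rule cup_eq[OF d\<xi> d\<zeta>])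
  show "cup L Rstar Rstar X Y \<in> T_space L 2 (Rstar + Rstar)"
    unfolding XY T_space_def using bracket_cocycle(1)[OF d\<xi> d\<zeta>] by (rule quotientI)
  \<comment> \<open>The minus sign makes the coboundary of \<open>C\<close> equal to the bracket itself.\<close>
  define C where "C xs = - lie_cochain L Rstar \<xi> \<zeta> xs" for xs
  have dC: "bracket Rstar Rstar (cobd 2 L \<xi>) (cobd 2 L \<zeta>) = cobd 3 L C"
    unfolding bracket_cocycle(2)[OF d\<xi> d\<zeta>] C_def cobd_uminus ..
  obtain b where b: "\<And>j. j < N \<Longrightarrow> b (Suc j mod N) - b j = t j *s ext (dvec N a j)"
    "\<And>j r. j < N \<Longrightarrow> r \<in> L \<Longrightarrow> pairing (a j) r = 0 \<Longrightarrow> \<xi> [r] = pairing (b j) (ext r)"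
    "\<And>r. r \<notin> L \<Longrightarrow> \<xi> [r] = 0" "\<And>r. r - Rstar \<in> L \<Longrightarrow> \<xi> [r] = 0"
    "\<And>j. j < N \<Longrightarrow> b j $ 3 = 0"
    by (rule gluedE[OF \<xi>]) blast
  obtain b' where b': "\<And>j. j < N \<Longrightarrow> b' (Suc j mod N) - b' j = s j *s ext (dvec N a j)"
    "\<And>j r. j < N \<Longrightarrow> r \<in> L \<Longrightarrow> pairing (a j) r = 0 \<Longrightarrow> \<zeta> [r] = pairing (b' j) (ext r)"
    "\<And>r. r \<notin> L \<Longrightarrow> \<zeta> [r] = 0" "\<And>r. r - Rstar \<in> L \<Longrightarrow> \<zeta> [r] = 0"
    "\<And>j. j < N \<Longrightarrow> b' j $ 3 = 0"
    by (rule gluedE[OF \<zeta>]) blast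
  define g where "g j r = pairing (b j) (ext r) * \<zeta> [r] + \<xi> [r] * pairing (b' j) (ext r)
      - pairing (b j) (ext r) * pairing (b' j) (ext r)" for j r
  define G where "G j xs = (if xs \<in> Stup 1 (K2 L N a j) then - g j (hd xs) else 0)" for j xs
  have G1: "G j [r] = - g j r" if "r \<in> K2 L N a j" for j r
    using that unfolding G_def Stup_1_iff by simp
  define q where "q j = - prod_tuple N a t s j" for j
  have C: "C \<in> Harr 2 L"
    using lie_cochain_Harr[OF add_L, of Rstar \<xi> \<zeta>] by (simp add: C_def Harr_2_iff)
  have GH: "G j \<in> Harr 1 (K2 L N a j)" for j by (simp only: Harr_1_iff) (simp add: G_def)
  have dG: "cobd 2 (K2 L N a j) (G j) = restr 2 (K2 L N a j) C" if j: "j < N" for j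
    unfolding restr_cobd_eq_iff
  proof (intro allI impI)
    fix x y assume xy: "x \<in> K2 L N a j" "y \<in> K2 L N a j" "x + y \<in> K2 L N a j"
    then have "x \<in> L" "y \<in> L" "pairing (a j) (x + y) \<le> 1" by (simp_all add: mem_K2[OF j])
    then have "lie_cochain L Rstar \<xi> \<zeta> [x, y] = g j x + g j y - g j (x + y)"
      unfolding g_def
      by (intro lie_cochain_local_primitive[OF j b(2)[OF j] b'(2)[OF j] b(5)[OF j] b'(5)[OF j]]
          b(3,4) b'(3,4) d\<xi> d\<zeta>)
    then show "G j [y] - G j [x + y] + G j [x] = C [x, y]" using xy by (simp add: G1 C_def)
  qed
  have qk: "q \<in> ktuples N" by (simp add: q_def ktuples_def prod_tuple_def)
  have diff: "G j [r] - G (Suc j mod N) [r] = pairing (q j) (ext r)"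
    if j: "j < N" and r: "r \<in> K2 L N a j \<inter> K2 L N a (Suc j)" for j r
  proof -
    let ?j' = "Suc j mod N"
    have r': "r \<in> K2 L N a j" "r \<in> K2 L N a ?j'" using r by (simp_all add: K2_Suc)
    then have rL: "r \<in> L" and le: "pairing (a j) r \<le> 1" "pairing (a ?j') r \<le> 1"
      by (simp_all add: mem_K2[OF j] mem_K2[OF nxt_lt[OF j]])
    have ge: "0 \<le> pairing (a j) r" "0 \<le> pairing (a ?j') r" using rL j nxt_lt[OF j] unfolding mem_L by blast+
    define d where "d = (of_int (pairing (dvec N a j) r) :: 'k)"
    have B: "pairing (b ?j') (ext r) = pairing (b j) (ext r) + t j * d"
      using arg_cong[OF b(1)[OF j], of "\<lambda>v. pairing v (ext r)"] by (simp add: d_def algebra_simps)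
    have B': "pairing (b' ?j') (ext r) = pairing (b' j) (ext r) + s j * d"
      using arg_cong[OF b'(1)[OF j], of "\<lambda>v. pairing v (ext r)"] by (simp add: d_def algebra_simps)
    consider "pairing (a j) r = pairing (a ?j') r" | "pairing (a j) r = 0" "pairing (a ?j') r = 1"
      | "pairing (a j) r = 1" "pairing (a ?j') r = 0"
      using ge le by linarith
    then have "d = 0 \<or> (d = 1 \<and> \<xi> [r] = pairing (b j) (ext r) \<and> \<zeta> [r] = pairing (b' j) (ext r)) \<or>
        (d = - 1 \<and> \<xi> [r] = pairing (b j) (ext r) + t j * d \<and> \<zeta> [r] = pairing (b' j) (ext r) + s j * d)"
    proof cases
      case 1
      then show ?thesis by (simp add: d_def dvec_def)
    next
      case 2
      then show ?thesis using b(2)[OF j rL] b'(2)[OF j rL] by (simp add: d_def dvec_def)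
    next
      case 3
      then show ?thesis using b(2)[OF nxt_lt[OF j] rL] b'(2)[OF nxt_lt[OF j] rL] unfolding B B'
        by (simp add: d_def dvec_def)
    qed
    then have "g j r - g ?j' r = s j * t j * d"
      unfolding g_def B B' by (rule local_primitive_difference)
    moreover have "pairing (q j) (ext r) = - (s j * t j * d)"
      using j by (simp add: q_def prod_tuple_def d_def)
    ultimately show ?thesis by (simp add: G1[OF r'(1)] G1[OF r'(2)] algebra_simps)
  qed
  have conn: "q \<in> ker_eta L N a"
    "T2_connect L N a (T_rel L 2 (Rstar + Rstar) `` {cobd 3 L C}) = quot_rel L N a `` {q}"
    by (rule T2_connect_eq[OF bracket_cocycle(1)[OF d\<xi> d\<zeta>, unfolded dC] C GH dG qk diff]; assumption)+
  have neg: "(\<lambda>j. - p j) \<in> ker_eta L N a" if "p \<in> ker_eta L N a" for p :: "nat \<Rightarrow> 'k ^ 3"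
    using that by (simp add: ker_eta_def ktuples_def sum_negf)
  have pq: "prod_tuple N a t s = (\<lambda>j. - q j)" by (simp add: q_def)
  show "prod_tuple N a t s \<in> ker_eta L N a" unfolding pq by (rule neg[OF conn(1)])
  have negrel: "((\<lambda>j. - p j), (\<lambda>j. - p' j)) \<in> quot_rel L N a" if pp: "(p, p') \<in> quot_rel L N a"
    for p p' :: "nat \<Rightarrow> 'k ^ 3"
  proof -
    obtain \<beta> where \<beta>: "p \<in> ker_eta L N a" "p' \<in> ker_eta L N a" "(\<lambda>j. p j - p' j) = delta N \<beta>"
      using pp unfolding quot_rel_def by blast
    show ?thesis
    proof (rule ker_eta_quot[OF neg[OF \<beta>(1)] neg[OF \<beta>(2)], where \<beta> = "\<lambda>j. - \<beta> j"])
      fix j assume "j < N"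
      then show "- p j - - p' j = - \<beta> j - - \<beta> (Suc j mod N)"
        using fun_cong[OF \<beta>(3), of j] by (simp add: delta_def algebra_simps)
    qed
  qed
  have "(\<lambda>p j. - p j) ` (quot_rel L N a `` {q}) = quot_rel L N a `` {\<lambda>j. - q j}"
  proof (intro equalityI subsetI)
    fix p assume "p \<in> quot_rel L N a `` {\<lambda>j. - q j}"
    then have "(q, \<lambda>j. - p j) \<in> quot_rel L N a" using negrel[of "\<lambda>j. - q j" p] by simp
    then show "p \<in> (\<lambda>p j. - p j) ` (quot_rel L N a `` {q})" by (intro image_eqI[of _ _ "\<lambda>j. - p j"]) auto
  qed (use negrel in auto)
  then show "T2_ident L N a (cup L Rstar Rstar X Y) = quot_rel L N a `` {prod_tuple N a t s}"
    unfolding T2_ident_def XY dC conn(2) pq .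
qed

section \<open>Summation of components\<close>

lemma quot_relD:
  fixes p q :: "nat \<Rightarrow> 'k::field_char_0 ^ 3"
  assumes "(p, q) \<in> quot_rel L N a"
  obtains \<beta> where "p \<in> ker_eta L N a" "q \<in> ker_eta L N a"
    "\<And>j. j < N \<Longrightarrow> p j - q j = \<beta> j - \<beta> (Suc j mod N)"
proof -
  obtain \<beta> where \<beta>: "p \<in> ker_eta L N a" "q \<in> ker_eta L N a" "(\<lambda>j. p j - q j) = delta N \<beta>"
    using assms unfolding quot_rel_def by blast
  have "p j - q j = \<beta> j - \<beta> (Suc j mod N)" if "j < N" for j
    using fun_cong[OF \<beta>(3), of j] that by (simp add: delta_def)
  then show ?thesis using that \<beta> by blast
qed

text \<open>
  A tuple with sum zero is the cyclic difference of its negated partial sums.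
\<close>

lemma quot_rel_iff_sum:
  fixes p q :: "nat \<Rightarrow> 'k::field_char_0 ^ 3"
  shows "(p, q) \<in> quot_rel L N a \<longleftrightarrow>
    p \<in> ker_eta L N a \<and> q \<in> ker_eta L N a \<and> (\<Sum>j<N. p j) = (\<Sum>j<N. q j)"
proof
  assume "(p, q) \<in> quot_rel L N a"
  then obtain \<beta> where \<beta>: "p \<in> ker_eta L N a" "q \<in> ker_eta L N a"
    "\<And>j. j < N \<Longrightarrow> p j - q j = \<beta> j - \<beta> (Suc j mod N)" by (rule quot_relD) blast
  have "(\<Sum>j<N. p j) - (\<Sum>j<N. q j) = (\<Sum>j<N. p j - q j)" by (simp add: sum_subtractf)
  also have "\<dots> = (\<Sum>j<N. \<beta> j - \<beta> (Suc j mod N))" by (intro sum.cong) (auto simp: \<beta>)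
  also have "\<dots> = 0" using sum_cyclic_shift[of N \<beta>] N_ge_3 by (simp add: sum_subtractf)
  finally show "p \<in> ker_eta L N a \<and> q \<in> ker_eta L N a \<and> (\<Sum>j<N. p j) = (\<Sum>j<N. q j)" using \<beta> by simp
next
  assume *: "p \<in> ker_eta L N a \<and> q \<in> ker_eta L N a \<and> (\<Sum>j<N. p j) = (\<Sum>j<N. q j)"
  define \<beta> where "\<beta> j = - (\<Sum>i<j. p i - q i)" for j
  have "p j - q j = \<beta> j - \<beta> (Suc j mod N)" if "j < N" for j
  proof -
    have "\<beta> (Suc j mod N) = \<beta> (Suc j)"
    proof (cases "Suc j = N")
      case True
      have "\<beta> N = 0" using * by (simp add: \<beta>_def sum_subtractf)
      then show ?thesis using True by (simp add: \<beta>_def)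
    qed (use that in simp)
    then show ?thesis by (simp add: \<beta>_def)
  qed
  then show "(p, q) \<in> quot_rel L N a" using * by (intro ker_eta_quot) auto
qed

lemma sum_class_eq:
  fixes p :: "nat \<Rightarrow> 'k::field_char_0 ^ 3"
  assumes "p \<in> ker_eta L N a"
  shows "sum_class N (quot_rel L N a `` {p}) = (\<Sum>j<N. p j)"
proof -
  have "(\<lambda>q. \<Sum>j<N. q j) ` (quot_rel L N a `` {p}) = {\<Sum>j<N. p j}"
    using assms by (auto simp: quot_rel_iff_sum)
  then show ?thesis by (simp add: sum_class_def)
qed

lemma ker_eta_combination:
  fixes p q :: "nat \<Rightarrow> 'k::field_char_0 ^ 3"
  assumes "p \<in> ker_eta L N a" "q \<in> ker_eta L N a"
  shows "(\<lambda>j. c *s p j + q j) \<in> ker_eta L N a"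
  using assms by (auto simp: ker_eta_def ktuples_def sum.distrib vec.scale_sum_right[symmetric])

text \<open>
  The element \<open>R\<close> has the value 1 at all vertices, so it lies in every slab.
\<close>

lemma ker_eta_sum_Rperp:
  fixes p :: "nat \<Rightarrow> 'k::field_char_0 ^ 3"
  assumes "p \<in> ker_eta L N a"
  shows "(\<Sum>j<N. p j) \<in> Rperp"
proof -
  have "Rstar \<in> K2 L N a j" if "j < N" for j
    using that height by (simp add: mem_K2 mem_L)
  then have "(ext Rstar :: 'k ^ 3) \<in> vec.span (ext ` (\<Inter>j<N. K2 L N a j))"
    by (intro vec.span_base imageI) auto
  then show ?thesis using assms unfolding ker_eta_def Rperp_def by blast
qed

lemma sum_class_inj:
  "inj_on (sum_class N) (ker_mod_im L N a :: (nat \<Rightarrow> 'k::field_char_0 ^ 3) set set)"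
proof (rule inj_onI)
  fix X Y :: "(nat \<Rightarrow> 'k ^ 3) set"
  assume "X \<in> ker_mod_im L N a" "Y \<in> ker_mod_im L N a" and eq: "sum_class N X = sum_class N Y"
  then obtain p q where p: "p \<in> ker_eta L N a" "X = quot_rel L N a `` {p}"
    and q: "q \<in> ker_eta L N a" "Y = quot_rel L N a `` {q}"
    unfolding ker_mod_im_def quotient_def by blast
  then have "(\<Sum>j<N. p j) = (\<Sum>j<N. q j)" using eq by (simp add: sum_class_eq)
  then show "X = Y" using p q by (auto simp: quot_rel_iff_sum)
qed

text \<open>
  An element vanishing on the edge is a multiple of the normal \<open>n\<close>; taking the value 1 somewhere, it is
  \<open>n\<close> or \<open>-n\<close>, and \<open>n\<close> computes the determinant.
\<close>

lemma unimodular_if_edge_at_height_1: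
  assumes i: "i < N" and z: "pairing (a i) r = 0" "pairing (a (Suc i mod N)) r = 0"
    and k: "pairing (a k) r = 1"
  shows "\<bar>det (vector [a i, a (Suc i mod N), a k] :: int ^ 3 ^ 3)\<bar> = 1"
proof -
  obtain n v u w where fr: "edge_frame N a i n v u w" using frame[OF i] by blast
  then have "r = pairing w r *s n + pairing (a (Suc i mod N)) r *s v + pairing (a i) r *s u"
    unfolding edge_frame_def by blast
  then have "r = pairing w r *s n" using z by simp
  then have "pairing w r * pairing (a k) n = 1" using k by (metis pairing_simps(10))
  then have "\<bar>pairing (a k) n\<bar> = 1" by (auto simp: zmult_eq_1_iff)
  moreover have "\<bar>det (vector [a i, a (Suc i mod N), a k] :: int ^ 3 ^ 3)\<bar> = \<bar>pairing (a k) n\<bar>"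
    using fr unfolding edge_frame_def by blast
  ultimately show ?thesis by simp
qed

text \<open>
  An element \<open>r\<close> vanishing on the edge and equal to 1 at some vertex is, up to sign, the primitive normal
  \<open>n\<close>.  So \<open>d\<close> is orthogonal to \<open>n\<close> and to \<open>R\<close>, which by the dual basis leaves only multiples of the
  primitive edge direction.
\<close>

lemma edge_direction_generates:
  assumes i: "i < N" and z: "pairing (a i) r = 0" "pairing (a (Suc i mod N)) r = 0"
    and k: "pairing (a k) r = 1" and d: "d $ 3 = 0" "pairing d r = 0"
  shows "\<exists>m. d = m *s dvec N a i"
proof -
  obtain n v u w where fr: "edge_frame N a i n v u w" using frame[OF i] by blast
  let ?i' = "Suc i mod N"
  have coord: "x = pairing w x *s n + pairing (a ?i') x *s v + pairing (a i) x *s u" for x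
    using fr unfolding edge_frame_def by blast
  have r: "r = pairing w r *s n" using coord[of r] z by simp
  then have "pairing w r * pairing (a k) n = 1" using k by (metis pairing_simps(10))
  then have "pairing w r \<noteq> 0" by auto
  moreover have "pairing w r * pairing d n = 0" using d(2) r by (metis pairing_simps(10))
  ultimately have dn: "pairing d n = 0" by simp
  have "pairing (a i) Rstar = 1" "pairing (a ?i') Rstar = 1" using height i nxt_lt[OF i] by simp_all
  then have "Rstar = pairing w Rstar *s n + v + u" using coord[of Rstar] by simp
  then have "pairing d Rstar = pairing w Rstar * pairing d n + pairing d v + pairing d u"
    by (metis pairing_simps(4) pairing_simps(10))
  then have du: "pairing d u = - pairing d v" using dn d(1) by simp
  have "pairing (d - pairing d v *s dvec N a i) x = 0" for x
  proof -
    have "pairing d x = pairing d v * (pairing (a ?i') x - pairing (a i) x)"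
      by (subst coord[of x]) (simp add: dn du algebra_simps)
    then show ?thesis by (simp add: dvec_def algebra_simps)
  qed
  then have "d - pairing d v *s dvec N a i = 0" by (rule lat_pairing_nondegenerate)
  then show ?thesis by auto
qed

text \<open>
  The opposite edges \<open>i\<close> and \<open>i + 2\<close> are parallel and both primitive, hence their directions agree up
  to sign.  They cannot be equal: seen from the edge between them the polygon would lie on both sides.
\<close>

lemma parallelogram_if_width_1:
  assumes N: "N = 4" and i: "i < N"
    and z: "pairing (a i) r = 0" "pairing (a (Suc i mod N)) r = 0"
    and o: "pairing (a (Suc (Suc i) mod N)) r = 1" "pairing (a (Suc (Suc (Suc i)) mod N)) r = 1"
  shows "a i + a (Suc (Suc i) mod N) = a (Suc i mod N) + a (Suc (Suc (Suc i)) mod N)"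
proof -
  let ?i1 = "Suc i mod N" and ?i2 = "Suc (Suc i) mod N" and ?i3 = "Suc (Suc (Suc i)) mod N"
  have lt: "?i1 < N" "?i2 < N" "?i3 < N" using N by auto
  have d0: "dvec N a i = a ?i1 - a i" and d2: "dvec N a ?i2 = a ?i3 - a ?i2"
    and nx: "Suc ?i1 mod N = ?i2" "Suc ?i2 mod N = ?i3"
    by (simp_all add: dvec_def mod_Suc_eq)
  have "\<exists>m. dvec N a ?i2 = m *s dvec N a i"
    using lt height z o by (intro edge_direction_generates[OF i z o(1)]) (simp_all add: d2)
  then obtain m where m: "dvec N a ?i2 = m *s dvec N a i" by blast
  have "\<exists>m'. dvec N a i = m' *s dvec N a ?i2"
    using lt i height z o
    by (intro edge_direction_generates[OF lt(2), where r = "Rstar - r" and k = i]) (simp_all add: d0 nx)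
  then obtain m' where m': "dvec N a i = m' *s dvec N a ?i2" by blast
  obtain n v u w where fr: "edge_frame N a i n v u w" using frame[OF i] by blast
  have "pairing (dvec N a i) v = 1" using fr unfolding edge_frame_def d0 by simp
  moreover have "pairing (dvec N a i) v = m' * (m * pairing (dvec N a i) v)"
    using m m' by (metis pairing_simps(9))
  ultimately have "m' * m = 1" by simp
  then have "m = 1 \<or> m = - 1" by (auto simp: zmult_eq_1_iff)
  moreover have "m \<noteq> 1"
  proof
    assume "m = 1"
    obtain n v u w where fr: "edge_frame N a ?i1 n v u w" using frame[OF lt(1)] by blast
    have ne: "i \<noteq> ?i1" "i \<noteq> ?i2" "?i3 \<noteq> ?i1" "?i3 \<noteq> ?i2"
    proof -
      have "i = 0 \<or> i = 1 \<or> i = 2 \<or> i = 3" using i N by auto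
      then show "i \<noteq> ?i1" "i \<noteq> ?i2" "?i3 \<noteq> ?i1" "?i3 \<noteq> ?i2" unfolding N by (elim disjE; simp)+
    qed
    have "0 < pairing (a i) n" "0 < pairing (a ?i3) n"
      using fr i lt ne unfolding edge_frame_def nx by (metis order_le_less)+
    moreover have "pairing (a ?i1) n = 0" "pairing (a ?i2) n = 0"
      using fr lt unfolding edge_frame_def nx by blast+
    moreover have "pairing (dvec N a ?i2) n = pairing (dvec N a i) n" using m \<open>m = 1\<close> by simp
    ultimately show False unfolding d0 d2 by simp
  qed
  ultimately have "a ?i3 - a ?i2 = - (a ?i1 - a i)" using m unfolding d0 d2 by (simp add: vec_eq_iff)
  then show ?thesis by (simp add: algebra_simps)
qed

text \<open>
  The element takes the values 0 and 1 on the vertices.  Since both \<open>r\<close> and \<open>R - r\<close> are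
  in the monoid, nonadjacent vertices have different values; for five or more vertices this is impossible,
  because no two neighbours in the closed sequence \<open>0, 2, 4, 1, 3, 0\<close> of odd length are adjacent.  The remaining cases are
  triangles with an edge on one level and parallelograms with an edge on each level.
\<close>

lemma width_1_smooth_or_conifold:
  assumes r: "\<And>j. j < N \<Longrightarrow> r \<in> K2 L N a j" and "r \<noteq> 0" "r \<noteq> Rstar"
  shows "smooth_cone N a \<or> conifold_cone N a"
proof -
  define p where "p l = pairing (a l) r" for l
  have N0: "0 < N" using N_ge_3 by simp
  have rL: "r \<in> L" using r[OF N0] by (simp add: mem_K2[OF N0])
  have p01: "p l = 0 \<or> p l = 1" if "l < N" for l
    using rL r[OF that] that unfolding mem_K2[OF that] mem_L p_def by force
  have r'L: "Rstar - r \<in> L" unfolding mem_L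
  proof (intro allI impI)
    fix l assume "l < N"
    then show "0 \<le> pairing (a l) (Rstar - r)" using p01[of l] height[of l] by (auto simp: p_def)
  qed
  have adj: "p l \<noteq> p k" if lk: "l < N" "k < N" "l \<noteq> k" "k \<noteq> Suc l mod N" "l \<noteq> Suc k mod N" for l k
  proof
    assume eq: "p l = p k"
    show False
    proof (cases "p l = 0")
      case True
      then show False using common_zero_adjacent[OF rL lk(1,2,3)] eq lk \<open>r \<noteq> 0\<close> by (simp add: p_def)
    next
      case False
      then have "p l = 1" using p01[OF lk(1)] by simp
      then show False
        using common_zero_adjacent[OF r'L lk(1,2,3)] eq lk \<open>r \<noteq> Rstar\<close> height by (simp add: p_def)
    qed
  qed
  have "N < 5"
  proof (rule ccontr)
    assume "\<not> N < 5"
    then have N5: "5 \<le> N" by simp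
    have S: "Suc 4 mod N \<noteq> 1" "Suc 4 mod N \<noteq> 2" "Suc 3 mod N = 4" "Suc 2 mod N = 3" "Suc 1 mod N = 2"
      "Suc 0 mod N = 1"
      using N5 by (cases "N = 5"; simp)+
    have "p 0 \<noteq> p 2" "p 0 \<noteq> p 3" "p 1 \<noteq> p 3" "p 1 \<noteq> p 4" "p 2 \<noteq> p 4"
      using N5 S by (intro adj; simp)+
    then show False using p01[of 0] p01[of 1] p01[of 2] p01[of 3] p01[of 4] N5 by auto
  qed
  then consider "N = 3" | "N = 4" using N_ge_3 by linarith
  then show ?thesis
  proof cases
    case 1
    have e: "Suc 0 mod 3 = (1::nat)" "Suc (Suc 0) mod 3 = (2::nat)" "Suc 1 mod 3 = (2::nat)"
      "Suc (Suc 1) mod 3 = (0::nat)" "Suc 2 mod 3 = (0::nat)" "Suc (Suc 2) mod 3 = (1::nat)" by simp_all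
    have key: "\<bar>det (vector [a 0, a 1, a 2] :: int ^ 3 ^ 3)\<bar> = 1"
      if "i < 3" "pairing (a i) x = 0" "pairing (a (Suc i mod 3)) x = 0" "pairing (a (Suc (Suc i) mod 3)) x = 1" for i x
    proof -
      have "\<bar>det (vector [a i, a (Suc i mod 3), a (Suc (Suc i) mod 3)] :: int ^ 3 ^ 3)\<bar> = 1"
        using unimodular_if_edge_at_height_1[of i x "Suc (Suc i) mod 3"] that 1 by simp
      moreover have "i = 0 \<or> i = 1 \<or> i = 2" using that by auto
      ultimately show ?thesis by (elim disjE) (simp_all only: e det_cyclic[where x = "a 0" and y = "a 1" and z = "a 2"])
    qed
    have const: False if "p 0 = p 1" "p 1 = p 2"
    proof -
      have zero: "x = 0" if "pairing (a 0) x = 0" "pairing (a 1) x = 0" "pairing (a 2) x = 0" for x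
      proof -
        obtain n v u w where fr: "edge_frame N a 0 n v u w" using frame[OF N0] by blast
        have "x = pairing w x *s n + pairing (a (Suc 0 mod N)) x *s v + pairing (a 0) x *s u"
          using fr unfolding edge_frame_def by blast
        then have x: "x = pairing w x *s n" using that 1 by simp
        have "pairing (a 2) n \<noteq> 0" using fr 1 unfolding edge_frame_def by auto
        moreover have "pairing w x * pairing (a 2) n = 0" using that(3) x by (metis pairing_simps(10))
        ultimately have "pairing w x = 0" by simp
        then show "x = 0" using x by simp
      qed
      have "p 0 = 0 \<or> p 0 = 1" using p01[OF N0] .
      then show False
      proof
        assume "p 0 = 0"
        then show False using zero[of r] that \<open>r \<noteq> 0\<close> by (simp add: p_def)
      next
        assume "p 0 = 1"
        then have "Rstar - r = 0" using zero[of "Rstar - r"] that height 1 by (simp add: p_def)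
        then show False using \<open>r \<noteq> Rstar\<close> by simp
      qed
    qed
    have h: "a 0 $ 3 = 1" "a 1 $ 3 = 1" "a 2 $ 3 = 1" using height 1 by simp_all
    have P: "p 0 = 0 \<or> p 0 = 1" "p 1 = 0 \<or> p 1 = 1" "p 2 = 0 \<or> p 2 = 1" using p01 1 by simp_all
    consider "p 0 = 0" "p 1 = 0" "p 2 = 1" | "p 0 = 1" "p 1 = 1" "p 2 = 0"
      | "p 1 = 0" "p 2 = 0" "p 0 = 1" | "p 1 = 1" "p 2 = 1" "p 0 = 0"
      | "p 2 = 0" "p 0 = 0" "p 1 = 1" | "p 2 = 1" "p 0 = 1" "p 1 = 0"
      using P const by metis
    then have "\<bar>det (vector [a 0, a 1, a 2] :: int ^ 3 ^ 3)\<bar> = 1"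
    proof cases
      case 1 then show ?thesis using key[of 0 r, unfolded e] by (simp add: p_def)
    next
      case 2 then show ?thesis using key[of 0 "Rstar - r", unfolded e] h by (simp add: p_def)
    next
      case 3 then show ?thesis using key[of 1 r, unfolded e] by (simp add: p_def)
    next
      case 4 then show ?thesis using key[of 1 "Rstar - r", unfolded e] h by (simp add: p_def)
    next
      case 5 then show ?thesis using key[of 2 r, unfolded e] by (simp add: p_def)
    next
      case 6 then show ?thesis using key[of 2 "Rstar - r", unfolded e] h by (simp add: p_def)
    qed
    then show ?thesis using 1 by (simp add: smooth_cone_def)
  next
    case 2
    have e: "Suc 0 mod 4 = (1::nat)" "Suc 1 mod 4 = (2::nat)" "Suc 2 mod 4 = (3::nat)" "Suc 3 mod 4 = (0::nat)"
      "Suc (Suc 0) mod 4 = (2::nat)" "Suc (Suc 1) mod 4 = (3::nat)" "Suc (Suc 2) mod 4 = (0::nat)"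
      "Suc (Suc 3) mod 4 = (1::nat)" "Suc (Suc (Suc 0)) mod 4 = (3::nat)" "Suc (Suc (Suc 1)) mod 4 = (0::nat)"
      "Suc (Suc (Suc 2)) mod 4 = (1::nat)" "Suc (Suc (Suc 3)) mod 4 = (2::nat)"
      by simp_all
    have ne: "p 0 \<noteq> p 2" "p 1 \<noteq> p 3" using 2 by (intro adj; simp)+
    have P: "p 0 = 0 \<or> p 0 = 1" "p 1 = 0 \<or> p 1 = 1" "p 2 = 0 \<or> p 2 = 1" "p 3 = 0 \<or> p 3 = 1"
      using p01 2 by simp_all
    have key: "a i + a (Suc (Suc i) mod 4) = a (Suc i mod 4) + a (Suc (Suc (Suc i)) mod 4) \<and>
        \<bar>det (vector [a i, a (Suc i mod 4), a (Suc (Suc i) mod 4)] :: int ^ 3 ^ 3)\<bar> = 1"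
      if "i < 4" "p i = 0" "p (Suc i mod 4) = 0" "p (Suc (Suc i) mod 4) = 1" "p (Suc (Suc (Suc i)) mod 4) = 1" for i
      using parallelogram_if_width_1[of i r] unimodular_if_edge_at_height_1[of i r "Suc (Suc i) mod 4"] that 2
      by (simp add: p_def)
    consider "p 0 = 0" "p 1 = 0" "p 2 = 1" "p 3 = 1" | "p 0 = 1" "p 1 = 0" "p 2 = 0" "p 3 = 1"
      | "p 0 = 1" "p 1 = 1" "p 2 = 0" "p 3 = 0" | "p 0 = 0" "p 1 = 1" "p 2 = 1" "p 3 = 0"
      using P ne by metis
    then have "a 0 + a 2 = a 1 + a 3 \<and> \<bar>det (vector [a 0, a 1, a 2] :: int ^ 3 ^ 3)\<bar> = 1"
    proof cases
      case 1 then show ?thesis using key[of 0, unfolded e] by simp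
    next
      case 2
      then have k: "a 1 + a 3 = a 2 + a 0" "\<bar>det (vector [a 1, a 2, a 3] :: int ^ 3 ^ 3)\<bar> = 1"
        using key[of 1, unfolded e] by simp_all
      then have a3: "a 3 = a 2 + a 0 - a 1" by (simp add: algebra_simps)
      show ?thesis
        using k(2) unfolding a3 det_parallelogram by simp
    next
      case 3
      then have k: "a 2 + a 0 = a 3 + a 1" "\<bar>det (vector [a 2, a 3, a 0] :: int ^ 3 ^ 3)\<bar> = 1"
        using key[of 2, unfolded e] by simp_all
      then have a3: "a 3 = a 2 + a 0 - a 1" by (simp add: algebra_simps)
      show ?thesis
        using k(2) unfolding a3 det_parallelogram by simp
    next
      case 4
      then have k: "a 3 + a 1 = a 0 + a 2" "\<bar>det (vector [a 3, a 0, a 1] :: int ^ 3 ^ 3)\<bar> = 1"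
        using key[of 3, unfolded e] by simp_all
      then have a3: "a 3 = a 2 + a 0 - a 1" by (simp add: algebra_simps)
      show ?thesis
        using k(2) unfolding a3 det_parallelogram by simp
    qed
    then show ?thesis using 2 by (simp add: conifold_cone_def)
  qed
qed

text \<open>
  The kernel of \<open>\<eta>\<close> imposes on the sum only orthogonality to \<open>0\<close> and \<open>R\<close>, so an element of \<open>R\<^sup>\<bottom>\<close> may be
  placed in a single component.
\<close>

lemma sum_class_surj:
  assumes "\<not> smooth_cone N a" "\<not> conifold_cone N a"
  shows "Rperp \<subseteq> sum_class N ` (ker_mod_im L N a :: (nat \<Rightarrow> 'k::field_char_0 ^ 3) set set)"
proof
  fix b :: "'k ^ 3" assume b: "b \<in> Rperp"
  define p where "p j = (if j = 0 then b else 0)" for j :: nat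
  have N0: "0 < N" using N_ge_3 by simp
  have sum: "(\<Sum>j<N. p j) = b" using N0 by (simp add: p_def)
  have "p \<in> ker_eta L N a"
  proof (rule mem_ker_etaI)
    show "p \<in> ktuples N" using N0 by (simp add: p_def ktuples_def)
  next
    fix r assume "\<And>j. j < N \<Longrightarrow> r \<in> K2 L N a j"
    then have "r = 0 \<or> r = Rstar" using width_1_smooth_or_conifold assms by blast
    then show "pairing (\<Sum>j<N. p j) (ext r) = 0" unfolding sum using b by (auto simp: Rperp_def)
  qed
  then show "b \<in> sum_class N ` ker_mod_im L N a"
    using sum_class_eq sum unfolding ker_mod_im_def by (metis imageI quotientI)
qed

end

lemma isolated_gorenstein_cone_toric_monoid:
  assumes "lattice_polygon P N a" "isolated N a"
  shows "isolated_gorenstein_cone N a (toric_monoid P)"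
  using lattice_polygon_ge_3[OF assms(1)] mem_toric_monoid_iff[OF assms(1)]
    lattice_polygon_height[OF assms(1)] primitive_edge_frame[OF assms]
  by unfold_locales

theorem corollary4p5:
  fixes P :: "(real ^ 3) set" and a :: "nat \<Rightarrow> int ^ 3" and N :: nat
    and \<Lambda> :: "(int ^ 3) set"
  assumes "lattice_polygon P N a"
    and "isolated N a"
    and "\<Lambda> = toric_monoid P"
  shows
    "(\<forall>t\<in>(Vspace N a :: (nat \<Rightarrow> 'k::field_char_0) set). \<forall>s\<in>Vspace N a.
        T1_ident \<Lambda> N a (Vrel N a `` {t}) \<in> T_space \<Lambda> 1 Rstar \<and>
        T1_ident \<Lambda> N a (Vrel N a `` {s}) \<in> T_space \<Lambda> 1 Rstar \<and>
        cup \<Lambda> Rstar Rstar (T1_ident \<Lambda> N a (Vrel N a `` {t})) (T1_ident \<Lambda> N a (Vrel N a `` {s}))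
          \<in> T_space \<Lambda> 2 (Rstar + Rstar) \<and>
        prod_tuple N a t s \<in> ker_eta \<Lambda> N a \<and>
        T2_ident \<Lambda> N a (cup \<Lambda> Rstar Rstar
            (T1_ident \<Lambda> N a (Vrel N a `` {t})) (T1_ident \<Lambda> N a (Vrel N a `` {s})))
          = quot_rel \<Lambda> N a `` {prod_tuple N a t s} \<and>
        altmann_cup N a t s \<in> Rperp \<and>
        sum_class N (T2_ident \<Lambda> N a (cup \<Lambda> Rstar Rstar
            (T1_ident \<Lambda> N a (Vrel N a `` {t})) (T1_ident \<Lambda> N a (Vrel N a `` {s}))))
          = altmann_cup N a t s) \<and>
     (\<forall>p\<in>(ker_eta \<Lambda> N a :: (nat \<Rightarrow> 'k ^ 3) set).
        sum_class N (quot_rel \<Lambda> N a `` {p}) = (\<Sum>j<N. p j)) \<and>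
     (\<forall>p\<in>(ker_eta \<Lambda> N a :: (nat \<Rightarrow> 'k ^ 3) set). \<forall>q\<in>ker_eta \<Lambda> N a. \<forall>c.
        sum_class N (quot_rel \<Lambda> N a `` {\<lambda>j. c *s p j + q j})
          = c *s sum_class N (quot_rel \<Lambda> N a `` {p}) + sum_class N (quot_rel \<Lambda> N a `` {q})) \<and>
     inj_on (sum_class N) (ker_mod_im \<Lambda> N a :: (nat \<Rightarrow> 'k ^ 3) set set) \<and>
     sum_class N ` (ker_mod_im \<Lambda> N a :: (nat \<Rightarrow> 'k ^ 3) set set) \<subseteq> Rperp \<and>
     (\<not> smooth_cone N a \<longrightarrow> \<not> conifold_cone N a \<longrightarrow>
        bij_betw (sum_class N) (ker_mod_im \<Lambda> N a :: (nat \<Rightarrow> 'k ^ 3) set set) Rperp)"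
proof -
  interpret isolated_gorenstein_cone N a \<Lambda>
    unfolding assms(3) by (rule isolated_gorenstein_cone_toric_monoid[OF assms(1,2)])
  have Rperp: "sum_class N ` (ker_mod_im \<Lambda> N a :: (nat \<Rightarrow> 'k ^ 3) set set) \<subseteq> Rperp"
    unfolding ker_mod_im_def quotient_def using sum_class_eq ker_eta_sum_Rperp by fastforce
  have altmann: "altmann_cup N a t s = (\<Sum>j<N. prod_tuple N a t s j)" for t s :: "nat \<Rightarrow> 'k"
    by (simp add: altmann_cup_def prod_tuple_def)
  show ?thesis
  proof (intro conjI ballI allI impI)
    fix t s :: "nat \<Rightarrow> 'k" assume t: "t \<in> Vspace N a" and s: "s \<in> Vspace N a"
    note cup = cup_product_formula[OF t s]
    show "T1_ident \<Lambda> N a (Vrel N a `` {t}) \<in> T_space \<Lambda> 1 Rstar" by (rule cup(1))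
    show "T1_ident \<Lambda> N a (Vrel N a `` {s}) \<in> T_space \<Lambda> 1 Rstar"
      by (rule cup_product_formula(1)[OF s t])
    show "cup \<Lambda> Rstar Rstar (T1_ident \<Lambda> N a (Vrel N a `` {t})) (T1_ident \<Lambda> N a (Vrel N a `` {s}))
        \<in> T_space \<Lambda> 2 (Rstar + Rstar)" by (rule cup(2))
    show "prod_tuple N a t s \<in> ker_eta \<Lambda> N a" by (rule cup(3))
    show "T2_ident \<Lambda> N a (cup \<Lambda> Rstar Rstar
        (T1_ident \<Lambda> N a (Vrel N a `` {t})) (T1_ident \<Lambda> N a (Vrel N a `` {s})))
      = quot_rel \<Lambda> N a `` {prod_tuple N a t s}" by (rule cup(4))
    show "altmann_cup N a t s \<in> Rperp" unfolding altmann by (rule ker_eta_sum_Rperp[OF cup(3)])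
    show "sum_class N (T2_ident \<Lambda> N a (cup \<Lambda> Rstar Rstar
        (T1_ident \<Lambda> N a (Vrel N a `` {t})) (T1_ident \<Lambda> N a (Vrel N a `` {s}))))
      = altmann_cup N a t s"
      unfolding cup(4) altmann by (rule sum_class_eq[OF cup(3)])
  next
    fix p :: "nat \<Rightarrow> 'k ^ 3" assume "p \<in> ker_eta \<Lambda> N a"
    then show "sum_class N (quot_rel \<Lambda> N a `` {p}) = (\<Sum>j<N. p j)" by (rule sum_class_eq)
  next
    fix p q :: "nat \<Rightarrow> 'k ^ 3" and c assume pq: "p \<in> ker_eta \<Lambda> N a" "q \<in> ker_eta \<Lambda> N a"
    show "sum_class N (quot_rel \<Lambda> N a `` {\<lambda>j. c *s p j + q j})
        = c *s sum_class N (quot_rel \<Lambda> N a `` {p}) + sum_class N (quot_rel \<Lambda> N a `` {q})"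
      unfolding sum_class_eq[OF pq(1)] sum_class_eq[OF pq(2)] sum_class_eq[OF ker_eta_combination[OF pq]]
      by (simp add: sum.distrib vec.scale_sum_right)
  next
    assume "\<not> smooth_cone N a" "\<not> conifold_cone N a"
    then show "bij_betw (sum_class N) (ker_mod_im \<Lambda> N a :: (nat \<Rightarrow> 'k ^ 3) set set) Rperp"
      unfolding bij_betw_def using sum_class_inj Rperp sum_class_surj by blast
  qed (use sum_class_inj Rperp in blast)+
qed

end
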